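(* Let $H=\{H_\alpha\}_{\alpha\in\pi}$ be a Hopf $\pi$-coalgebra with $\dim H_\alpha<\infty$ for all $\alpha\in\pi$, let $(C,\sigma)$ be a left $\pi$-coisotropic quantum subgroup of $H$, and let $(V,\rho)$ and $(W,\psi)$ be left $\pi$-comodules over $C$. Then $$Coind(\rho\oplus\psi)\cong Coind(\rho)\oplus Coind(\psi)$$ as right $\pi$-comodules over $H$.
   Context: Everything is over a field $K$: spaces, linear maps, tensor products; algebras are associative and unital. $I$ denotes identity maps. $\pi$ is a group with neutral element $1$. A $\pi$-coalgebra is a family $C=\{C_\alpha\}_{\alpha\in\pi}$ of $K$-spaces with linear maps $\Delta_{\alpha,\beta}:C_{\alpha\beta}\to C_\alpha\otimes C_\beta$ and $\epsilon:C_1\to K$ such that $(\Delta_{\alpha,\beta}\otimes I)\Delta_{\alpha\beta,\gamma}=(I\otimes\Delta_{\beta,\gamma})\Delta_{\alpha,\beta\gamma}$ and $(\epsilon\otimes I)\Delta_{1,\alpha}=I=(I\otimes\epsilon)\Delta_{\alpha,1}$ (identifying $K\otimes C_\alpha\cong C_\alpha\cong C_\alpha\otimes K$). A Hopf $\pi$-coalgebra is a $\pi$-coalgebra $H=\{H_\alpha\}$ with linear maps $S_\alpha:H_\alpha\to H_{\alpha^{-1}}$ such that each $H_\alpha$ is an algebra (multiplication $\mu_\alpha$, unit $1_\alpha$), all $\Delta_{\alpha,\beta}$ and $\epsilon$ are algebra maps, and $\mu_\alpha(S_{\alpha^{-1}}\otimes I)\Delta_{\alpha^{-1},\alpha}=1_\alpha\epsilon=\mu_\alpha(I\otimes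 S_{\alpha^{-1}})\Delta_{\alpha,\alpha^{-1}}$. A right $\pi$-comodule $(M,\theta)$ over a $\pi$-coalgebra $C$ is a family $M=\{M_\alpha\}$ of spaces with linear maps $\theta_{\alpha,\beta}:M_{\alpha\beta}\to M_\alpha\otimes C_\beta$ such that $(\theta_{\alpha,\beta}\otimes I)\theta_{\alpha\beta,\gamma}=(I\otimes\Delta_{\beta,\gamma})\theta_{\alpha,\beta\gamma}$ and $(I\otimes\epsilon)\theta_{\alpha,1}=I$. A left $\pi$-comodule $(V,\rho)$ over $C$ is a family $V=\{V_\alpha\}$ with linear maps $\rho_{\alpha,\beta}:V_{\alpha\beta}\to C_\alpha\otimes V_\beta$ such that $(\Delta_{\alpha,\beta}\otimes I)\rho_{\alpha\beta,\gamma}=(I\otimes\rho_{\beta,\gamma})\rho_{\alpha,\beta\gamma}$ and $(\epsilon\otimes I)\rho_{1,\alpha}=I$. (Canonical identifications with tensoring by $K$ are used.) Right $\pi$-comodules $(M,\theta)$, $(N,\theta')$ are equivalent (isomorphic, $\cong$) if there is a family of vector space isomorphisms $F_\alpha:M_\alpha\to N_\alpha$ with $\theta'_{\alpha,\beta}F_{\alpha\beta}=(F_\alpha\otimes I)\theta_{\alpha,\beta}$ for all $\alpha,\beta\in\pi$. Direct sums: with $P$ the natural projections and $l$ the natural inclusions of the summands, the direct sum of left $\pi$-comodules $(V,\rho),(W,\psi)$ is $\{V_\alpha\oplus W_\alpha\}$ with $(\rho\oplus\psi)_{\alpha,\beta}=(I_{C_\alpha}\otimes l^V_\beta)\rho_{\alpha,\beta}P^V_{\alpha\beta}+(I_{C_\alpha}\otimes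 l^W_\beta)\psi_{\alpha,\beta}P^W_{\alpha\beta}$; the direct sum of right $\pi$-comodules $(M,\theta),(N,\theta')$ is $\{M_\alpha\oplus N_\alpha\}$ with coaction $(l^M_\alpha\otimes I)\theta_{\alpha,\beta}P^M_{\alpha\beta}+(l^N_\alpha\otimes I)\theta'_{\alpha,\beta}P^N_{\alpha\beta}$. A left $\pi$-coisotropic quantum subgroup of $H$ is a pair $(C,\sigma)$ where $C$ is a $\pi$-coalgebra, each $C_\alpha$ carries a left $H_\alpha$-module structure, and $\sigma=\{\sigma_\alpha:H_\alpha\to C_\alpha\}$ is a family of surjective linear maps such that each $\sigma_\alpha$ is left $H_\alpha$-linear, $\Delta^C_{\alpha,\beta}\sigma_{\alpha\beta}=(\sigma_\alpha\otimes\sigma_\beta)\Delta^H_{\alpha,\beta}$, and $\epsilon^C\sigma_1=\epsilon^H$. For a left $\pi$-comodule $(V,\rho)$ over $C$, the coinduced representation $Coind(\rho)$ is the right $\pi$-comodule over $H$ with $Coind(\rho)_\alpha=\{F\in Hom_K(V_1,H_\alpha): L_{1,\alpha}F=(I_{C_1}\otimes F)\rho_{1,1}\}$, where $L_{1,\alpha}=(\sigma_1\otimes I_{H_\alpha})\Delta^H_{1,\alpha}$, and coaction $Coind(\rho)_{\alpha\beta}\to Coind(\rho)_\alpha\otimes H_\beta$, $F\mapsto\sum_i[(I_{H_\alpha}\otimes g_i^\beta)\Delta^H_{\alpha,\beta}F]\otimes e_i^\beta$, where $\{e_i^\beta\},\{g_i^\beta\}$ are dual bases of $H_\beta$ and $H_\beta^*$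 and $H_\alpha\otimes K\cong H_\alpha$. *)

theory Defs
  imports "Jordan_Normal_Form.Missing_VectorSpace" "HOL-Algebra.AbelCoset"
begin

text \<open>Spaces are \<^const>\<open>vectorspace\<close>s of HOL-Algebra records. Structure maps are only
  constrained on carriers. The \<^const>\<open>mult\<close> and \<^const>\<open>one\<close> fields of a record that is
  merely a space (and not an algebra) carry no meaning.\<close>

section \<open>Tensor products over a field\<close>

type_synonym ('k, 'm, 'n) tensor = "('m \<times> 'n \<Rightarrow> 'k) set"

definition ground_space :: "('k, 'r) ring_scheme \<Rightarrow> ('k, 'k) module" where
  "ground_space K = \<lparr>carrier = carrier K, mult = mult K, one = one K,
     zero = zero K, add = add K, smult = mult K\<rparr>"

definition free_space :: "('k, 'r) ring_scheme \<Rightarrow> 'x set \<Rightarrow> ('k, 'x \<Rightarrow> 'k) module" where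
  "free_space K X = (ring.func_space K X)
     \<lparr>carrier := {f \<in> X \<rightarrow>\<^sub>E carrier K. finite {x \<in> X. f x \<noteq> \<zero>\<^bsub>K\<^esub>}}\<rparr>"

definition free_gen :: "('k, 'r) ring_scheme \<Rightarrow> 'x set \<Rightarrow> 'x \<Rightarrow> ('x \<Rightarrow> 'k)" where
  "free_gen K X x = (\<lambda>y\<in>X. if y = x then \<one>\<^bsub>K\<^esub> else \<zero>\<^bsub>K\<^esub>)"

definition quot_space :: "('k, 'a) module \<Rightarrow> 'a set \<Rightarrow> ('k, 'a set) module" where
  "quot_space M U = \<lparr>carrier = a_rcosets\<^bsub>M\<^esub> U,
     mult = (\<lambda>X Y. U), one = U, zero = U,
     add = (\<lambda>X Y. X <+>\<^bsub>M\<^esub> Y),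
     smult = (\<lambda>c X. \<Union>x\<in>X. U +>\<^bsub>M\<^esub> (c \<odot>\<^bsub>M\<^esub> x))\<rparr>"

definition pair_space ::
  "('k, 'r) ring_scheme \<Rightarrow> ('k, 'm) module \<Rightarrow> ('k, 'n) module \<Rightarrow> ('k, 'm \<times> 'n \<Rightarrow> 'k) module" where
  "pair_space K M N = free_space K (carrier M \<times> carrier N)"

definition bilinear_relations ::
  "('k, 'r) ring_scheme \<Rightarrow> ('k, 'm) module \<Rightarrow> ('k, 'n) module \<Rightarrow> ('m \<times> 'n \<Rightarrow> 'k) set" where
  "bilinear_relations K M N =
    (let P = pair_space K M N; d = (\<lambda>m n. free_gen K (carrier M \<times> carrier N) (m, n)) in
      {d (m \<oplus>\<^bsub>M\<^esub> m') n \<ominus>\<^bsub>P\<^esub> d m n \<ominus>\<^bsub>P\<^esub> d m' n | m m' n.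
         m \<in> carrier M \<and> m' \<in> carrier M \<and> n \<in> carrier N}
    \<union> {d m (n \<oplus>\<^bsub>N\<^esub> n') \<ominus>\<^bsub>P\<^esub> d m n \<ominus>\<^bsub>P\<^esub> d m n' | m n n'.
         m \<in> carrier M \<and> n \<in> carrier N \<and> n' \<in> carrier N}
    \<union> {d (c \<odot>\<^bsub>M\<^esub> m) n \<ominus>\<^bsub>P\<^esub> c \<odot>\<^bsub>P\<^esub> d m n | c m n.
         c \<in> carrier K \<and> m \<in> carrier M \<and> n \<in> carrier N}
    \<union> {d m (c \<odot>\<^bsub>N\<^esub> n) \<ominus>\<^bsub>P\<^esub> c \<odot>\<^bsub>P\<^esub> d m n | c m n.
         c \<in> carrier K \<and> m \<in> carrier M \<and> n \<in> carrier N})"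

definition tensor_null ::
  "('k, 'r) ring_scheme \<Rightarrow> ('k, 'm) module \<Rightarrow> ('k, 'n) module \<Rightarrow> ('m \<times> 'n \<Rightarrow> 'k) set" where
  "tensor_null K M N = module.span K (pair_space K M N) (bilinear_relations K M N)"

definition tensor_space ::
  "('k, 'r) ring_scheme \<Rightarrow> ('k, 'm) module \<Rightarrow> ('k, 'n) module
    \<Rightarrow> ('k, ('k, 'm, 'n) tensor) module" where
  "tensor_space K M N = quot_space (pair_space K M N) (tensor_null K M N)"

definition tens ::
  "('k, 'r) ring_scheme \<Rightarrow> ('k, 'm) module \<Rightarrow> ('k, 'n) module \<Rightarrow> 'm \<Rightarrow> 'n \<Rightarrow> ('k, 'm, 'n) tensor" where
  "tens K M N m n =
     tensor_null K M N +>\<^bsub>pair_space K M N\<^esub> free_gen K (carrier M \<times> carrier N) (m, n)"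

text \<open>The linear map on the tensor product induced by a bilinear map \<open>b\<close>; it is made
  \<^const>\<open>extensional\<close> only so that it is unique as a HOL function.\<close>

definition tensor_lift ::
  "('k, 'r) ring_scheme \<Rightarrow> ('k, 'm) module \<Rightarrow> ('k, 'n) module \<Rightarrow> ('k, 'p) module
    \<Rightarrow> ('m \<Rightarrow> 'n \<Rightarrow> 'p) \<Rightarrow> ('k, 'm, 'n) tensor \<Rightarrow> 'p" where
  "tensor_lift K M N P b =
    (THE h. h \<in> module_hom K (tensor_space K M N) P
          \<and> h \<in> extensional (carrier (tensor_space K M N))
          \<and> (\<forall>m\<in>carrier M. \<forall>n\<in>carrier N. h (tens K M N m n) = b m n))"

text \<open>\<open>f \<otimes> g : M \<otimes> N \<rightarrow> M' \<otimes> N'\<close>\<close>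

definition tensor_map ::
  "('k, 'r) ring_scheme \<Rightarrow> ('k, 'm) module \<Rightarrow> ('k, 'n) module
    \<Rightarrow> ('k, 'p) module \<Rightarrow> ('k, 'q) module
    \<Rightarrow> ('m \<Rightarrow> 'p) \<Rightarrow> ('n \<Rightarrow> 'q) \<Rightarrow> ('k, 'm, 'n) tensor \<Rightarrow> ('k, 'p, 'q) tensor" where
  "tensor_map K M N M' N' f g =
    tensor_lift K M N (tensor_space K M' N') (\<lambda>m n. tens K M' N' (f m) (g n))"

text \<open>\<open>(M \<otimes> N) \<otimes> P \<rightarrow> M \<otimes> (N \<otimes> P)\<close>\<close>

definition tensor_assoc ::
  "('k, 'r) ring_scheme \<Rightarrow> ('k, 'm) module \<Rightarrow> ('k, 'n) module \<Rightarrow> ('k, 'p) module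
    \<Rightarrow> ('k, ('k, 'm, 'n) tensor, 'p) tensor \<Rightarrow> ('k, 'm, ('k, 'n, 'p) tensor) tensor" where
  "tensor_assoc K M N P =
    (let T = tensor_space K M (tensor_space K N P) in
      tensor_lift K (tensor_space K M N) P T
        (\<lambda>t p. tensor_lift K M N T (\<lambda>m n. tens K M (tensor_space K N P) m (tens K N P n p)) t))"

definition tensor_lunit ::
  "('k, 'r) ring_scheme \<Rightarrow> ('k, 'm) module \<Rightarrow> ('k, 'k, 'm) tensor \<Rightarrow> 'm" where
  "tensor_lunit K M = tensor_lift K (ground_space K) M M (\<lambda>c m. c \<odot>\<^bsub>M\<^esub> m)"

definition tensor_runit ::
  "('k, 'r) ring_scheme \<Rightarrow> ('k, 'm) module \<Rightarrow> ('k, 'm, 'k) tensor \<Rightarrow> 'm" where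
  "tensor_runit K M = tensor_lift K M (ground_space K) M (\<lambda>m c. c \<odot>\<^bsub>M\<^esub> m)"

text \<open>Not the library locale \<^locale>\<open>algebra\<close>, which is commutative.\<close>

definition k_algebra :: "('k, 'r) ring_scheme \<Rightarrow> ('k, 'a) module \<Rightarrow> bool" where
  "k_algebra K A \<longleftrightarrow> vectorspace K A \<and> ring A \<and>
    (\<forall>c\<in>carrier K. \<forall>x\<in>carrier A. \<forall>y\<in>carrier A.
       (c \<odot>\<^bsub>A\<^esub> x) \<otimes>\<^bsub>A\<^esub> y = c \<odot>\<^bsub>A\<^esub> (x \<otimes>\<^bsub>A\<^esub> y) \<and>
       x \<otimes>\<^bsub>A\<^esub> (c \<odot>\<^bsub>A\<^esub> y) = c \<odot>\<^bsub>A\<^esub> (x \<otimes>\<^bsub>A\<^esub> y))"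

definition algebra_hom ::
  "('k, 'r) ring_scheme \<Rightarrow> ('k, 'a) module \<Rightarrow> ('k, 'b) module \<Rightarrow> ('a \<Rightarrow> 'b) set" where
  "algebra_hom K A B = module_hom K A B \<inter> ring_hom A B"

text \<open>The tensor product of algebras, \<open>(a \<otimes> b)(a' \<otimes> b') = aa' \<otimes> bb'\<close>.\<close>

definition tensor_algebra ::
  "('k, 'r) ring_scheme \<Rightarrow> ('k, 'a) module \<Rightarrow> ('k, 'b) module
    \<Rightarrow> ('k, ('k, 'a, 'b) tensor) module" where
  "tensor_algebra K A B = (let T = tensor_space K A B in
    T\<lparr>mult := (\<lambda>s t. tensor_lift K A B T (\<lambda>a b.
                 tensor_lift K A B T (\<lambda>a' b'. tens K A B (a \<otimes>\<^bsub>A\<^esub> a') (b \<otimes>\<^bsub>B\<^esub> b')) t) s),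
      one := tens K A B \<one>\<^bsub>A\<^esub> \<one>\<^bsub>B\<^esub>\<rparr>)"


section \<open>Hopf group coalgebras, comodules, coisotropic quantum subgroups\<close>

text \<open>The group \<open>\<pi>\<close> is \<open>G\<close> below.\<close>

locale pi_coalgebra =
  fixes G :: "('g, 's) monoid_scheme" (structure)
    and K :: "('k, 'r) ring_scheme"
    and C :: "'g \<Rightarrow> ('k, 'c) module"
    and \<Delta> :: "'g \<Rightarrow> 'g \<Rightarrow> 'c \<Rightarrow> ('k, 'c, 'c) tensor"
    and \<epsilon> :: "'c \<Rightarrow> 'k"
  assumes group: "group G"
    and field: "field K"
    and space: "\<alpha> \<in> carrier G \<Longrightarrow> vectorspace K (C \<alpha>)"
    and comult_hom: "\<lbrakk>\<alpha> \<in> carrier G; \<beta> \<in> carrier G\<rbrakk> \<Longrightarrow>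
      \<Delta> \<alpha> \<beta> \<in> module_hom K (C (\<alpha> \<otimes> \<beta>)) (tensor_space K (C \<alpha>) (C \<beta>))"
    and counit_hom: "\<epsilon> \<in> module_hom K (C \<one>) (ground_space K)"
    and coassoc: "\<lbrakk>\<alpha> \<in> carrier G; \<beta> \<in> carrier G; \<gamma> \<in> carrier G; x \<in> carrier (C (\<alpha> \<otimes> \<beta> \<otimes> \<gamma>))\<rbrakk> \<Longrightarrow>
      tensor_assoc K (C \<alpha>) (C \<beta>) (C \<gamma>)
        (tensor_map K (C (\<alpha> \<otimes> \<beta>)) (C \<gamma>) (tensor_space K (C \<alpha>) (C \<beta>)) (C \<gamma>) (\<Delta> \<alpha> \<beta>) id
          (\<Delta> (\<alpha> \<otimes> \<beta>) \<gamma> x))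
      = tensor_map K (C \<alpha>) (C (\<beta> \<otimes> \<gamma>)) (C \<alpha>) (tensor_space K (C \<beta>) (C \<gamma>)) id (\<Delta> \<beta> \<gamma>)
          (\<Delta> \<alpha> (\<beta> \<otimes> \<gamma>) x)"
    and counit_left: "\<lbrakk>\<alpha> \<in> carrier G; x \<in> carrier (C \<alpha>)\<rbrakk> \<Longrightarrow>
      tensor_lunit K (C \<alpha>)
        (tensor_map K (C \<one>) (C \<alpha>) (ground_space K) (C \<alpha>) \<epsilon> id (\<Delta> \<one> \<alpha> x)) = x"
    and counit_right: "\<lbrakk>\<alpha> \<in> carrier G; x \<in> carrier (C \<alpha>)\<rbrakk> \<Longrightarrow>
      tensor_runit K (C \<alpha>)
        (tensor_map K (C \<alpha>) (C \<one>) (C \<alpha>) (ground_space K) id \<epsilon> (\<Delta> \<alpha> \<one> x)) = x"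

locale hopf_pi_coalgebra = pi_coalgebra G K H \<Delta> \<epsilon>
  for G :: "('g, 's) monoid_scheme" (structure)
    and K :: "('k, 'r) ring_scheme"
    and H :: "'g \<Rightarrow> ('k, 'h) module"
    and \<Delta> :: "'g \<Rightarrow> 'g \<Rightarrow> 'h \<Rightarrow> ('k, 'h, 'h) tensor"
    and \<epsilon> :: "'h \<Rightarrow> 'k" +
  fixes S :: "'g \<Rightarrow> 'h \<Rightarrow> 'h"
  assumes algebra: "\<alpha> \<in> carrier G \<Longrightarrow> k_algebra K (H \<alpha>)"
    and antipode_hom: "\<alpha> \<in> carrier G \<Longrightarrow> S \<alpha> \<in> module_hom K (H \<alpha>) (H (inv \<alpha>))"
    and comult_algebra_hom: "\<lbrakk>\<alpha> \<in> carrier G; \<beta> \<in> carrier G\<rbrakk> \<Longrightarrow>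
      \<Delta> \<alpha> \<beta> \<in> algebra_hom K (H (\<alpha> \<otimes> \<beta>)) (tensor_algebra K (H \<alpha>) (H \<beta>))"
    and counit_algebra_hom: "\<epsilon> \<in> algebra_hom K (H \<one>) (ground_space K)"
    and antipode_left: "\<lbrakk>\<alpha> \<in> carrier G; x \<in> carrier (H \<one>)\<rbrakk> \<Longrightarrow>
      tensor_lift K (H \<alpha>) (H \<alpha>) (H \<alpha>) (mult (H \<alpha>))
        (tensor_map K (H (inv \<alpha>)) (H \<alpha>) (H \<alpha>) (H \<alpha>) (S (inv \<alpha>)) id (\<Delta> (inv \<alpha>) \<alpha> x))
      = \<epsilon> x \<odot>\<^bsub>H \<alpha>\<^esub> \<one>\<^bsub>H \<alpha>\<^esub>"
    and antipode_right: "\<lbrakk>\<alpha> \<in> carrier G; x \<in> carrier (H \<one>)\<rbrakk> \<Longrightarrow>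
      tensor_lift K (H \<alpha>) (H \<alpha>) (H \<alpha>) (mult (H \<alpha>))
        (tensor_map K (H \<alpha>) (H (inv \<alpha>)) (H \<alpha>) (H \<alpha>) id (S (inv \<alpha>)) (\<Delta> \<alpha> (inv \<alpha>) x))
      = \<epsilon> x \<odot>\<^bsub>H \<alpha>\<^esub> \<one>\<^bsub>H \<alpha>\<^esub>"

locale right_pi_comodule = pi_coalgebra G K C \<Delta> \<epsilon>
  for G :: "('g, 's) monoid_scheme" (structure)
    and K :: "('k, 'r) ring_scheme"
    and C :: "'g \<Rightarrow> ('k, 'c) module"
    and \<Delta> :: "'g \<Rightarrow> 'g \<Rightarrow> 'c \<Rightarrow> ('k, 'c, 'c) tensor"
    and \<epsilon> :: "'c \<Rightarrow> 'k" +
  fixes M :: "'g \<Rightarrow> ('k, 'm) module"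
    and \<theta> :: "'g \<Rightarrow> 'g \<Rightarrow> 'm \<Rightarrow> ('k, 'm, 'c) tensor"
  assumes comodule_space: "\<alpha> \<in> carrier G \<Longrightarrow> vectorspace K (M \<alpha>)"
    and coact_hom: "\<lbrakk>\<alpha> \<in> carrier G; \<beta> \<in> carrier G\<rbrakk> \<Longrightarrow>
      \<theta> \<alpha> \<beta> \<in> module_hom K (M (\<alpha> \<otimes> \<beta>)) (tensor_space K (M \<alpha>) (C \<beta>))"
    and coact_assoc: "\<lbrakk>\<alpha> \<in> carrier G; \<beta> \<in> carrier G; \<gamma> \<in> carrier G; x \<in> carrier (M (\<alpha> \<otimes> \<beta> \<otimes> \<gamma>))\<rbrakk> \<Longrightarrow>
      tensor_assoc K (M \<alpha>) (C \<beta>) (C \<gamma>)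
        (tensor_map K (M (\<alpha> \<otimes> \<beta>)) (C \<gamma>) (tensor_space K (M \<alpha>) (C \<beta>)) (C \<gamma>) (\<theta> \<alpha> \<beta>) id
          (\<theta> (\<alpha> \<otimes> \<beta>) \<gamma> x))
      = tensor_map K (M \<alpha>) (C (\<beta> \<otimes> \<gamma>)) (M \<alpha>) (tensor_space K (C \<beta>) (C \<gamma>)) id (\<Delta> \<beta> \<gamma>)
          (\<theta> \<alpha> (\<beta> \<otimes> \<gamma>) x)"
    and coact_counit: "\<lbrakk>\<alpha> \<in> carrier G; x \<in> carrier (M \<alpha>)\<rbrakk> \<Longrightarrow>
      tensor_runit K (M \<alpha>)
        (tensor_map K (M \<alpha>) (C \<one>) (M \<alpha>) (ground_space K) id \<epsilon> (\<theta> \<alpha> \<one> x)) = x"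

locale left_pi_comodule = pi_coalgebra G K C \<Delta> \<epsilon>
  for G :: "('g, 's) monoid_scheme" (structure)
    and K :: "('k, 'r) ring_scheme"
    and C :: "'g \<Rightarrow> ('k, 'c) module"
    and \<Delta> :: "'g \<Rightarrow> 'g \<Rightarrow> 'c \<Rightarrow> ('k, 'c, 'c) tensor"
    and \<epsilon> :: "'c \<Rightarrow> 'k" +
  fixes V :: "'g \<Rightarrow> ('k, 'v) module"
    and \<rho> :: "'g \<Rightarrow> 'g \<Rightarrow> 'v \<Rightarrow> ('k, 'c, 'v) tensor"
  assumes comodule_space: "\<alpha> \<in> carrier G \<Longrightarrow> vectorspace K (V \<alpha>)"
    and coact_hom: "\<lbrakk>\<alpha> \<in> carrier G; \<beta> \<in> carrier G\<rbrakk> \<Longrightarrow>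
      \<rho> \<alpha> \<beta> \<in> module_hom K (V (\<alpha> \<otimes> \<beta>)) (tensor_space K (C \<alpha>) (V \<beta>))"
    and coact_assoc: "\<lbrakk>\<alpha> \<in> carrier G; \<beta> \<in> carrier G; \<gamma> \<in> carrier G; x \<in> carrier (V (\<alpha> \<otimes> \<beta> \<otimes> \<gamma>))\<rbrakk> \<Longrightarrow>
      tensor_assoc K (C \<alpha>) (C \<beta>) (V \<gamma>)
        (tensor_map K (C (\<alpha> \<otimes> \<beta>)) (V \<gamma>) (tensor_space K (C \<alpha>) (C \<beta>)) (V \<gamma>) (\<Delta> \<alpha> \<beta>) id
          (\<rho> (\<alpha> \<otimes> \<beta>) \<gamma> x))
      = tensor_map K (C \<alpha>) (V (\<beta> \<otimes> \<gamma>)) (C \<alpha>) (tensor_space K (C \<beta>) (V \<gamma>)) id (\<rho> \<beta> \<gamma>)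
          (\<rho> \<alpha> (\<beta> \<otimes> \<gamma>) x)"
    and coact_counit: "\<lbrakk>\<alpha> \<in> carrier G; x \<in> carrier (V \<alpha>)\<rbrakk> \<Longrightarrow>
      tensor_lunit K (V \<alpha>)
        (tensor_map K (C \<one>) (V \<alpha>) (ground_space K) (V \<alpha>) \<epsilon> id (\<rho> \<one> \<alpha> x)) = x"

definition right_pi_comodule_iso ::
  "('g, 's) monoid_scheme \<Rightarrow> ('k, 'r) ring_scheme \<Rightarrow> ('g \<Rightarrow> ('k, 'c) module)
    \<Rightarrow> ('g \<Rightarrow> 'g \<Rightarrow> 'c \<Rightarrow> ('k, 'c, 'c) tensor) \<Rightarrow> ('c \<Rightarrow> 'k)
    \<Rightarrow> ('g \<Rightarrow> ('k, 'm) module) \<Rightarrow> ('g \<Rightarrow> 'g \<Rightarrow> 'm \<Rightarrow> ('k, 'm, 'c) tensor)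
    \<Rightarrow> ('g \<Rightarrow> ('k, 'n) module) \<Rightarrow> ('g \<Rightarrow> 'g \<Rightarrow> 'n \<Rightarrow> ('k, 'n, 'c) tensor) \<Rightarrow> bool" where
  "right_pi_comodule_iso G K C \<Delta> \<epsilon> M \<theta> N \<theta>' \<longleftrightarrow>
    right_pi_comodule G K C \<Delta> \<epsilon> M \<theta> \<and> right_pi_comodule G K C \<Delta> \<epsilon> N \<theta>' \<and>
    (\<exists>F. (\<forall>\<alpha>\<in>carrier G. F \<alpha> \<in> module_hom K (M \<alpha>) (N \<alpha>)
                       \<and> bij_betw (F \<alpha>) (carrier (M \<alpha>)) (carrier (N \<alpha>)))
       \<and> (\<forall>\<alpha>\<in>carrier G. \<forall>\<beta>\<in>carrier G. \<forall>x\<in>carrier (M (\<alpha> \<otimes>\<^bsub>G\<^esub> \<beta>)).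
            \<theta>' \<alpha> \<beta> (F (\<alpha> \<otimes>\<^bsub>G\<^esub> \<beta>) x)
            = tensor_map K (M \<alpha>) (C \<beta>) (N \<alpha>) (C \<beta>) (F \<alpha>) id (\<theta> \<alpha> \<beta> x)))"

definition direct_sum_family ::
  "('g \<Rightarrow> ('k, 'v) module) \<Rightarrow> ('g \<Rightarrow> ('k, 'w) module) \<Rightarrow> 'g \<Rightarrow> ('k, 'v \<times> 'w) module" where
  "direct_sum_family V W = (\<lambda>\<alpha>. direct_sum (V \<alpha>) (W \<alpha>))"

definition left_sum_coact ::
  "('k, 'r) ring_scheme \<Rightarrow> ('g \<Rightarrow> ('k, 'c) module)
    \<Rightarrow> ('g \<Rightarrow> ('k, 'v) module) \<Rightarrow> ('g \<Rightarrow> 'g \<Rightarrow> 'v \<Rightarrow> ('k, 'c, 'v) tensor)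
    \<Rightarrow> ('g \<Rightarrow> ('k, 'w) module) \<Rightarrow> ('g \<Rightarrow> 'g \<Rightarrow> 'w \<Rightarrow> ('k, 'c, 'w) tensor)
    \<Rightarrow> 'g \<Rightarrow> 'g \<Rightarrow> 'v \<times> 'w \<Rightarrow> ('k, 'c, 'v \<times> 'w) tensor" where
  "left_sum_coact K C V \<rho> W \<psi> \<alpha> \<beta> x =
    tensor_map K (C \<alpha>) (V \<beta>) (C \<alpha>) (direct_sum (V \<beta>) (W \<beta>))
      id (inj1 (V \<beta>) (W \<beta>)) (\<rho> \<alpha> \<beta> (fst x))
    \<oplus>\<^bsub>tensor_space K (C \<alpha>) (direct_sum (V \<beta>) (W \<beta>))\<^esub>
    tensor_map K (C \<alpha>) (W \<beta>) (C \<alpha>) (direct_sum (V \<beta>) (W \<beta>))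
      id (inj2 (V \<beta>) (W \<beta>)) (\<psi> \<alpha> \<beta> (snd x))"

definition right_sum_coact ::
  "('k, 'r) ring_scheme \<Rightarrow> ('g \<Rightarrow> ('k, 'c) module)
    \<Rightarrow> ('g \<Rightarrow> ('k, 'm) module) \<Rightarrow> ('g \<Rightarrow> 'g \<Rightarrow> 'm \<Rightarrow> ('k, 'm, 'c) tensor)
    \<Rightarrow> ('g \<Rightarrow> ('k, 'n) module) \<Rightarrow> ('g \<Rightarrow> 'g \<Rightarrow> 'n \<Rightarrow> ('k, 'n, 'c) tensor)
    \<Rightarrow> 'g \<Rightarrow> 'g \<Rightarrow> 'm \<times> 'n \<Rightarrow> ('k, 'm \<times> 'n, 'c) tensor" where
  "right_sum_coact K C M \<theta> N \<theta>' \<alpha> \<beta> x =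
    tensor_map K (M \<alpha>) (C \<beta>) (direct_sum (M \<alpha>) (N \<alpha>)) (C \<beta>)
      (inj1 (M \<alpha>) (N \<alpha>)) id (\<theta> \<alpha> \<beta> (fst x))
    \<oplus>\<^bsub>tensor_space K (direct_sum (M \<alpha>) (N \<alpha>)) (C \<beta>)\<^esub>
    tensor_map K (N \<alpha>) (C \<beta>) (direct_sum (M \<alpha>) (N \<alpha>)) (C \<beta>)
      (inj2 (M \<alpha>) (N \<alpha>)) id (\<theta>' \<alpha> \<beta> (snd x))"

locale left_coisotropic_subgroup =
  H: hopf_pi_coalgebra G K H \<Delta>H \<epsilon>H S + C: pi_coalgebra G K C \<Delta>C \<epsilon>C
  for G :: "('g, 's) monoid_scheme" (structure)
    and K :: "('k, 'r) ring_scheme"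
    and H :: "'g \<Rightarrow> ('k, 'h) module"
    and \<Delta>H :: "'g \<Rightarrow> 'g \<Rightarrow> 'h \<Rightarrow> ('k, 'h, 'h) tensor"
    and \<epsilon>H :: "'h \<Rightarrow> 'k"
    and S :: "'g \<Rightarrow> 'h \<Rightarrow> 'h"
    and C :: "'g \<Rightarrow> ('k, 'c) module"
    and \<Delta>C :: "'g \<Rightarrow> 'g \<Rightarrow> 'c \<Rightarrow> ('k, 'c, 'c) tensor"
    and \<epsilon>C :: "'c \<Rightarrow> 'k" +
  fixes act :: "'g \<Rightarrow> 'h \<Rightarrow> 'c \<Rightarrow> 'c"
    and \<sigma> :: "'g \<Rightarrow> 'h \<Rightarrow> 'c"
  assumes act_hom: "\<lbrakk>\<alpha> \<in> carrier G; h \<in> carrier (H \<alpha>)\<rbrakk> \<Longrightarrow>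
      act \<alpha> h \<in> module_hom K (C \<alpha>) (C \<alpha>)"
    and act_add: "\<lbrakk>\<alpha> \<in> carrier G; h \<in> carrier (H \<alpha>); h' \<in> carrier (H \<alpha>); c \<in> carrier (C \<alpha>)\<rbrakk> \<Longrightarrow>
      act \<alpha> (h \<oplus>\<^bsub>H \<alpha>\<^esub> h') c = act \<alpha> h c \<oplus>\<^bsub>C \<alpha>\<^esub> act \<alpha> h' c"
    and act_smult: "\<lbrakk>\<alpha> \<in> carrier G; k \<in> carrier K; h \<in> carrier (H \<alpha>); c \<in> carrier (C \<alpha>)\<rbrakk> \<Longrightarrow>
      act \<alpha> (k \<odot>\<^bsub>H \<alpha>\<^esub> h) c = k \<odot>\<^bsub>C \<alpha>\<^esub> act \<alpha> h c"
    and act_mult: "\<lbrakk>\<alpha> \<in> carrier G; h \<in> carrier (H \<alpha>); h' \<in> carrier (H \<alpha>); c \<in> carrier (C \<alpha>)\<rbrakk> \<Longrightarrow>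
      act \<alpha> (h \<otimes>\<^bsub>H \<alpha>\<^esub> h') c = act \<alpha> h (act \<alpha> h' c)"
    and act_one: "\<lbrakk>\<alpha> \<in> carrier G; c \<in> carrier (C \<alpha>)\<rbrakk> \<Longrightarrow> act \<alpha> \<one>\<^bsub>H \<alpha>\<^esub> c = c"
    and proj_hom: "\<alpha> \<in> carrier G \<Longrightarrow> \<sigma> \<alpha> \<in> module_hom K (H \<alpha>) (C \<alpha>)"
    and proj_surj: "\<alpha> \<in> carrier G \<Longrightarrow> \<sigma> \<alpha> ` carrier (H \<alpha>) = carrier (C \<alpha>)"
    and proj_act: "\<lbrakk>\<alpha> \<in> carrier G; h \<in> carrier (H \<alpha>); x \<in> carrier (H \<alpha>)\<rbrakk> \<Longrightarrow>
      \<sigma> \<alpha> (h \<otimes>\<^bsub>H \<alpha>\<^esub> x) = act \<alpha> h (\<sigma> \<alpha> x)"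
    and proj_comult: "\<lbrakk>\<alpha> \<in> carrier G; \<beta> \<in> carrier G; x \<in> carrier (H (\<alpha> \<otimes> \<beta>))\<rbrakk> \<Longrightarrow>
      \<Delta>C \<alpha> \<beta> (\<sigma> (\<alpha> \<otimes> \<beta>) x)
      = tensor_map K (H \<alpha>) (H \<beta>) (C \<alpha>) (C \<beta>) (\<sigma> \<alpha>) (\<sigma> \<beta>) (\<Delta>H \<alpha> \<beta> x)"
    and proj_counit: "x \<in> carrier (H \<one>) \<Longrightarrow> \<epsilon>C (\<sigma> \<one> x) = \<epsilon>H x"


section \<open>Coinduced representations\<close>

text \<open>\<open>Hom\<^sub>K(V, W)\<close>; maps are \<^const>\<open>extensional\<close> so that two of them are equal as
  soon as they agree on the carrier of \<open>V\<close>.\<close>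

definition hom_space ::
  "('k, 'r) ring_scheme \<Rightarrow> ('k, 'v) module \<Rightarrow> ('k, 'w) module \<Rightarrow> ('k, 'v \<Rightarrow> 'w) module" where
  "hom_space K V W = \<lparr>carrier = module_hom K V W \<inter> extensional (carrier V),
     mult = (\<lambda>f g. \<lambda>v\<in>carrier V. \<zero>\<^bsub>W\<^esub>),
     one = (\<lambda>v\<in>carrier V. \<zero>\<^bsub>W\<^esub>),
     zero = (\<lambda>v\<in>carrier V. \<zero>\<^bsub>W\<^esub>),
     add = (\<lambda>f g. \<lambda>v\<in>carrier V. f v \<oplus>\<^bsub>W\<^esub> g v),
     smult = (\<lambda>c f. \<lambda>v\<in>carrier V. c \<odot>\<^bsub>W\<^esub> f v)\<rparr>"

text \<open>\<open>g b\<close> is the element dual to \<open>b \<in> B\<close>; the basis is indexed by itself.\<close>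

definition dual_bases ::
  "('k, 'r) ring_scheme \<Rightarrow> ('k, 'h) module \<Rightarrow> 'h set \<Rightarrow> ('h \<Rightarrow> 'h \<Rightarrow> 'k) \<Rightarrow> bool" where
  "dual_bases K V B g \<longleftrightarrow> finite B \<and> vectorspace.basis K V B
     \<and> (\<forall>b\<in>B. g b \<in> module_hom K V (ground_space K))
     \<and> (\<forall>b\<in>B. \<forall>b'\<in>B. g b b' = (if b = b' then \<one>\<^bsub>K\<^esub> else \<zero>\<^bsub>K\<^esub>))"

definition coind_L ::
  "('g, 's) monoid_scheme \<Rightarrow> ('k, 'r) ring_scheme \<Rightarrow> ('g \<Rightarrow> ('k, 'h) module)
    \<Rightarrow> ('g \<Rightarrow> 'g \<Rightarrow> 'h \<Rightarrow> ('k, 'h, 'h) tensor) \<Rightarrow> ('g \<Rightarrow> ('k, 'c) module) \<Rightarrow> ('g \<Rightarrow> 'h \<Rightarrow> 'c)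
    \<Rightarrow> 'g \<Rightarrow> 'h \<Rightarrow> ('k, 'c, 'h) tensor" where
  "coind_L G K H \<Delta>H C \<sigma> \<alpha> x =
    tensor_map K (H \<one>\<^bsub>G\<^esub>) (H \<alpha>) (C \<one>\<^bsub>G\<^esub>) (H \<alpha>) (\<sigma> \<one>\<^bsub>G\<^esub>) id (\<Delta>H \<one>\<^bsub>G\<^esub> \<alpha> x)"

definition coind ::
  "('g, 's) monoid_scheme \<Rightarrow> ('k, 'r) ring_scheme \<Rightarrow> ('g \<Rightarrow> ('k, 'h) module)
    \<Rightarrow> ('g \<Rightarrow> 'g \<Rightarrow> 'h \<Rightarrow> ('k, 'h, 'h) tensor) \<Rightarrow> ('g \<Rightarrow> ('k, 'c) module) \<Rightarrow> ('g \<Rightarrow> 'h \<Rightarrow> 'c)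
    \<Rightarrow> ('g \<Rightarrow> ('k, 'v) module) \<Rightarrow> ('g \<Rightarrow> 'g \<Rightarrow> 'v \<Rightarrow> ('k, 'c, 'v) tensor)
    \<Rightarrow> 'g \<Rightarrow> ('k, 'v \<Rightarrow> 'h) module" where
  "coind G K H \<Delta>H C \<sigma> V \<rho> \<alpha> = (hom_space K (V \<one>\<^bsub>G\<^esub>) (H \<alpha>))
    \<lparr>carrier := {F \<in> carrier (hom_space K (V \<one>\<^bsub>G\<^esub>) (H \<alpha>)). \<forall>v\<in>carrier (V \<one>\<^bsub>G\<^esub>).
       coind_L G K H \<Delta>H C \<sigma> \<alpha> (F v)
       = tensor_map K (C \<one>\<^bsub>G\<^esub>) (V \<one>\<^bsub>G\<^esub>) (C \<one>\<^bsub>G\<^esub>) (H \<alpha>) id F (\<rho> \<one>\<^bsub>G\<^esub> \<one>\<^bsub>G\<^esub> v)}\<rparr>"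

text \<open>The coaction \<open>F \<mapsto> \<Sum>\<^sub>i ((I \<otimes> g\<^sub>i) \<Delta> F) \<otimes> e\<^sub>i\<close>, with \<open>(B \<beta>, g \<beta>)\<close> a pair of dual bases
  for \<open>H \<beta>\<close>.\<close>

definition coind_coact ::
  "('g, 's) monoid_scheme \<Rightarrow> ('k, 'r) ring_scheme \<Rightarrow> ('g \<Rightarrow> ('k, 'h) module)
    \<Rightarrow> ('g \<Rightarrow> 'g \<Rightarrow> 'h \<Rightarrow> ('k, 'h, 'h) tensor) \<Rightarrow> ('g \<Rightarrow> ('k, 'c) module) \<Rightarrow> ('g \<Rightarrow> 'h \<Rightarrow> 'c)
    \<Rightarrow> ('g \<Rightarrow> 'h set) \<Rightarrow> ('g \<Rightarrow> 'h \<Rightarrow> 'h \<Rightarrow> 'k)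
    \<Rightarrow> ('g \<Rightarrow> ('k, 'v) module) \<Rightarrow> ('g \<Rightarrow> 'g \<Rightarrow> 'v \<Rightarrow> ('k, 'c, 'v) tensor)
    \<Rightarrow> 'g \<Rightarrow> 'g \<Rightarrow> ('v \<Rightarrow> 'h) \<Rightarrow> ('k, 'v \<Rightarrow> 'h, 'h) tensor" where
  "coind_coact G K H \<Delta>H C \<sigma> B g V \<rho> \<alpha> \<beta> F =
    (\<Oplus>\<^bsub>tensor_space K (coind G K H \<Delta>H C \<sigma> V \<rho> \<alpha>) (H \<beta>)\<^esub> b \<in> B \<beta>.
       tens K (coind G K H \<Delta>H C \<sigma> V \<rho> \<alpha>) (H \<beta>)
         (\<lambda>v\<in>carrier (V \<one>\<^bsub>G\<^esub>).
            tensor_runit K (H \<alpha>)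
              (tensor_map K (H \<alpha>) (H \<beta>) (H \<alpha>) (ground_space K) id (g \<beta> b) (\<Delta>H \<alpha> \<beta> (F v))))
         b)"

end

theory Submission
  imports Defs
begin

text \<open>Coinduction is contravariantly functorial: a linear map \<open>j : X\<^sub>1 \<rightarrow> D\<^sub>1\<close> that commutes with the
  coactions at \<open>(1, 1)\<close> induces, by precomposition, a map of right comodules from the representation
  coinduced by \<open>D\<close> to the one coinduced by \<open>X\<close>. For \<open>D = V \<oplus> W\<close>, restriction along the two
  inclusions gives the isomorphism, and its inverse comes from restriction along the two projections.

  An element of \<open>Coind(\<rho>)\<^sub>\<alpha> \<otimes> H\<^sub>\<beta>\<close> is determined by its images under the evaluations at the vectors
  \<open>v \<in> V\<^sub>1\<close>, because \<open>H\<^sub>\<beta>\<close> has a finite dual basis, and the coaction of \<open>F\<close> evaluates at \<open>v\<close> to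
  \<open>\<Delta>(F v)\<close>. This reduces the comodule axioms and the naturality in \<open>j\<close> to properties of \<open>\<Delta>\<close>.
  The direct sum of the coinduced representations inherits the comodule axioms along the
  isomorphism.\<close>

section \<open>Linear maps and quotient spaces\<close>

text \<open>The coaction is defined through a chosen basis of \<open>H \<beta>\<close>, whereas its
  evaluation at \<open>v\<close> is free of any choice. The link between the two is contraction of
  the second leg with a functional (\<open>slice\<close>): contracting with the dual functionals
  recovers the coefficients of a tensor, and contraction commutes with evaluation because the two
  act on different legs.

  Coassociativity lives in a threefold tensor product, whereas evaluations are shown to separate
  only the elements of \<open>Coind \<otimes> H\<close>. The third leg is therefore removed by
  contraction: coassociativity of \<open>H\<close> is used in the form \<open>slice_comult\<close>,
  in which no associator is left, and an expansion of the third leg in the basis puts the contracted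
  identities together again.

  Tensors are cosets of finitely supported functions, and \<open>tensor_lift\<close> is a definite
  description. Nothing can be said about an induced map before existence and uniqueness in the
  universal property are established; after that, identities between linear maps are tested on pure
  tensors.\<close>

lemma module_homI:
  assumes "\<And>x. x \<in> carrier M \<Longrightarrow> f x \<in> carrier N"
    and "\<And>x y. \<lbrakk>x \<in> carrier M; y \<in> carrier M\<rbrakk> \<Longrightarrow> f (x \<oplus>\<^bsub>M\<^esub> y) = f x \<oplus>\<^bsub>N\<^esub> f y"
    and "\<And>c x. \<lbrakk>c \<in> carrier K; x \<in> carrier M\<rbrakk> \<Longrightarrow> f (c \<odot>\<^bsub>M\<^esub> x) = c \<odot>\<^bsub>N\<^esub> f x"
  shows "f \<in> module_hom K M N"
  using assms by (auto simp: module_hom_def)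

lemma module_hom_in: "\<lbrakk>f \<in> module_hom K M N; x \<in> carrier M\<rbrakk> \<Longrightarrow> f x \<in> carrier N"
  by (auto simp: module_hom_def)

lemma mod_homI: "\<lbrakk>module K M; module K N; f \<in> module_hom K M N\<rbrakk> \<Longrightarrow> mod_hom K M N f"
  by (simp add: mod_hom_def mod_hom_axioms_def)

lemma module_hom_zero:
  "\<lbrakk>module K M; module K N; f \<in> module_hom K M N\<rbrakk> \<Longrightarrow> f \<zero>\<^bsub>M\<^esub> = \<zero>\<^bsub>N\<^esub>"
  by (rule mod_hom.f0_is_0) (rule mod_homI)

lemma module_hom_minus:
  "\<lbrakk>module K M; module K N; f \<in> module_hom K M N; x \<in> carrier M; y \<in> carrier M\<rbrakk>
    \<Longrightarrow> f (x \<ominus>\<^bsub>M\<^esub> y) = f x \<ominus>\<^bsub>N\<^esub> f y"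
  by (rule mod_hom.f_minus) (rule mod_homI)

lemma module_hom_finsum:
  assumes M: "module K M" and N: "module K N" and f: "f \<in> module_hom K M N"
    and x: "\<And>i. i \<in> A \<Longrightarrow> x i \<in> carrier M"
  shows "f (\<Oplus>\<^bsub>M\<^esub>i\<in>A. x i) = (\<Oplus>\<^bsub>N\<^esub>i\<in>A. f (x i))"
proof -
  interpret M: module K M by fact
  interpret N: module K N by fact
  show ?thesis
  proof (cases "finite A")
    case True
    then show ?thesis using x
      by (induct A) (simp_all add: module_hom_zero[OF M N f] module_hom_add[OF f]
          module_hom_in[OF f] Pi_def)
  next
    \<comment> \<open>A sum over an infinite index set is zero by convention, so only preservation
      of zero is left.\<close>
    case False
    then show ?thesis by (simp add: module_hom_zero[OF M N f])
  qed
qed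

lemma module_hom_comp:
  "\<lbrakk>f \<in> module_hom K M N; g \<in> module_hom K N P\<rbrakk> \<Longrightarrow> (\<lambda>x. g (f x)) \<in> module_hom K M P"
  by (intro module_homI) (simp_all add: module_hom_in module_hom_add module_hom_smult)

lemma module_hom_id: "id \<in> module_hom K M M"
  by (auto simp: module_hom_def)

text \<open>Linearity concerns values on the carrier only, so it passes between a function and its
  restriction. That \<open>M\<close> is a module keeps sums and multiples inside the set where the
  two functions agree.\<close>

lemma module_hom_cong:
  "\<lbrakk>\<And>x. x \<in> carrier M \<Longrightarrow> f x = g x; module K M; g \<in> module_hom K M N\<rbrakk> \<Longrightarrow> f \<in> module_hom K M N"
  by (rule module_homI)
    (simp_all add: module_hom_in module_hom_add module_hom_smult module.smult_closed
      abelian_monoid.a_closed abelian_group.axioms(1) module.axioms(2))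

lemma module_hom_plus:
  assumes "module K N" "f \<in> module_hom K M N" "g \<in> module_hom K M N"
  shows "(\<lambda>x. f x \<oplus>\<^bsub>N\<^esub> g x) \<in> module_hom K M N"
proof -
  interpret N: module K N by fact
  show ?thesis
    using assms(2,3)
    by (intro module_homI) (auto simp: module_hom_in module_hom_add module_hom_smult
        N.smult_r_distr N.M.a_ac)
qed

lemma module_hom_scale:
  assumes "module K N" "f \<in> module_hom K M N" "c \<in> carrier K"
  shows "(\<lambda>x. c \<odot>\<^bsub>N\<^esub> f x) \<in> module_hom K M N"
proof -
  interpret N: module K N by fact
  show ?thesis
    using assms(2,3)
    by (intro module_homI) (auto simp: module_hom_in module_hom_add module_hom_smult
        N.smult_r_distr N.smult_assoc1[symmetric] N.R.m_comm)
qed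

lemma module_hom_const_zero:
  assumes "module K N"
  shows "(\<lambda>x. \<zero>\<^bsub>N\<^esub>) \<in> module_hom K M N"
proof -
  interpret N: module K N by fact
  show ?thesis by (intro module_homI) auto
qed

lemma module_hom_sum:
  assumes N: "module K N" and f: "\<And>i. i \<in> A \<Longrightarrow> f i \<in> module_hom K M N"
  shows "(\<lambda>x. \<Oplus>\<^bsub>N\<^esub>i\<in>A. f i x) \<in> module_hom K M N"
proof (intro module_homI)
  interpret N: module K N by fact
  note in_N = module_hom_in[OF f]
  show "(\<Oplus>\<^bsub>N\<^esub>i\<in>A. f i x) \<in> carrier N" if "x \<in> carrier M" for x
    using that in_N by (intro N.M.finsum_closed) auto
  show "(\<Oplus>\<^bsub>N\<^esub>i\<in>A. f i (x \<oplus>\<^bsub>M\<^esub> y)) = (\<Oplus>\<^bsub>N\<^esub>i\<in>A. f i x) \<oplus>\<^bsub>N\<^esub> (\<Oplus>\<^bsub>N\<^esub>i\<in>A. f i y)"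
    if "x \<in> carrier M" "y \<in> carrier M" for x y
  proof -
    have "(\<Oplus>\<^bsub>N\<^esub>i\<in>A. f i (x \<oplus>\<^bsub>M\<^esub> y)) = (\<Oplus>\<^bsub>N\<^esub>i\<in>A. f i x \<oplus>\<^bsub>N\<^esub> f i y)"
      using that in_N by (intro N.M.finsum_cong') (auto simp: module_hom_add[OF f])
    then show ?thesis
      using that in_N by (simp add: Pi_def)
  qed
  show "(\<Oplus>\<^bsub>N\<^esub>i\<in>A. f i (c \<odot>\<^bsub>M\<^esub> x)) = c \<odot>\<^bsub>N\<^esub> (\<Oplus>\<^bsub>N\<^esub>i\<in>A. f i x)"
    if "c \<in> carrier K" "x \<in> carrier M" for c x
  proof -
    have "(\<lambda>y. c \<odot>\<^bsub>N\<^esub> y) \<in> module_hom K N N"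
      using module_hom_scale[OF N module_hom_id that(1)] by simp
    from module_hom_finsum[OF N N this, of A "\<lambda>i. f i x"] that in_N
    have "c \<odot>\<^bsub>N\<^esub> (\<Oplus>\<^bsub>N\<^esub>i\<in>A. f i x) = (\<Oplus>\<^bsub>N\<^esub>i\<in>A. c \<odot>\<^bsub>N\<^esub> f i x)"
      by simp
    then show ?thesis
      using that in_N by (auto intro!: N.M.finsum_cong' simp: module_hom_smult[OF f])
  qed
qed

lemma submodule_abelian_subgroup:
  assumes "submodule K U M"
  shows "abelian_subgroup U M"
proof -
  interpret U: submodule K U M by fact
  interpret M: module K M by (rule U.module)
  \<comment> \<open>Closure under negation is not among the introduction rules of
    \<open>submodule\<close>; it comes from scaling by minus one.\<close>
  have "\<ominus>\<^bsub>M\<^esub> x \<in> U" if "x \<in> U" for x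
    using that U.subset U.smult_closed[of "\<ominus>\<^bsub>K\<^esub> \<one>\<^bsub>K\<^esub>" x] M.smult_minus_1[of x]
    by (simp add: subset_iff)
  then have "additive_subgroup U M"
    using U.subset U.m_closed U.zero_closed
    by (intro additive_subgroup.intro subgroup.intro) (auto simp flip: a_inv_def)
  then show ?thesis
    by (intro abelian_subgroupI3) (auto intro: M.abelian_group_axioms)
qed

lemma quot_space_module:
  assumes "submodule K U M"
  shows "module K (quot_space M U)"
    and "(\<lambda>x. U +>\<^bsub>M\<^esub> x) \<in> module_hom K M (quot_space M U)"
    and "(\<lambda>x. U +>\<^bsub>M\<^esub> x) ` carrier M = carrier (quot_space M U)"
proof -
  let ?Q = "quot_space M U" and ?p = "\<lambda>x. U +>\<^bsub>M\<^esub> x"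
  interpret U: submodule K U M by fact
  interpret M: module K M by (rule U.module)
  interpret AU: abelian_subgroup U M by (rule submodule_abelian_subgroup) fact
  show surj: "?p ` carrier M = carrier ?Q"
    by (auto simp: quot_space_def A_RCOSETS_defs a_r_coset_def)
  have p_in: "?p x \<in> carrier ?Q" if "x \<in> carrier M" for x
    using surj that by auto
  have p_add: "?p x \<oplus>\<^bsub>?Q\<^esub> ?p y = ?p (x \<oplus>\<^bsub>M\<^esub> y)" if "x \<in> carrier M" "y \<in> carrier M" for x y
    using that by (simp add: quot_space_def AU.a_rcos_sum)
  \<comment> \<open>A multiple of a coset is defined as a union of cosets, one for each element of
    the given coset. All of them coincide, because two elements differ by a member of
    \<open>U\<close> and \<open>U\<close> is closed under scaling.\<close>
  have p_smult: "c \<odot>\<^bsub>?Q\<^esub> ?p x = ?p (c \<odot>\<^bsub>M\<^esub> x)" if c: "c \<in> carrier K" and x: "x \<in> carrier M" for c x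
  proof -
    have "?p (c \<odot>\<^bsub>M\<^esub> y) = ?p (c \<odot>\<^bsub>M\<^esub> x)" if y: "y \<in> ?p x" for y
    proof -
      obtain u where u: "u \<in> U" "y = u \<oplus>\<^bsub>M\<^esub> x"
        using y by (auto simp: a_r_coset_def')
      then have "c \<odot>\<^bsub>M\<^esub> y = c \<odot>\<^bsub>M\<^esub> u \<oplus>\<^bsub>M\<^esub> c \<odot>\<^bsub>M\<^esub> x"
        using c x U.subset M.smult_r_distr by auto
      then have "c \<odot>\<^bsub>M\<^esub> y \<in> ?p (c \<odot>\<^bsub>M\<^esub> x)"
        using u c by (auto simp: a_r_coset_def')
      then show ?thesis
        using c x by (intro AU.a_repr_independence'[symmetric]) auto
    qed
    \<comment> \<open>A union of equal sets is that set only over a nonempty index set.\<close>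
    moreover have "?p x \<noteq> {}"
      using AU.a_rcos_self[OF x] by blast
    ultimately have "(\<Union>y\<in>?p x. ?p (c \<odot>\<^bsub>M\<^esub> y)) = ?p (c \<odot>\<^bsub>M\<^esub> x)"
      by (rule SUP_eq_const[rotated])
    then show ?thesis
      by (simp add: quot_space_def)
  qed
  have zero: "\<zero>\<^bsub>?Q\<^esub> = ?p \<zero>\<^bsub>M\<^esub>"
    by (simp add: quot_space_def M.M.a_coset_add_zero[OF U.subset])
  show "?p \<in> module_hom K M ?Q"
    by (intro module_homI) (simp_all add: p_in p_add p_smult)
  \<comment> \<open>Every coset has a representative, so a law quantified over cosets becomes one
    quantified over elements of \<open>M\<close>, where the projection is linear and the law is
    known.\<close>
  have all: "(\<forall>X\<in>carrier ?Q. Prop X) \<longleftrightarrow> (\<forall>x\<in>carrier M. Prop (?p x))" for Prop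
    unfolding surj[symmetric] by blast
  have Zero: "\<zero>\<^bsub>?Q\<^esub> \<in> carrier ?Q"
    by (simp add: zero p_in)
  have Add: "\<forall>X\<in>carrier ?Q. \<forall>Y\<in>carrier ?Q. X \<oplus>\<^bsub>?Q\<^esub> Y \<in> carrier ?Q"
    unfolding all by (simp add: p_add p_in)
  have Neg: "\<forall>X\<in>carrier ?Q. \<exists>Y\<in>carrier ?Q. X \<oplus>\<^bsub>?Q\<^esub> Y = \<zero>\<^bsub>?Q\<^esub>"
    unfolding all
  proof
    fix x assume "x \<in> carrier M"
    then show "\<exists>Y\<in>carrier ?Q. ?p x \<oplus>\<^bsub>?Q\<^esub> Y = \<zero>\<^bsub>?Q\<^esub>"
      by (intro bexI[of _ "?p (\<ominus>\<^bsub>M\<^esub> x)"]) (simp_all add: p_add zero p_in M.M.r_neg)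
  qed
  have Smult: "\<forall>c\<in>carrier K. \<forall>X\<in>carrier ?Q. c \<odot>\<^bsub>?Q\<^esub> X \<in> carrier ?Q"
    unfolding all by (simp add: p_smult p_in)
  have Comm: "\<forall>X\<in>carrier ?Q. \<forall>Y\<in>carrier ?Q. X \<oplus>\<^bsub>?Q\<^esub> Y = Y \<oplus>\<^bsub>?Q\<^esub> X"
    unfolding all by (simp add: p_add M.M.a_comm)
  have Assoc: "\<forall>X\<in>carrier ?Q. \<forall>Y\<in>carrier ?Q. \<forall>Z\<in>carrier ?Q.
      X \<oplus>\<^bsub>?Q\<^esub> Y \<oplus>\<^bsub>?Q\<^esub> Z = X \<oplus>\<^bsub>?Q\<^esub> (Y \<oplus>\<^bsub>?Q\<^esub> Z)"
    unfolding all by (simp add: p_add M.M.a_assoc)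
  have Add_id: "\<forall>X\<in>carrier ?Q. X \<oplus>\<^bsub>?Q\<^esub> \<zero>\<^bsub>?Q\<^esub> = X"
    unfolding all by (simp add: p_add zero)
  have Compat: "\<forall>c\<in>carrier K. \<forall>d\<in>carrier K. \<forall>X\<in>carrier ?Q.
      (c \<otimes>\<^bsub>K\<^esub> d) \<odot>\<^bsub>?Q\<^esub> X = c \<odot>\<^bsub>?Q\<^esub> (d \<odot>\<^bsub>?Q\<^esub> X)"
    unfolding all by (simp add: p_smult M.smult_assoc1)
  have Dist_f: "\<forall>c\<in>carrier K. \<forall>d\<in>carrier K. \<forall>X\<in>carrier ?Q.
      (c \<oplus>\<^bsub>K\<^esub> d) \<odot>\<^bsub>?Q\<^esub> X = c \<odot>\<^bsub>?Q\<^esub> X \<oplus>\<^bsub>?Q\<^esub> d \<odot>\<^bsub>?Q\<^esub> X"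
    unfolding all by (simp add: p_smult p_add M.smult_l_distr)
  have Dist_add: "\<forall>c\<in>carrier K. \<forall>X\<in>carrier ?Q. \<forall>Y\<in>carrier ?Q.
      c \<odot>\<^bsub>?Q\<^esub> (X \<oplus>\<^bsub>?Q\<^esub> Y) = c \<odot>\<^bsub>?Q\<^esub> X \<oplus>\<^bsub>?Q\<^esub> c \<odot>\<^bsub>?Q\<^esub> Y"
    unfolding all by (simp add: p_smult p_add M.smult_r_distr)
  have Smult_id: "\<forall>X\<in>carrier ?Q. \<one>\<^bsub>K\<^esub> \<odot>\<^bsub>?Q\<^esub> X = X"
    unfolding all by (simp add: p_smult)
  show "module K ?Q"
    by (rule module_criteria, rule module.axioms(1)[OF U.module], rule Zero, use Add in blast, rule Neg,
        use Smult in blast, use Comm in blast, use Assoc in blast, rule Add_id,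
        use Compat in blast, rule Smult_id, use Dist_f in blast, use Dist_add in blast)
qed

text \<open>Since \<open>f\<close> kills \<open>U\<close>, it is constant on each coset; the induced
  map evaluates \<open>f\<close> at an arbitrarily chosen representative.\<close>

lemma quot_space_factor:
  assumes U: "submodule K U M" and P: "module K P" and f: "f \<in> module_hom K M P"
    and null: "\<And>u. u \<in> U \<Longrightarrow> f u = \<zero>\<^bsub>P\<^esub>"
  obtains h where "h \<in> module_hom K (quot_space M U) P"
    and "\<And>x. x \<in> carrier M \<Longrightarrow> h (U +>\<^bsub>M\<^esub> x) = f x"
proof -
  let ?Q = "quot_space M U" and ?p = "\<lambda>x. U +>\<^bsub>M\<^esub> x"
  interpret U: submodule K U M by fact
  interpret M: module K M by (rule U.module)
  interpret P: module K P by fact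
  interpret AU: abelian_subgroup U M by (rule submodule_abelian_subgroup) fact
  note p = module_hom_in[OF quot_space_module(2)[OF U]]
    module_hom_add[OF quot_space_module(2)[OF U]] module_hom_smult[OF quot_space_module(2)[OF U]]
  have fx: "f y = f x" if x: "x \<in> carrier M" and y: "y \<in> ?p x" for x y
  proof -
    obtain u where u: "u \<in> U" "y = u \<oplus>\<^bsub>M\<^esub> x"
      using y by (auto simp: a_r_coset_def')
    then show ?thesis
      using x U.subset null[OF u(1)] module_hom_in[OF f x] by (auto simp: module_hom_add[OF f])
  qed
  define h where "h X = f (SOME x. x \<in> X)" for X
  have h: "h (?p x) = f x" if "x \<in> carrier M" for x
  proof -
    have "x \<in> ?p x"
      using that by (rule AU.a_rcos_self)
    then have "(SOME y. y \<in> ?p x) \<in> ?p x"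
      by (rule someI)
    then show ?thesis
      using fx[OF that] by (simp add: h_def)
  qed
  have "h \<in> module_hom K ?Q P"
    unfolding module_hom_def quot_space_module(3)[OF U, symmetric]
    by (auto simp: h p(2,3)[symmetric] module_hom_in[OF f] module_hom_add[OF f] module_hom_smult[OF f])
  with h show ?thesis
    using that by blast
qed

section \<open>Free spaces\<close>

lemma free_space_simps:
  assumes "cring K"
  shows "carrier (free_space K X) = {f \<in> X \<rightarrow>\<^sub>E carrier K. finite {x \<in> X. f x \<noteq> \<zero>\<^bsub>K\<^esub>}}"
    and "\<zero>\<^bsub>free_space K X\<^esub> = (\<lambda>x\<in>X. \<zero>\<^bsub>K\<^esub>)"
    and "f \<oplus>\<^bsub>free_space K X\<^esub> g = (\<lambda>x\<in>X. f x \<oplus>\<^bsub>K\<^esub> g x)"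
    and "c \<odot>\<^bsub>free_space K X\<^esub> f = (\<lambda>x\<in>X. c \<otimes>\<^bsub>K\<^esub> f x)"
proof -
  interpret cring K by fact
  show "carrier (free_space K X) = {f \<in> X \<rightarrow>\<^sub>E carrier K. finite {x \<in> X. f x \<noteq> \<zero>\<^bsub>K\<^esub>}}"
    and "\<zero>\<^bsub>free_space K X\<^esub> = (\<lambda>x\<in>X. \<zero>\<^bsub>K\<^esub>)"
    and "f \<oplus>\<^bsub>free_space K X\<^esub> g = (\<lambda>x\<in>X. f x \<oplus>\<^bsub>K\<^esub> g x)"
    and "c \<odot>\<^bsub>free_space K X\<^esub> f = (\<lambda>x\<in>X. c \<otimes>\<^bsub>K\<^esub> f x)"
    by (simp_all add: free_space_def func_space_def)
qed

text \<open>The finitely supported functions form a submodule of the module of all functions,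
  because the support of a sum lies in the union of the supports and scaling does not enlarge a
  support.\<close>

lemma free_space_module:
  assumes "cring K"
  shows "module K (free_space K X)"
proof -
  interpret cring K by fact
  let ?F = "func_space X" and ?N = "{f \<in> X \<rightarrow>\<^sub>E carrier K. finite {x \<in> X. f x \<noteq> \<zero>\<^bsub>K\<^esub>}}"
  have F: "module K ?F"
    by (rule func_space_is_module)
  have "submodule K ?N ?F"
  proof (rule submodule.intro)
    show "module K ?F" by (rule F)
    show "?N \<subseteq> carrier ?F" by (auto simp: func_space_def)
    fix f g assume f: "f \<in> ?N" and g: "g \<in> ?N"
    from f g have "finite ({x \<in> X. f x \<noteq> \<zero>\<^bsub>K\<^esub>} \<union> {x \<in> X. g x \<noteq> \<zero>\<^bsub>K\<^esub>})"
      by simp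
    then have "finite {x \<in> X. f x \<oplus>\<^bsub>K\<^esub> g x \<noteq> \<zero>\<^bsub>K\<^esub>}"
      by (rule rev_finite_subset) auto
    with f g show "f \<oplus>\<^bsub>?F\<^esub> g \<in> ?N"
      by (auto simp: func_space_def PiE_def Pi_def cong: conj_cong)
  next
    fix c f assume c: "c \<in> carrier K" and f: "f \<in> ?N"
    from f have "finite {x \<in> X. f x \<noteq> \<zero>\<^bsub>K\<^esub>}"
      by simp
    then have "finite {x \<in> X. c \<otimes>\<^bsub>K\<^esub> f x \<noteq> \<zero>\<^bsub>K\<^esub>}"
      by (rule rev_finite_subset) (use c in auto)
    with f c show "c \<odot>\<^bsub>?F\<^esub> f \<in> ?N"
      by (auto simp: func_space_def PiE_def Pi_def cong: conj_cong)
  qed (auto simp: func_space_def)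
  from module.submodule_is_module[OF F this] show ?thesis
    by (simp add: free_space_def)
qed

lemma free_gen_closed:
  assumes "cring K" "x \<in> X"
  shows "free_gen K X x \<in> carrier (free_space K X)"
proof -
  interpret cring K by fact
  have "finite {y \<in> X. free_gen K X x y \<noteq> \<zero>\<^bsub>K\<^esub>}"
    by (rule finite_subset[of _ "{x}"]) (auto simp: free_gen_def)
  then show ?thesis
    by (auto simp: free_space_simps[OF assms(1)] free_gen_def)
qed

lemma free_space_expand:
  assumes K: "cring K" and f: "f \<in> carrier (free_space K X)"
    and A: "finite A" "A \<subseteq> X" "\<And>x. x \<in> X - A \<Longrightarrow> f x = \<zero>\<^bsub>K\<^esub>"
  shows "f = (\<Oplus>\<^bsub>free_space K X\<^esub>x\<in>A. f x \<odot>\<^bsub>free_space K X\<^esub> free_gen K X x)"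
proof -
  let ?F = "free_space K X"
  interpret cring K by fact
  interpret F: module K ?F by (rule free_space_module) fact
  have f_in: "f x \<in> carrier K" if "x \<in> X" for x
    using f that by (auto simp: free_space_simps[OF K])
  \<comment> \<open>For the induction the sum must have a known value even when \<open>A\<close>
    does not yet cover the support: it is \<open>f\<close> cut off to \<open>A\<close>.\<close>
  have "(\<Oplus>\<^bsub>?F\<^esub>x\<in>A. f x \<odot>\<^bsub>?F\<^esub> free_gen K X x) = (\<lambda>x\<in>X. if x \<in> A then f x else \<zero>\<^bsub>K\<^esub>)"
    using A(1,2)
  proof (induct A)
    case empty
    then show ?case by (simp add: free_space_simps[OF K])
  next
    case (insert a A)
    have "(\<Oplus>\<^bsub>?F\<^esub>x\<in>insert a A. f x \<odot>\<^bsub>?F\<^esub> free_gen K X x)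
        = f a \<odot>\<^bsub>?F\<^esub> free_gen K X a \<oplus>\<^bsub>?F\<^esub> (\<Oplus>\<^bsub>?F\<^esub>x\<in>A. f x \<odot>\<^bsub>?F\<^esub> free_gen K X x)"
      using insert by (intro F.M.finsum_insert) (auto simp: f_in free_gen_closed[OF K])
    also have "(\<Oplus>\<^bsub>?F\<^esub>x\<in>A. f x \<odot>\<^bsub>?F\<^esub> free_gen K X x) = (\<lambda>x\<in>X. if x \<in> A then f x else \<zero>\<^bsub>K\<^esub>)"
      by (rule insert.hyps(3)) (use insert.prems in auto)
    also have "f a \<odot>\<^bsub>?F\<^esub> free_gen K X a \<oplus>\<^bsub>?F\<^esub> \<dots> = (\<lambda>x\<in>X. if x \<in> insert a A then f x else \<zero>\<^bsub>K\<^esub>)"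
      using insert f_in by (auto simp: free_space_simps(3,4)[OF K] free_gen_def)
    finally show ?case .
  qed
  also have "\<dots> = f"
    using f A(3) by (auto simp: free_space_simps[OF K] PiE_def extensional_def fun_eq_iff)
  finally show ?thesis ..
qed

lemma free_space_hom_eqI:
  assumes K: "cring K" and P: "module K P"
    and f: "f \<in> module_hom K (free_space K X) P" and g: "g \<in> module_hom K (free_space K X) P"
    and eq: "\<And>x. x \<in> X \<Longrightarrow> f (free_gen K X x) = g (free_gen K X x)"
    and t: "t \<in> carrier (free_space K X)"
  shows "f t = g t"
proof -
  let ?F = "free_space K X"
  interpret P: module K P by fact
  interpret F: module K ?F by (rule free_space_module) fact
  let ?A = "{x \<in> X. t x \<noteq> \<zero>\<^bsub>K\<^esub>}"
  have A: "finite ?A" and t_in: "\<And>x. x \<in> X \<Longrightarrow> t x \<in> carrier K"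
    using t by (auto simp: free_space_simps[OF K])
  have "h t = (\<Oplus>\<^bsub>P\<^esub>x\<in>?A. t x \<odot>\<^bsub>P\<^esub> h (free_gen K X x))" if h: "h \<in> module_hom K ?F P" for h
  proof -
    have "h t = h (\<Oplus>\<^bsub>?F\<^esub>x\<in>?A. t x \<odot>\<^bsub>?F\<^esub> free_gen K X x)"
      by (rule arg_cong[OF free_space_expand[OF K t A]]) auto
    also have "\<dots> = (\<Oplus>\<^bsub>P\<^esub>x\<in>?A. h (t x \<odot>\<^bsub>?F\<^esub> free_gen K X x))"
      by (rule module_hom_finsum[OF F.module_axioms P h]) (auto intro: t_in free_gen_closed[OF K])
    also have "\<dots> = (\<Oplus>\<^bsub>P\<^esub>x\<in>?A. t x \<odot>\<^bsub>P\<^esub> h (free_gen K X x))"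
      by (rule P.M.finsum_cong') (auto simp: module_hom_smult[OF h] t_in free_gen_closed[OF K]
          module_hom_in[OF h])
    finally show ?thesis .
  qed
  from this[OF f] this[OF g] show ?thesis
    by (auto intro!: P.M.finsum_cong' simp: eq t_in module_hom_in[OF g] free_gen_closed[OF K])
qed

lemma free_space_extend:
  assumes K: "cring K" and P: "module K P" and b: "\<And>x. x \<in> X \<Longrightarrow> b x \<in> carrier P"
  obtains h where "h \<in> module_hom K (free_space K X) P"
    and "\<And>x. x \<in> X \<Longrightarrow> h (free_gen K X x) = b x"
proof -
  let ?F = "free_space K X"
  interpret K: cring K by fact
  interpret P: module K P by fact
  interpret F: module K ?F by (rule free_space_module) fact
  define h where "h f = (\<Oplus>\<^bsub>P\<^esub>x\<in>{x \<in> X. f x \<noteq> \<zero>\<^bsub>K\<^esub>}. f x \<odot>\<^bsub>P\<^esub> b x)" for f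
  \<comment> \<open>The index set may be any finite set containing the support. Additivity needs
    this freedom: \<open>f\<close>, \<open>g\<close> and their sum have different supports and are
    compared over a common one.\<close>
  have h_eq: "h f = (\<Oplus>\<^bsub>P\<^esub>x\<in>A. f x \<odot>\<^bsub>P\<^esub> b x)"
    if f: "f \<in> carrier ?F" and A: "finite A" "A \<subseteq> X" "{x \<in> X. f x \<noteq> \<zero>\<^bsub>K\<^esub>} \<subseteq> A" for f A
    unfolding h_def using f A b
    by (intro P.M.add.finprod_mono_neutral_cong_left)
      (auto simp: free_space_simps[OF K] subset_iff PiE_def Pi_def)
  have in_F: "f x \<in> carrier K" if "f \<in> carrier ?F" "x \<in> X" for f x
    using that by (auto simp: free_space_simps[OF K])
  have supp: "finite {x \<in> X. f x \<noteq> \<zero>\<^bsub>K\<^esub>}" if "f \<in> carrier ?F" for f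
    using that by (auto simp: free_space_simps[OF K])
  have "h \<in> module_hom K ?F P"
  proof (rule module_homI)
    fix f assume f: "f \<in> carrier ?F"
    then show "h f \<in> carrier P"
      unfolding h_def using b by (intro P.M.finsum_closed) (auto simp: in_F)
    show "h (c \<odot>\<^bsub>?F\<^esub> f) = c \<odot>\<^bsub>P\<^esub> h f" if c: "c \<in> carrier K" for c
    proof -
      let ?A = "{x \<in> X. f x \<noteq> \<zero>\<^bsub>K\<^esub>}"
      have "h (c \<odot>\<^bsub>?F\<^esub> f) = (\<Oplus>\<^bsub>P\<^esub>x\<in>?A. (c \<odot>\<^bsub>?F\<^esub> f) x \<odot>\<^bsub>P\<^esub> b x)"
        using f c by (intro h_eq F.smult_closed) (auto simp: supp free_space_simps(4)[OF K])
      also have "\<dots> = (\<Oplus>\<^bsub>P\<^esub>x\<in>?A. c \<odot>\<^bsub>P\<^esub> (f x \<odot>\<^bsub>P\<^esub> b x))"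
        using f c b
        by (intro P.M.finsum_cong') (auto simp: in_F free_space_simps(4)[OF K] P.smult_assoc1)
      also have "\<dots> = c \<odot>\<^bsub>P\<^esub> h f"
        unfolding h_def using f c b
        by (intro module_hom_finsum[OF P P module_hom_scale[OF P module_hom_id c], simplified, symmetric])
          (auto simp: in_F)
      finally show ?thesis .
    qed
    fix g assume g: "g \<in> carrier ?F"
    let ?A = "{x \<in> X. f x \<noteq> \<zero>\<^bsub>K\<^esub>} \<union> {x \<in> X. g x \<noteq> \<zero>\<^bsub>K\<^esub>}"
    have "h (f \<oplus>\<^bsub>?F\<^esub> g) = (\<Oplus>\<^bsub>P\<^esub>x\<in>?A. (f \<oplus>\<^bsub>?F\<^esub> g) x \<odot>\<^bsub>P\<^esub> b x)"
      using f g by (intro h_eq F.M.a_closed) (auto simp: supp free_space_simps(3)[OF K])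
    also have "\<dots> = (\<Oplus>\<^bsub>P\<^esub>x\<in>?A. f x \<odot>\<^bsub>P\<^esub> b x \<oplus>\<^bsub>P\<^esub> g x \<odot>\<^bsub>P\<^esub> b x)"
      using f g b
      by (intro P.M.finsum_cong') (auto simp: in_F free_space_simps(3)[OF K] P.smult_l_distr)
    also have "\<dots> = (\<Oplus>\<^bsub>P\<^esub>x\<in>?A. f x \<odot>\<^bsub>P\<^esub> b x) \<oplus>\<^bsub>P\<^esub> (\<Oplus>\<^bsub>P\<^esub>x\<in>?A. g x \<odot>\<^bsub>P\<^esub> b x)"
      using f g b by (intro P.M.finsum_addf) (auto simp: in_F)
    also have "\<dots> = h f \<oplus>\<^bsub>P\<^esub> h g"
      using f g by (simp add: h_eq[of f ?A] h_eq[of g ?A] supp)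
    finally show "h (f \<oplus>\<^bsub>?F\<^esub> g) = h f \<oplus>\<^bsub>P\<^esub> h g" .
  qed
  moreover have "h (free_gen K X x) = b x" if x: "x \<in> X" for x
  proof -
    have "h (free_gen K X x) = (\<Oplus>\<^bsub>P\<^esub>y\<in>{x}. free_gen K X x y \<odot>\<^bsub>P\<^esub> b y)"
      using x free_gen_closed[OF K x] by (intro h_eq) (auto simp: free_gen_def)
    then show ?thesis
      using x b by (simp add: free_gen_def)
  qed
  ultimately show ?thesis
    using that by blast
qed

lemma quot_space_null:
  assumes "submodule K U M" "u \<in> U"
  shows "U +>\<^bsub>M\<^esub> u = \<zero>\<^bsub>quot_space M U\<^esub>"
proof -
  interpret AU: abelian_subgroup U M by (rule submodule_abelian_subgroup) fact
  show ?thesis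
    using assms(2) by (simp add: quot_space_def AU.a_rcos_const)
qed

section \<open>Tensor products\<close>

text \<open>Phrased as linearity in each variable, so that precomposing either variable with a
  linear map, or postcomposing the whole, is composition of linear maps.\<close>

definition bilinear_map ::
  "('k, 'r) ring_scheme \<Rightarrow> ('k, 'm) module \<Rightarrow> ('k, 'n) module \<Rightarrow> ('k, 'p) module
    \<Rightarrow> ('m \<Rightarrow> 'n \<Rightarrow> 'p) \<Rightarrow> bool" where
  "bilinear_map K M N P b \<longleftrightarrow>
    (\<forall>m\<in>carrier M. b m \<in> module_hom K N P) \<and>
    (\<forall>n\<in>carrier N. (\<lambda>m. b m n) \<in> module_hom K M P)"

lemma bilinear_mapI:
  assumes "\<And>m. m \<in> carrier M \<Longrightarrow> b m \<in> module_hom K N P"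
    and "\<And>n. n \<in> carrier N \<Longrightarrow> (\<lambda>m. b m n) \<in> module_hom K M P"
  shows "bilinear_map K M N P b"
  using assms by (simp add: bilinear_map_def)

lemma bilinear_mapD:
  assumes "bilinear_map K M N P b"
  shows "m \<in> carrier M \<Longrightarrow> b m \<in> module_hom K N P"
    and "n \<in> carrier N \<Longrightarrow> (\<lambda>m. b m n) \<in> module_hom K M P"
  using assms by (simp_all add: bilinear_map_def)

lemma (in abelian_group) minus_eq_iff:
  assumes "x \<in> carrier G" "y \<in> carrier G" "z \<in> carrier G"
  shows "x \<ominus> y = z \<longleftrightarrow> x = y \<oplus> z"
proof
  assume "x \<ominus> y = z"
  then have "y \<oplus> z = y \<oplus> (\<ominus> y \<oplus> x)"
    using assms by (simp add: a_minus_def a_comm)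
  then show "x = y \<oplus> z"
    using assms by (simp add: r_neg2)
next
  assume "x = y \<oplus> z"
  then have "x \<ominus> y = \<ominus> y \<oplus> (y \<oplus> z)"
    using assms by (simp add: a_minus_def a_comm)
  then show "x \<ominus> y = z"
    using assms by (simp add: r_neg1)
qed

text \<open>The generators in \<open>bilinear_relations\<close> are differences. These equivalences
  turn their vanishing, in the quotient or under a map, into the equations of bilinearity.\<close>

lemma (in abelian_group) minus_eq_zero_iff:
  "\<lbrakk>x \<in> carrier G; y \<in> carrier G\<rbrakk> \<Longrightarrow> x \<ominus> y = \<zero> \<longleftrightarrow> x = y"
  "\<lbrakk>x \<in> carrier G; y \<in> carrier G; z \<in> carrier G\<rbrakk> \<Longrightarrow> x \<ominus> y \<ominus> z = \<zero> \<longleftrightarrow> x = y \<oplus> z"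
  by (simp_all add: minus_eq_iff)

section \<open>The universal property of the tensor product\<close>

context
  fixes K :: "('k, 'r) ring_scheme" and M :: "('k, 'm) module" and N :: "('k, 'n) module"
  assumes M: "module K M" and N: "module K N"
begin

interpretation M: module K M by (rule M)
interpretation N: module K N by (rule N)

private abbreviation "P0 \<equiv> pair_space K M N"
private abbreviation "U0 \<equiv> tensor_null K M N"
private abbreviation "T0 \<equiv> tensor_space K M N"
private abbreviation "d \<equiv> \<lambda>m n. free_gen K (carrier M \<times> carrier N) (m, n)"

private lemma K: "cring K"
  using M by (rule module.axioms(1))

private lemma P0: "module K P0"
  unfolding pair_space_def using K by (rule free_space_module)

interpretation P0: module K P0 by (rule P0)

private lemma d: "\<lbrakk>m \<in> carrier M; n \<in> carrier N\<rbrakk> \<Longrightarrow> d m n \<in> carrier P0"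
  unfolding pair_space_def using K by (intro free_gen_closed) auto

private lemma relations: "bilinear_relations K M N \<subseteq> carrier P0"
  unfolding bilinear_relations_def Let_def by (auto intro!: P0.M.minus_closed d)

private lemma null: "submodule K U0 P0"
  unfolding tensor_null_def by (rule P0.span_is_submodule[OF relations])

private lemma proj: "(\<lambda>x. U0 +>\<^bsub>P0\<^esub> x) \<in> module_hom K P0 T0"
  unfolding tensor_space_def by (rule quot_space_module(2)[OF null])

lemma tensor_module: "module K T0"
  unfolding tensor_space_def by (rule quot_space_module(1)[OF null])

interpretation T0: module K T0 by (rule tensor_module)

private lemma rel_zero: "u \<in> bilinear_relations K M N \<Longrightarrow> U0 +>\<^bsub>P0\<^esub> u = \<zero>\<^bsub>T0\<^esub>"
  unfolding tensor_space_def
  using P0.in_own_span[OF relations] by (intro quot_space_null[OF null]) (auto simp: tensor_null_def)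

text \<open>The shape of the last hypothesis covers both additivity relations, so additivity of
  \<open>tens\<close> in either argument follows from it.\<close>

private lemma proj_eq_add:
  assumes "x \<in> carrier P0" "y \<in> carrier P0" "z \<in> carrier P0"
    and "x \<ominus>\<^bsub>P0\<^esub> y \<ominus>\<^bsub>P0\<^esub> z \<in> bilinear_relations K M N"
  shows "U0 +>\<^bsub>P0\<^esub> x = (U0 +>\<^bsub>P0\<^esub> y) \<oplus>\<^bsub>T0\<^esub> (U0 +>\<^bsub>P0\<^esub> z)"
proof (rule T0.M.minus_eq_zero_iff(2)[THEN iffD1])
  have "U0 +>\<^bsub>P0\<^esub> (x \<ominus>\<^bsub>P0\<^esub> y \<ominus>\<^bsub>P0\<^esub> z)
      = (U0 +>\<^bsub>P0\<^esub> x) \<ominus>\<^bsub>T0\<^esub> (U0 +>\<^bsub>P0\<^esub> y) \<ominus>\<^bsub>T0\<^esub> (U0 +>\<^bsub>P0\<^esub> z)"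
    using assms(1-3) by (simp only: module_hom_minus[OF P0 tensor_module proj] P0.M.minus_closed)
  then show "(U0 +>\<^bsub>P0\<^esub> x) \<ominus>\<^bsub>T0\<^esub> (U0 +>\<^bsub>P0\<^esub> y) \<ominus>\<^bsub>T0\<^esub> (U0 +>\<^bsub>P0\<^esub> z) = \<zero>\<^bsub>T0\<^esub>"
    by (simp only: rel_zero[OF assms(4)])
qed (intro module_hom_in[OF proj] assms)+

private lemma proj_eq_smult:
  assumes "c \<in> carrier K" "x \<in> carrier P0" "y \<in> carrier P0"
    and "x \<ominus>\<^bsub>P0\<^esub> c \<odot>\<^bsub>P0\<^esub> y \<in> bilinear_relations K M N"
  shows "U0 +>\<^bsub>P0\<^esub> x = c \<odot>\<^bsub>T0\<^esub> (U0 +>\<^bsub>P0\<^esub> y)"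
proof (rule T0.M.minus_eq_zero_iff(1)[THEN iffD1])
  have "U0 +>\<^bsub>P0\<^esub> (x \<ominus>\<^bsub>P0\<^esub> c \<odot>\<^bsub>P0\<^esub> y) = (U0 +>\<^bsub>P0\<^esub> x) \<ominus>\<^bsub>T0\<^esub> c \<odot>\<^bsub>T0\<^esub> (U0 +>\<^bsub>P0\<^esub> y)"
    using assms(1-3)
    by (simp only: module_hom_minus[OF P0 tensor_module proj] module_hom_smult[OF proj]
        P0.smult_closed)
  then show "(U0 +>\<^bsub>P0\<^esub> x) \<ominus>\<^bsub>T0\<^esub> c \<odot>\<^bsub>T0\<^esub> (U0 +>\<^bsub>P0\<^esub> y) = \<zero>\<^bsub>T0\<^esub>"
    by (simp only: rel_zero[OF assms(4)])
qed (intro T0.smult_closed module_hom_in[OF proj] assms)+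

private lemma tens_d: "tens K M N m n = U0 +>\<^bsub>P0\<^esub> d m n"
  by (simp add: tens_def)

lemma tens_closed: "\<lbrakk>m \<in> carrier M; n \<in> carrier N\<rbrakk> \<Longrightarrow> tens K M N m n \<in> carrier T0"
  unfolding tens_d by (intro module_hom_in[OF proj] d)

private lemma relationsI:
  "\<lbrakk>m \<in> carrier M; m' \<in> carrier M; n \<in> carrier N\<rbrakk> \<Longrightarrow>
    d (m \<oplus>\<^bsub>M\<^esub> m') n \<ominus>\<^bsub>P0\<^esub> d m n \<ominus>\<^bsub>P0\<^esub> d m' n \<in> bilinear_relations K M N"
  "\<lbrakk>m \<in> carrier M; n \<in> carrier N; n' \<in> carrier N\<rbrakk> \<Longrightarrow>
    d m (n \<oplus>\<^bsub>N\<^esub> n') \<ominus>\<^bsub>P0\<^esub> d m n \<ominus>\<^bsub>P0\<^esub> d m n' \<in> bilinear_relations K M N"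
  "\<lbrakk>c \<in> carrier K; m \<in> carrier M; n \<in> carrier N\<rbrakk> \<Longrightarrow>
    d (c \<odot>\<^bsub>M\<^esub> m) n \<ominus>\<^bsub>P0\<^esub> c \<odot>\<^bsub>P0\<^esub> d m n \<in> bilinear_relations K M N"
  "\<lbrakk>c \<in> carrier K; m \<in> carrier M; n \<in> carrier N\<rbrakk> \<Longrightarrow>
    d m (c \<odot>\<^bsub>N\<^esub> n) \<ominus>\<^bsub>P0\<^esub> c \<odot>\<^bsub>P0\<^esub> d m n \<in> bilinear_relations K M N"
  unfolding bilinear_relations_def Let_def by blast+

lemma tens_bilinear: "bilinear_map K M N T0 (tens K M N)"
proof -
  have "tens K M N (m \<oplus>\<^bsub>M\<^esub> m') n = tens K M N m n \<oplus>\<^bsub>T0\<^esub> tens K M N m' n"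
    if "m \<in> carrier M" "m' \<in> carrier M" "n \<in> carrier N" for m m' n
    unfolding tens_d
    by (rule proj_eq_add) (use that in \<open>simp_all add: d relationsI\<close>)
  moreover have "tens K M N m (n \<oplus>\<^bsub>N\<^esub> n') = tens K M N m n \<oplus>\<^bsub>T0\<^esub> tens K M N m n'"
    if "m \<in> carrier M" "n \<in> carrier N" "n' \<in> carrier N" for m n n'
    unfolding tens_d
    by (rule proj_eq_add) (use that in \<open>simp_all add: d relationsI\<close>)
  moreover have "tens K M N (c \<odot>\<^bsub>M\<^esub> m) n = c \<odot>\<^bsub>T0\<^esub> tens K M N m n"
    if "c \<in> carrier K" "m \<in> carrier M" "n \<in> carrier N" for c m n
    unfolding tens_d
    by (rule proj_eq_smult) (use that in \<open>simp_all add: d relationsI\<close>)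
  moreover have "tens K M N m (c \<odot>\<^bsub>N\<^esub> n) = c \<odot>\<^bsub>T0\<^esub> tens K M N m n"
    if "c \<in> carrier K" "m \<in> carrier M" "n \<in> carrier N" for c m n
    unfolding tens_d
    by (rule proj_eq_smult) (use that in \<open>simp_all add: d relationsI\<close>)
  ultimately show ?thesis
    by (intro bilinear_mapI module_homI) (simp_all add: tens_closed)
qed

text \<open>Both maps are pulled back along the surjection from the free space. Its generators go to
  the pure tensors, and a linear map on a free space is fixed by its values on generators.\<close>

lemma tensor_hom_eqI:
  assumes P: "module K P" and f: "f \<in> module_hom K T0 P" and g: "g \<in> module_hom K T0 P"
    and eq: "\<And>m n. \<lbrakk>m \<in> carrier M; n \<in> carrier N\<rbrakk> \<Longrightarrow> f (tens K M N m n) = g (tens K M N m n)"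
    and t: "t \<in> carrier T0"
  shows "f t = g t"
proof -
  obtain x where x: "x \<in> carrier P0" "t = U0 +>\<^bsub>P0\<^esub> x"
    using t quot_space_module(3)[OF null] unfolding tensor_space_def by blast
  have "(\<lambda>x. f (U0 +>\<^bsub>P0\<^esub> x)) x = (\<lambda>x. g (U0 +>\<^bsub>P0\<^esub> x)) x"
    by (rule free_space_hom_eqI[OF K P, where X = "carrier M \<times> carrier N"])
      (use module_hom_comp[OF proj f] module_hom_comp[OF proj g] x eq in
        \<open>auto simp: pair_space_def tens_def\<close>)
  then show ?thesis
    using x by simp
qed

text \<open>This unlocks the definite description in the definition: existence comes from extending
  \<open>b\<close> freely and factoring through the relations, uniqueness from
  \<open>tensor_hom_eqI\<close>.\<close>

lemma tensor_lift:
  assumes P: "module K P" and b: "bilinear_map K M N P b"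
  shows "tensor_lift K M N P b \<in> module_hom K T0 P"
    and "\<And>m n. \<lbrakk>m \<in> carrier M; n \<in> carrier N\<rbrakk> \<Longrightarrow> tensor_lift K M N P b (tens K M N m n) = b m n"
proof -
  interpret P: module K P by (rule P)
  note b1 = bilinear_mapD(1)[OF b] and b2 = bilinear_mapD(2)[OF b]
  have b_in: "b m n \<in> carrier P" if "m \<in> carrier M" "n \<in> carrier N" for m n
    using that by (intro module_hom_in[OF b1])
  obtain f where f: "f \<in> module_hom K P0 P"
    and f_d: "\<And>m n. \<lbrakk>m \<in> carrier M; n \<in> carrier N\<rbrakk> \<Longrightarrow> f (d m n) = b m n"
    using free_space_extend[OF K P, of "carrier M \<times> carrier N" "\<lambda>(m, n). b m n"] b_in
    unfolding pair_space_def by (metis (no_types, lifting) SigmaE SigmaI case_prod_conv)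
  note f_minus = module_hom_minus[OF P0 P f]
  have "f u = \<zero>\<^bsub>P\<^esub>" if "u \<in> bilinear_relations K M N" for u
    using that unfolding bilinear_relations_def Let_def
    by (auto simp: f_minus d f_d b_in P.M.minus_eq_zero_iff P.M.minus_eq_iff module_hom_smult[OF f]
        module_hom_add[OF b1] module_hom_add[OF b2] module_hom_smult[OF b1] module_hom_smult[OF b2])
  \<comment> \<open>The kernel is a submodule, so containing the relations it contains their span,
    which is the subspace divided out.\<close>
  then have "bilinear_relations K M N \<subseteq> mod_hom.ker P0 P f"
    using relations by (auto simp: mod_hom.ker_def[OF mod_homI[OF P0 P f]])
  then have "U0 \<subseteq> mod_hom.ker P0 P f"
    unfolding tensor_null_def
    by (rule P0.span_is_subset) (rule mod_hom.ker_is_submodule[OF mod_homI[OF P0 P f]])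
  then have "f u = \<zero>\<^bsub>P\<^esub>" if "u \<in> U0" for u
    using that by (auto simp: mod_hom.ker_def[OF mod_homI[OF P0 P f]])
  then obtain h where h: "h \<in> module_hom K T0 P"
    and h_f: "\<And>x. x \<in> carrier P0 \<Longrightarrow> h (U0 +>\<^bsub>P0\<^esub> x) = f x"
    using quot_space_factor[OF null P f] unfolding tensor_space_def by metis
  \<comment> \<open>Agreement on pure tensors fixes a linear map on the carrier only; restriction
    also fixes its values elsewhere, so that it is unique as a function.\<close>
  let ?h = "restrict h (carrier T0)"
  let ?Q = "\<lambda>h. h \<in> module_hom K T0 P \<and> h \<in> extensional (carrier T0)
      \<and> (\<forall>m\<in>carrier M. \<forall>n\<in>carrier N. h (tens K M N m n) = b m n)"
  have Q: "?Q ?h"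
  proof (intro conjI ballI)
    show "?h \<in> module_hom K T0 P"
      by (rule module_hom_cong[OF _ tensor_module h]) simp
    show "?h (tens K M N m n) = b m n" if "m \<in> carrier M" "n \<in> carrier N" for m n
      using that by (simp add: tens_closed) (simp add: tens_d h_f d f_d)
  qed simp
  moreover have "h' = ?h" if h': "?Q h'" for h'
  proof (rule extensionalityI)
    show "h' t = ?h t" if "t \<in> carrier T0" for t
      by (rule tensor_hom_eqI[OF P _ _ _ that]) (use h' Q in metis)+
  qed (use h' in simp_all)
  ultimately have "?Q (tensor_lift K M N P b)"
    unfolding tensor_lift_def by (rule theI)
  then show "tensor_lift K M N P b \<in> module_hom K T0 P"
    and "\<And>m n. \<lbrakk>m \<in> carrier M; n \<in> carrier N\<rbrakk> \<Longrightarrow> tensor_lift K M N P b (tens K M N m n) = b m n"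
    by blast+
qed

end

section \<open>Functoriality of the tensor product\<close>

lemma tens_simps:
  assumes "module K M" "module K N"
  shows "\<lbrakk>m \<in> carrier M; m' \<in> carrier M; n \<in> carrier N\<rbrakk> \<Longrightarrow>
      tens K M N (m \<oplus>\<^bsub>M\<^esub> m') n = tens K M N m n \<oplus>\<^bsub>tensor_space K M N\<^esub> tens K M N m' n"
    and "\<lbrakk>m \<in> carrier M; n \<in> carrier N; n' \<in> carrier N\<rbrakk> \<Longrightarrow>
      tens K M N m (n \<oplus>\<^bsub>N\<^esub> n') = tens K M N m n \<oplus>\<^bsub>tensor_space K M N\<^esub> tens K M N m n'"
    and "\<lbrakk>c \<in> carrier K; m \<in> carrier M; n \<in> carrier N\<rbrakk> \<Longrightarrow>
      tens K M N (c \<odot>\<^bsub>M\<^esub> m) n = c \<odot>\<^bsub>tensor_space K M N\<^esub> tens K M N m n"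
    and "\<lbrakk>c \<in> carrier K; m \<in> carrier M; n \<in> carrier N\<rbrakk> \<Longrightarrow>
      tens K M N m (c \<odot>\<^bsub>N\<^esub> n) = c \<odot>\<^bsub>tensor_space K M N\<^esub> tens K M N m n"
  using bilinear_mapD[OF tens_bilinear[OF assms]]
  by (simp_all add: module_hom_def)

lemma tensor_map_bilinear:
  assumes M': "module K M'" and N': "module K N'"
    and f: "f \<in> module_hom K M M'" and g: "g \<in> module_hom K N N'"
  shows "bilinear_map K M N (tensor_space K M' N') (\<lambda>m n. tens K M' N' (f m) (g n))"
proof (rule bilinear_mapI)
  note b = bilinear_mapD[OF tens_bilinear[OF M' N']]
  show "(\<lambda>n. tens K M' N' (f m) (g n)) \<in> module_hom K N (tensor_space K M' N')" if "m \<in> carrier M" for m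
    by (rule module_hom_comp[OF g b(1)]) (rule module_hom_in[OF f that])
  show "(\<lambda>m. tens K M' N' (f m) (g n)) \<in> module_hom K M (tensor_space K M' N')" if "n \<in> carrier N" for n
    by (rule module_hom_comp[OF f b(2)]) (rule module_hom_in[OF g that])
qed

lemma tensor_map_hom:
  assumes "module K M" "module K N" "module K M'" "module K N'"
    and "f \<in> module_hom K M M'" "g \<in> module_hom K N N'"
  shows "tensor_map K M N M' N' f g \<in> module_hom K (tensor_space K M N) (tensor_space K M' N')"
  unfolding tensor_map_def using assms by (intro tensor_lift(1) tensor_module tensor_map_bilinear)

lemma tensor_map_tens:
  assumes "module K M" "module K N" "module K M'" "module K N'"
    and "f \<in> module_hom K M M'" "g \<in> module_hom K N N'"
    and "m \<in> carrier M" "n \<in> carrier N"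
  shows "tensor_map K M N M' N' f g (tens K M N m n) = tens K M' N' (f m) (g n)"
  unfolding tensor_map_def using assms by (intro tensor_lift(2) tensor_module tensor_map_bilinear)

lemma tensor_map_comp:
  assumes M: "module K M" "module K N" "module K M'" "module K N'" "module K M''" "module K N''"
    and f: "f \<in> module_hom K M M'" and g: "g \<in> module_hom K N N'"
    and f': "f' \<in> module_hom K M' M''" and g': "g' \<in> module_hom K N' N''"
    and t: "t \<in> carrier (tensor_space K M N)"
  shows "tensor_map K M' N' M'' N'' f' g' (tensor_map K M N M' N' f g t)
    = tensor_map K M N M'' N'' (\<lambda>m. f' (f m)) (\<lambda>n. g' (g n)) t"
proof -
  note ff' = module_hom_comp[OF f f'] and gg' = module_hom_comp[OF g g']
  note h = tensor_map_hom[OF M(1-4) f g] and h' = tensor_map_hom[OF M(3-6) f' g']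
  show ?thesis
    by (rule tensor_hom_eqI[OF M(1,2) tensor_module[OF M(5,6)] module_hom_comp[OF h h']
          tensor_map_hom[OF M(1,2,5,6) ff' gg'] _ t])
      (simp add: tensor_map_tens M f g f' g' ff' gg' module_hom_in[OF f] module_hom_in[OF g])
qed

text \<open>The maps \<open>f'\<close> and \<open>g'\<close> inherit linearity from \<open>f\<close>
  and \<open>g\<close>, and then both sides agree on pure tensors. This is how
  \<open>extensional\<close> maps, which elements of \<open>Coind\<close> have to be, are exchanged
  with the unrestricted maps they come from.\<close>

lemma tensor_map_cong:
  assumes M: "module K M" "module K N" "module K M'" "module K N'"
    and f: "f \<in> module_hom K M M'" and g: "g \<in> module_hom K N N'"
    and f': "\<And>m. m \<in> carrier M \<Longrightarrow> f' m = f m" and g': "\<And>n. n \<in> carrier N \<Longrightarrow> g' n = g n"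
    and t: "t \<in> carrier (tensor_space K M N)"
  shows "tensor_map K M N M' N' f' g' t = tensor_map K M N M' N' f g t"
proof -
  have hf: "f' \<in> module_hom K M M'" and hg: "g' \<in> module_hom K N N'"
    using module_hom_cong[OF f' M(1) f] module_hom_cong[OF g' M(2) g] by simp_all
  show ?thesis
    by (rule tensor_hom_eqI[OF M(1,2) tensor_module[OF M(3,4)] tensor_map_hom[OF M hf hg]
          tensor_map_hom[OF M f g] _ t])
      (simp add: tensor_map_tens M f g f' g' hf hg)
qed

text \<open>The condition defining \<open>Coind\<close> has \<open>F\<close> in the second slot of a
  tensor product of maps. Linearity in that slot makes its solutions a subspace.\<close>

lemma tensor_map_right_linear:
  assumes M: "module K M" "module K N" "module K M'" "module K N'"
    and f: "f \<in> module_hom K M M'" and g: "g \<in> module_hom K N N'"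
    and t: "t \<in> carrier (tensor_space K M N)"
  shows "tensor_map K M N M' N' f (\<lambda>n. \<zero>\<^bsub>N'\<^esub>) t = \<zero>\<^bsub>tensor_space K M' N'\<^esub>"
    and "c \<in> carrier K \<Longrightarrow> tensor_map K M N M' N' f (\<lambda>n. c \<odot>\<^bsub>N'\<^esub> g n) t
      = c \<odot>\<^bsub>tensor_space K M' N'\<^esub> tensor_map K M N M' N' f g t"
    and "h \<in> module_hom K N N' \<Longrightarrow> tensor_map K M N M' N' f (\<lambda>n. g n \<oplus>\<^bsub>N'\<^esub> h n) t
      = tensor_map K M N M' N' f g t \<oplus>\<^bsub>tensor_space K M' N'\<^esub> tensor_map K M N M' N' f h t"
proof -
  let ?T = "tensor_space K M' N'"
  note T = tensor_module[OF M(3,4)]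
  note eqI = tensor_hom_eqI[OF M(1,2) T _ _ _ t]
  have zero: "tens K M' N' m \<zero>\<^bsub>N'\<^esub> = \<zero>\<^bsub>?T\<^esub>" if "m \<in> carrier M'" for m
    by (rule module_hom_zero[OF M(4) T]) (rule bilinear_mapD(1)[OF tens_bilinear[OF M(3,4)] that])
  note z = module_hom_const_zero[OF M(4)]
  show "tensor_map K M N M' N' f (\<lambda>n. \<zero>\<^bsub>N'\<^esub>) t = \<zero>\<^bsub>?T\<^esub>"
    by (rule eqI[OF tensor_map_hom[OF M f z] module_hom_const_zero[OF T]])
      (simp add: tensor_map_tens[OF M f z] zero module_hom_in[OF f])
  show "tensor_map K M N M' N' f (\<lambda>n. c \<odot>\<^bsub>N'\<^esub> g n) t = c \<odot>\<^bsub>?T\<^esub> tensor_map K M N M' N' f g t"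
    if c: "c \<in> carrier K"
  proof -
    note cg = module_hom_scale[OF M(4) g c]
    show ?thesis
      by (rule eqI[OF tensor_map_hom[OF M f cg] module_hom_scale[OF T tensor_map_hom[OF M f g] c]])
        (simp add: tensor_map_tens[OF M f cg] tensor_map_tens[OF M f g] tens_simps[OF M(3,4)] c
          module_hom_in[OF f] module_hom_in[OF g])
  qed
  show "tensor_map K M N M' N' f (\<lambda>n. g n \<oplus>\<^bsub>N'\<^esub> h n) t
      = tensor_map K M N M' N' f g t \<oplus>\<^bsub>?T\<^esub> tensor_map K M N M' N' f h t"
    if h: "h \<in> module_hom K N N'"
  proof -
    note gh = module_hom_plus[OF M(4) g h]
    show ?thesis
      by (rule eqI[OF tensor_map_hom[OF M f gh]
            module_hom_plus[OF T tensor_map_hom[OF M f g] tensor_map_hom[OF M f h]]])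
        (simp add: tensor_map_tens[OF M f gh] tensor_map_tens[OF M f g] tensor_map_tens[OF M f h]
          tens_simps[OF M(3,4)] module_hom_in[OF f] module_hom_in[OF g] module_hom_in[OF h])
  qed
qed

section \<open>The right unit and associativity maps\<close>

lemma ground_space_module:
  assumes "cring K"
  shows "module K (ground_space K)"
proof -
  interpret cring K by fact
  show ?thesis
    by (rule module_criteria[OF assms])
      (auto simp: ground_space_def a_ac m_ac l_distr r_distr intro: r_neg)
qed

lemma ground_space_simps [simp]:
  "carrier (ground_space K) = carrier K" "\<zero>\<^bsub>ground_space K\<^esub> = \<zero>\<^bsub>K\<^esub>"
  "x \<oplus>\<^bsub>ground_space K\<^esub> y = x \<oplus>\<^bsub>K\<^esub> y" "c \<odot>\<^bsub>ground_space K\<^esub> x = c \<otimes>\<^bsub>K\<^esub> x"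
  by (simp_all add: ground_space_def)

lemma smult_bilinear:
  assumes "module K M"
  shows "bilinear_map K M (ground_space K) M (\<lambda>m c. c \<odot>\<^bsub>M\<^esub> m)"
proof -
  interpret module K M by fact
  have "c \<odot>\<^bsub>M\<^esub> (d \<odot>\<^bsub>M\<^esub> m) = d \<odot>\<^bsub>M\<^esub> (c \<odot>\<^bsub>M\<^esub> m)"
    if "c \<in> carrier K" "d \<in> carrier K" "m \<in> carrier M" for c d m
    using that by (simp add: smult_assoc1[symmetric] R.m_comm)
  then show ?thesis
    by (intro bilinear_mapI module_homI) (simp_all add: smult_l_distr smult_r_distr smult_assoc1)
qed

lemma tensor_runit:
  assumes M: "module K M"
  shows "tensor_runit K M \<in> module_hom K (tensor_space K M (ground_space K)) M"
    and "\<lbrakk>m \<in> carrier M; c \<in> carrier K\<rbrakk> \<Longrightarrow>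
      tensor_runit K M (tens K M (ground_space K) m c) = c \<odot>\<^bsub>M\<^esub> m"
  unfolding tensor_runit_def
  using tensor_lift[OF M ground_space_module[OF module.axioms(1)[OF M]] M smult_bilinear[OF M]]
  by simp_all

lemma tensor_assoc:
  assumes M: "module K M" and N: "module K N" and P: "module K P"
  shows "tensor_assoc K M N P \<in> module_hom K (tensor_space K (tensor_space K M N) P)
      (tensor_space K M (tensor_space K N P))"
    and "\<lbrakk>m \<in> carrier M; n \<in> carrier N; p \<in> carrier P\<rbrakk> \<Longrightarrow>
      tensor_assoc K M N P (tens K (tensor_space K M N) P (tens K M N m n) p)
      = tens K M (tensor_space K N P) m (tens K N P n p)"
proof -
  let ?NP = "tensor_space K N P" and ?MN = "tensor_space K M N"
  let ?T = "tensor_space K M ?NP"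
  let ?b = "\<lambda>p m n. tens K M ?NP m (tens K N P n p)"
  let ?B = "\<lambda>t p. tensor_lift K M N ?T (?b p) t"
  note NP = tensor_module[OF N P] and MN = tensor_module[OF M N]
  note T = tensor_module[OF M NP]
  interpret T: module K ?T by (rule T)
  interpret P: module K P by (rule P)
  note tNP = bilinear_mapD[OF tens_bilinear[OF N P]] and tM = bilinear_mapD[OF tens_bilinear[OF M NP]]
  have b: "bilinear_map K M N ?T (?b p)" if p: "p \<in> carrier P" for p
    using that
    by (intro bilinear_mapI tM(2) module_hom_comp[OF tNP(2) tM(1)] tens_closed[OF N P])
  note lift = tensor_lift[OF M N T b]
  \<comment> \<open>Linearity of \<open>?B\<close> in \<open>t\<close> is that of the inner lift.
    Linearity in \<open>p\<close> equates two maps that are linear in \<open>t\<close>, so it may be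
    tested for \<open>t\<close> a pure tensor, where the lift is explicit.\<close>
  have B: "bilinear_map K ?MN P ?T ?B"
  proof (rule bilinear_mapI)
    fix t assume t: "t \<in> carrier ?MN"
    note eqI = tensor_hom_eqI[OF M N T _ _ _ t]
    show "(\<lambda>p. ?B t p) \<in> module_hom K P ?T"
    proof (rule module_homI)
      show "?B t p \<in> carrier ?T" if "p \<in> carrier P" for p
        using lift(1)[OF that] t by (rule module_hom_in)
      show "?B t (p \<oplus>\<^bsub>P\<^esub> p') = ?B t p \<oplus>\<^bsub>?T\<^esub> ?B t p'" if p: "p \<in> carrier P" "p' \<in> carrier P" for p p'
        by (rule eqI[OF lift(1) module_hom_plus[OF T lift(1) lift(1)]])
          (simp_all add: lift(2) p tens_simps[OF N P] tens_simps[OF M NP] tens_closed[OF N P])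
      show "?B t (c \<odot>\<^bsub>P\<^esub> p) = c \<odot>\<^bsub>?T\<^esub> ?B t p" if p: "c \<in> carrier K" "p \<in> carrier P" for c p
        by (rule eqI[OF lift(1) module_hom_scale[OF T lift(1)]])
          (simp_all add: lift(2) p tens_simps[OF N P] tens_simps[OF M NP] tens_closed[OF N P])
    qed
  qed (rule lift(1))
  note res = tensor_lift[OF MN P T B]
  show "tensor_assoc K M N P \<in> module_hom K (tensor_space K ?MN P) ?T"
    unfolding tensor_assoc_def Let_def by (rule res(1))
  show "tensor_assoc K M N P (tens K ?MN P (tens K M N m n) p) = ?b p m n"
    if "m \<in> carrier M" "n \<in> carrier N" "p \<in> carrier P"
    unfolding tensor_assoc_def Let_def
    using that by (simp add: res(2) tens_closed[OF M N] lift(2))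
qed

text \<open>With \<open>p\<close> fixed, tensoring by \<open>p\<close> is linear, so the two-factor
  principle applies to the inner tensor product and then to the outer one.\<close>

lemma tensor3_hom_eqI:
  assumes M: "module K M" and N: "module K N" and P: "module K P" and Q: "module K Q"
    and f: "f \<in> module_hom K (tensor_space K (tensor_space K M N) P) Q"
    and g: "g \<in> module_hom K (tensor_space K (tensor_space K M N) P) Q"
    and eq: "\<And>m n p. \<lbrakk>m \<in> carrier M; n \<in> carrier N; p \<in> carrier P\<rbrakk> \<Longrightarrow>
      f (tens K (tensor_space K M N) P (tens K M N m n) p)
      = g (tens K (tensor_space K M N) P (tens K M N m n) p)"
    and t: "t \<in> carrier (tensor_space K (tensor_space K M N) P)"
  shows "f t = g t"
proof (rule tensor_hom_eqI[OF tensor_module[OF M N] P Q f g _ t])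
  fix s p assume s: "s \<in> carrier (tensor_space K M N)" and p: "p \<in> carrier P"
  note tp = bilinear_mapD(2)[OF tens_bilinear[OF tensor_module[OF M N] P] p]
  show "f (tens K (tensor_space K M N) P s p) = g (tens K (tensor_space K M N) P s p)"
    by (rule tensor_hom_eqI[OF M N Q module_hom_comp[OF tp f] module_hom_comp[OF tp g] eq[OF _ _ p] s])
qed

lemma tensor_assoc_natural:
  assumes M: "module K M" and N: "module K N" and P: "module K P"
    and M': "module K M'" and N': "module K N'" and P': "module K P'"
    and f: "f \<in> module_hom K M M'" and g: "g \<in> module_hom K N N'" and h: "h \<in> module_hom K P P'"
    and t: "t \<in> carrier (tensor_space K (tensor_space K M N) P)"
  shows "tensor_assoc K M' N' P' (tensor_map K (tensor_space K M N) P (tensor_space K M' N') P'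
      (tensor_map K M N M' N' f g) h t)
    = tensor_map K M (tensor_space K N P) M' (tensor_space K N' P') f (tensor_map K N P N' P' g h)
      (tensor_assoc K M N P t)"
proof -
  note mods = tensor_module[OF M N] tensor_module[OF N P] tensor_module[OF M' N'] tensor_module[OF N' P']
  note fg = tensor_map_hom[OF M N M' N' f g] and gh = tensor_map_hom[OF N P N' P' g h]
  note l = tensor_map_hom[OF mods(1) P mods(3) P' fg h]
    and r = tensor_map_hom[OF M mods(2) M' mods(4) f gh]
  show ?thesis
    by (rule tensor3_hom_eqI[OF M N P tensor_module[OF M' mods(4)]
          module_hom_comp[OF l tensor_assoc(1)[OF M' N' P']] module_hom_comp[OF tensor_assoc(1)[OF M N P] r] _ t])
      (simp add: tensor_map_tens[OF mods(1) P mods(3) P' fg h] tensor_map_tens[OF M N M' N' f g]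
        tensor_map_tens[OF M mods(2) M' mods(4) f gh] tensor_map_tens[OF N P N' P' g h]
        tensor_assoc(2)[OF M N P] tensor_assoc(2)[OF M' N' P']
        tens_closed[OF M N] tens_closed[OF N P] module_hom_in[OF f] module_hom_in[OF g] module_hom_in[OF h])
qed

section \<open>Slices and dual bases\<close>

text \<open>Contraction of the second leg with the functional \<phi>. The body coincides with the
  coefficient in \<open>coind_coact\<close> and, for \<phi> the counit, with the left side of the
  right counit axioms, so both can be read as slices.\<close>

definition slice ::
  "('k, 'r) ring_scheme \<Rightarrow> ('k, 'm) module \<Rightarrow> ('k, 'n) module \<Rightarrow> ('n \<Rightarrow> 'k)
    \<Rightarrow> ('k, 'm, 'n) tensor \<Rightarrow> 'm" where
  "slice K M N \<phi> t = tensor_runit K M (tensor_map K M N M (ground_space K) id \<phi> t)"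

context
  fixes K :: "('k, 'r) ring_scheme" and M :: "('k, 'm) module" and N :: "('k, 'n) module"
    and \<phi> :: "'n \<Rightarrow> 'k"
  assumes M: "module K M" and N: "module K N" and \<phi>: "\<phi> \<in> module_hom K N (ground_space K)"
begin

private lemma k: "module K (ground_space K)"
  by (rule ground_space_module) (rule module.axioms(1)[OF M])

lemma slice_hom: "slice K M N \<phi> \<in> module_hom K (tensor_space K M N) M"
  unfolding slice_def
  by (rule module_hom_comp[OF tensor_map_hom[OF M N M k module_hom_id \<phi>] tensor_runit(1)[OF M]])

lemma slice_tens:
  "\<lbrakk>m \<in> carrier M; n \<in> carrier N\<rbrakk> \<Longrightarrow> slice K M N \<phi> (tens K M N m n) = \<phi> n \<odot>\<^bsub>M\<^esub> m"
  using module_hom_in[OF \<phi>]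
  by (simp add: slice_def tensor_map_tens[OF M N M k module_hom_id \<phi>] tensor_runit(2)[OF M])

end

text \<open>\<open>f\<close> acts on the first leg and \<phi> on the second. Below, \<open>f\<close>
  is an evaluation, a comultiplication or a map of comodules.\<close>

lemma slice_natural:
  assumes M: "module K M" and M': "module K M'" and N: "module K N"
    and f: "f \<in> module_hom K M M'" and \<phi>: "\<phi> \<in> module_hom K N (ground_space K)"
    and t: "t \<in> carrier (tensor_space K M N)"
  shows "slice K M' N \<phi> (tensor_map K M N M' N f id t) = f (slice K M N \<phi> t)"
proof -
  note h = tensor_map_hom[OF M N M' N f module_hom_id]
  show ?thesis
    by (rule tensor_hom_eqI[OF M N M' module_hom_comp[OF h slice_hom[OF M' N \<phi>]]
          module_hom_comp[OF slice_hom[OF M N \<phi>] f] _ t])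
      (use module_hom_in[OF \<phi>] in \<open>simp add: tensor_map_tens[OF M N M' N f module_hom_id]
        slice_tens[OF M' N \<phi>] slice_tens[OF M N \<phi>] module_hom_in[OF f] module_hom_smult[OF f]\<close>)
qed

text \<open>Contracting the third leg does not depend on the bracketing, so the associator
  disappears from the identity.\<close>

lemma slice_assoc:
  assumes M: "module K M" and N: "module K N" and P: "module K P"
    and \<phi>: "\<phi> \<in> module_hom K P (ground_space K)"
    and t: "t \<in> carrier (tensor_space K (tensor_space K M N) P)"
  shows "tensor_map K M (tensor_space K N P) M N id (slice K N P \<phi>) (tensor_assoc K M N P t)
    = slice K (tensor_space K M N) P \<phi> t"
proof -
  note MN = tensor_module[OF M N] and NP = tensor_module[OF N P] and s = slice_hom[OF N P \<phi>]
  note h = tensor_map_hom[OF M NP M N module_hom_id s]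
  show ?thesis
    by (rule tensor3_hom_eqI[OF M N P MN module_hom_comp[OF tensor_assoc(1)[OF M N P] h]
          slice_hom[OF MN P \<phi>] _ t])
      (use module_hom_in[OF \<phi>] in \<open>simp add: tensor_assoc(2)[OF M N P]
        tensor_map_tens[OF M NP M N module_hom_id s] slice_tens[OF N P \<phi>] slice_tens[OF MN P \<phi>]
        tens_closed[OF M N] tens_closed[OF N P] tens_simps(4)[OF M N]\<close>)
qed

lemma dual_basesD:
  assumes "dual_bases K N B g"
  shows "finite B" and "vectorspace.basis K N B"
    and "b \<in> B \<Longrightarrow> g b \<in> module_hom K N (ground_space K)"
    and "\<lbrakk>b \<in> B; b' \<in> B\<rbrakk> \<Longrightarrow> g b b' = (if b = b' then \<one>\<^bsub>K\<^esub> else \<zero>\<^bsub>K\<^esub>)"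
  using assms by (auto simp: dual_bases_def)

context
  fixes K :: "('k, 'r) ring_scheme" and N :: "('k, 'n) module" and B :: "'n set"
    and g :: "'n \<Rightarrow> 'n \<Rightarrow> 'k"
  assumes N: "vectorspace K N" and dual: "dual_bases K N B g"
begin

interpretation N: vectorspace K N by (rule N)

private lemma mod: "module K N" ..

lemma dual_bases_carrier: "b \<in> B \<Longrightarrow> b \<in> carrier N"
  using dual_basesD(2)[OF dual] by (auto simp: N.basis_def)

lemma dual_bases_closed: "\<lbrakk>b \<in> B; n \<in> carrier N\<rbrakk> \<Longrightarrow> g b n \<in> carrier K"
  using module_hom_in[OF dual_basesD(3)[OF dual]] by simp

text \<open>Spanning provides some coefficients; applying \<open>g b\<close> to the resulting
  combination leaves, by duality, only the one at \<open>b\<close>.\<close>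

lemma dual_bases_expand:
  assumes n: "n \<in> carrier N"
  shows "n = (\<Oplus>\<^bsub>N\<^esub>b\<in>B. g b n \<odot>\<^bsub>N\<^esub> b)"
proof -
  have B: "finite B" "B \<subseteq> carrier N" "N.gen_set B"
    using dual_basesD(1,2)[OF dual] by (auto simp: N.basis_def)
  have "n \<in> {N.lincomb a B |a. a \<in> B \<rightarrow> carrier K}"
    unfolding N.finite_span[OF B(1,2), symmetric] B(3) by (rule n)
  then obtain a where a: "a \<in> B \<rightarrow> carrier K" and n_eq: "n = N.lincomb a B"
    by blast
  have a_in: "a b \<in> carrier K" if "b \<in> B" for b
    using a that by auto
  have "g b n = a b" if b: "b \<in> B" for b
  proof -
    interpret k: module K "ground_space K" by (rule ground_space_module) (rule N.R.is_cring)
    note gb = dual_basesD(3)[OF dual b]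
    have "g b n = (\<Oplus>\<^bsub>ground_space K\<^esub>b'\<in>B. g b (a b' \<odot>\<^bsub>N\<^esub> b'))"
      unfolding n_eq N.lincomb_def
      by (rule module_hom_finsum[OF mod k.module_axioms gb]) (auto simp: a_in dual_bases_carrier)
    also have "\<dots> = (\<Oplus>\<^bsub>ground_space K\<^esub>b'\<in>B. if b = b' then a b' else \<zero>\<^bsub>ground_space K\<^esub>)"
      by (rule k.M.finsum_cong')
        (auto simp: module_hom_smult[OF gb] a_in dual_bases_carrier dual_basesD(4)[OF dual b])
    also have "\<dots> = a b"
      using b a_in B(1) by (intro k.M.finsum_singleton) auto
    finally show ?thesis .
  qed
  then have "(\<Oplus>\<^bsub>N\<^esub>b\<in>B. g b n \<odot>\<^bsub>N\<^esub> b) = (\<Oplus>\<^bsub>N\<^esub>b\<in>B. a b \<odot>\<^bsub>N\<^esub> b)"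
    by (intro N.M.finsum_cong') (auto simp: a_in dual_bases_carrier)
  then show ?thesis
    by (simp add: n_eq N.lincomb_def)
qed

lemma dual_bases_hom_expand:
  assumes M: "module K M" and f: "f \<in> module_hom K N M" and n: "n \<in> carrier N"
  shows "f n = (\<Oplus>\<^bsub>M\<^esub>b\<in>B. g b n \<odot>\<^bsub>M\<^esub> f b)"
proof -
  interpret M: module K M by (rule M)
  have "f n = f (\<Oplus>\<^bsub>N\<^esub>b\<in>B. g b n \<odot>\<^bsub>N\<^esub> b)"
    by (rule arg_cong[OF dual_bases_expand[OF n]])
  also have "\<dots> = (\<Oplus>\<^bsub>M\<^esub>b\<in>B. f (g b n \<odot>\<^bsub>N\<^esub> b))"
    by (rule module_hom_finsum[OF mod M f])
      (auto simp: n dual_bases_closed dual_bases_carrier)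
  also have "\<dots> = (\<Oplus>\<^bsub>M\<^esub>b\<in>B. g b n \<odot>\<^bsub>M\<^esub> f b)"
    by (rule M.M.finsum_cong')
      (auto simp: n dual_bases_closed dual_bases_carrier module_hom_smult[OF f] module_hom_in[OF f])
  finally show ?thesis .
qed

text \<open>For a pure tensor this is the expansion of \<open>n\<close> in the basis, with each
  coefficient moved to the first leg, where it becomes the slice. Consequently a tensor is
  determined by its slices at the dual functionals.\<close>

lemma tensor_expand:
  assumes M: "module K M" and t: "t \<in> carrier (tensor_space K M N)"
  shows "t = (\<Oplus>\<^bsub>tensor_space K M N\<^esub>b\<in>B. tens K M N (slice K M N (g b) t) b)"
proof -
  let ?T = "tensor_space K M N"
  note T = tensor_module[OF M mod]
  interpret M: module K M by (rule M)
  interpret T: module K ?T by (rule T)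
  note gb = dual_basesD(3)[OF dual]
  have r: "(\<lambda>t. \<Oplus>\<^bsub>?T\<^esub>b\<in>B. tens K M N (slice K M N (g b) t) b) \<in> module_hom K ?T ?T"
    by (intro module_hom_sum[OF T] module_hom_comp[OF slice_hom[OF M mod gb]
          bilinear_mapD(2)[OF tens_bilinear[OF M mod]]] dual_bases_carrier)
  have "id t = (\<Oplus>\<^bsub>?T\<^esub>b\<in>B. tens K M N (slice K M N (g b) t) b)"
  proof (rule tensor_hom_eqI[OF M mod T module_hom_id r _ t])
    fix m n assume m: "m \<in> carrier M" and n: "n \<in> carrier N"
    have "tens K M N m n = (\<Oplus>\<^bsub>?T\<^esub>b\<in>B. g b n \<odot>\<^bsub>?T\<^esub> tens K M N m b)"
      by (rule dual_bases_hom_expand[OF T bilinear_mapD(1)[OF tens_bilinear[OF M mod] m] n])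
    also have "\<dots> = (\<Oplus>\<^bsub>?T\<^esub>b\<in>B. tens K M N (slice K M N (g b) (tens K M N m n)) b)"
      by (rule T.M.finsum_cong')
        (auto simp: slice_tens[OF M mod gb] m n dual_bases_closed dual_bases_carrier
          tens_simps(3)[OF M mod] tens_closed[OF M mod])
    finally show "id (tens K M N m n)
        = (\<Oplus>\<^bsub>?T\<^esub>b\<in>B. tens K M N (slice K M N (g b) (tens K M N m n)) b)"
      by simp
  qed
  then show ?thesis by simp
qed

end

section \<open>The coinduced comodule\<close>

lemma hom_space_simps:
  "carrier (hom_space K V W) = module_hom K V W \<inter> extensional (carrier V)"
  "\<zero>\<^bsub>hom_space K V W\<^esub> = (\<lambda>v\<in>carrier V. \<zero>\<^bsub>W\<^esub>)"
  "f \<oplus>\<^bsub>hom_space K V W\<^esub> h = (\<lambda>v\<in>carrier V. f v \<oplus>\<^bsub>W\<^esub> h v)"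
  "c \<odot>\<^bsub>hom_space K V W\<^esub> f = (\<lambda>v\<in>carrier V. c \<odot>\<^bsub>W\<^esub> f v)"
  by (simp_all add: hom_space_def)

lemma restrict_in_hom_space:
  assumes "module K V" "f \<in> module_hom K V W"
  shows "restrict f (carrier V) \<in> carrier (hom_space K V W)"
  using module_hom_cong[OF _ assms, of "restrict f (carrier V)"] by (simp add: hom_space_simps)

lemma hom_space_module:
  assumes V: "module K V" and W: "module K W"
  shows "module K (hom_space K V W)"
proof -
  let ?H = "hom_space K V W"
  interpret V: module K V by (rule V)
  interpret W: module K W by (rule W)
  note hom = restrict_in_hom_space[OF V]
  have in_W: "f v \<in> carrier W" if "f \<in> carrier ?H" "v \<in> carrier V" for f v
    using that module_hom_in by (auto simp: hom_space_simps)
  have Add: "f \<oplus>\<^bsub>?H\<^esub> h \<in> carrier ?H" if "f \<in> carrier ?H" "h \<in> carrier ?H" for f h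
    unfolding hom_space_simps(3)
    by (rule hom[OF module_hom_plus[OF W]]) (use that in \<open>simp_all add: hom_space_simps\<close>)
  have Smult: "c \<odot>\<^bsub>?H\<^esub> f \<in> carrier ?H" if "c \<in> carrier K" "f \<in> carrier ?H" for c f
    unfolding hom_space_simps(4)
    by (rule hom[OF module_hom_scale[OF W]]) (use that in \<open>simp_all add: hom_space_simps\<close>)
  have Zero: "\<zero>\<^bsub>?H\<^esub> \<in> carrier ?H"
    unfolding hom_space_simps(2) by (rule hom[OF module_hom_const_zero[OF W]])
  have Neg: "\<exists>h\<in>carrier ?H. f \<oplus>\<^bsub>?H\<^esub> h = \<zero>\<^bsub>?H\<^esub>" if f: "f \<in> carrier ?H" for f
  proof
    \<comment> \<open>With the multiple by minus one as witness, closure under scaling already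
      provides that the inverse is linear and extensional.\<close>
    show "(\<ominus>\<^bsub>K\<^esub> \<one>\<^bsub>K\<^esub>) \<odot>\<^bsub>?H\<^esub> f \<in> carrier ?H"
      using f by (intro Smult) auto
    show "f \<oplus>\<^bsub>?H\<^esub> (\<ominus>\<^bsub>K\<^esub> \<one>\<^bsub>K\<^esub>) \<odot>\<^bsub>?H\<^esub> f = \<zero>\<^bsub>?H\<^esub>"
      unfolding hom_space_simps
      by (intro restrict_ext) (simp add: in_W[OF f] W.smult_minus_1 W.M.r_neg)
  qed
  have Id: "\<forall>f\<in>carrier ?H. f \<oplus>\<^bsub>?H\<^esub> \<zero>\<^bsub>?H\<^esub> = f" "\<forall>f\<in>carrier ?H. \<one>\<^bsub>K\<^esub> \<odot>\<^bsub>?H\<^esub> f = f"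
    by (auto intro!: extensionalityI[of _ "carrier V"] simp: hom_space_simps module_hom_in)
  show ?thesis
  proof (rule module_criteria[OF module.axioms(1)[OF V] Zero _ _ _ _ _ Id(1) _ Id(2)])
  qed (use Add Smult Neg in \<open>auto intro!: restrict_ext
      simp: hom_space_simps(3,4) in_W W.M.a_ac W.smult_assoc1 W.smult_l_distr W.smult_r_distr\<close>)
qed

text \<open>The setting common to \<rho>, \<psi> and their direct sum, each of which instantiates
  it. The data are constrained at the neutral element, which is where the definition of
  \<open>Coind\<close> reads \<sigma>, the comodule and its coaction.\<close>

locale coinduction = H?: pi_coalgebra G K H \<Delta>H \<epsilon>H
  for G :: "('g, 's) monoid_scheme" (structure)
    and K :: "('k, 'r) ring_scheme"
    and H :: "'g \<Rightarrow> ('k, 'h) module"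
    and \<Delta>H :: "'g \<Rightarrow> 'g \<Rightarrow> 'h \<Rightarrow> ('k, 'h, 'h) tensor"
    and \<epsilon>H :: "'h \<Rightarrow> 'k" +
  fixes C :: "'g \<Rightarrow> ('k, 'c) module"
    and \<sigma> :: "'g \<Rightarrow> 'h \<Rightarrow> 'c"
    and V :: "'g \<Rightarrow> ('k, 'v) module"
    and \<rho> :: "'g \<Rightarrow> 'g \<Rightarrow> 'v \<Rightarrow> ('k, 'c, 'v) tensor"
    and B :: "'g \<Rightarrow> 'h set"
    and g :: "'g \<Rightarrow> 'h \<Rightarrow> 'h \<Rightarrow> 'k"
  assumes C_one: "module K (C \<one>)"
    and \<sigma>_one: "\<sigma> \<one> \<in> module_hom K (H \<one>) (C \<one>)"
    and V_one: "module K (V \<one>)"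
    and \<rho>_one: "v \<in> carrier (V \<one>) \<Longrightarrow> \<rho> \<one> \<one> v \<in> carrier (tensor_space K (C \<one>) (V \<one>))"
    and dual: "\<beta> \<in> carrier G \<Longrightarrow> dual_bases K (H \<beta>) (B \<beta>) (g \<beta>)"
begin

sublocale G: group G by (rule group)

abbreviation "E \<equiv> coind G K H \<Delta>H C \<sigma> V \<rho>"
abbreviation "L \<equiv> coind_L G K H \<Delta>H C \<sigma>"
abbreviation "\<theta> \<equiv> coind_coact G K H \<Delta>H C \<sigma> B g V \<rho>"

lemma H_module: "\<alpha> \<in> carrier G \<Longrightarrow> module K (H \<alpha>)"
  by (rule vectorspace.axioms(1)) (rule space)

lemma L_hom:
  assumes \<alpha>: "\<alpha> \<in> carrier G"
  shows "L \<alpha> \<in> module_hom K (H \<alpha>) (tensor_space K (C \<one>) (H \<alpha>))"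
proof -
  have \<Delta>: "\<Delta>H \<one> \<alpha> \<in> module_hom K (H \<alpha>) (tensor_space K (H \<one>) (H \<alpha>))"
    using comult_hom[of \<one> \<alpha>] \<alpha> by simp
  have "(\<lambda>x. L \<alpha> x) \<in> module_hom K (H \<alpha>) (tensor_space K (C \<one>) (H \<alpha>))"
    unfolding coind_L_def
    by (rule module_hom_comp[OF \<Delta> tensor_map_hom])
      (simp_all add: H_module \<alpha> C_one \<sigma>_one module_hom_id)
  then show ?thesis .
qed

lemma coind_simps:
  "F \<in> carrier (E \<alpha>) \<longleftrightarrow> F \<in> module_hom K (V \<one>) (H \<alpha>) \<and> F \<in> extensional (carrier (V \<one>)) \<and>
    (\<forall>v\<in>carrier (V \<one>). L \<alpha> (F v)
      = tensor_map K (C \<one>) (V \<one>) (C \<one>) (H \<alpha>) id F (\<rho> \<one> \<one> v))"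
  "\<zero>\<^bsub>E \<alpha>\<^esub> = (\<lambda>v\<in>carrier (V \<one>). \<zero>\<^bsub>H \<alpha>\<^esub>)"
  "F \<oplus>\<^bsub>E \<alpha>\<^esub> F' = (\<lambda>v\<in>carrier (V \<one>). F v \<oplus>\<^bsub>H \<alpha>\<^esub> F' v)"
  "c \<odot>\<^bsub>E \<alpha>\<^esub> F = (\<lambda>v\<in>carrier (V \<one>). c \<odot>\<^bsub>H \<alpha>\<^esub> F v)"
  by (auto simp: coind_def hom_space_def)

lemma coindD:
  assumes "F \<in> carrier (E \<alpha>)"
  shows "F \<in> module_hom K (V \<one>) (H \<alpha>)"
    and "v \<in> carrier (V \<one>) \<Longrightarrow> L \<alpha> (F v)
      = tensor_map K (C \<one>) (V \<one>) (C \<one>) (H \<alpha>) id F (\<rho> \<one> \<one> v)"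
  using assms by (simp_all add: coind_simps(1))

lemma coind_eqI:
  assumes "F \<in> carrier (E \<alpha>)" "F' \<in> carrier (E \<alpha>)" "\<And>v. v \<in> carrier (V \<one>) \<Longrightarrow> F v = F' v"
  shows "F = F'"
  using assms by (intro extensionalityI[of _ "carrier (V \<one>)"]) (simp_all add: coind_simps(1))

text \<open>The function occurs in the defining condition not only at \<open>v\<close> but also
  inside \<open>tensor_map\<close>; there the restriction is removed by
  \<open>tensor_map_cong\<close>.\<close>

lemma restrict_in_coind:
  assumes \<alpha>: "\<alpha> \<in> carrier G" and F: "F \<in> module_hom K (V \<one>) (H \<alpha>)"
    and eq: "\<And>v. v \<in> carrier (V \<one>) \<Longrightarrow> L \<alpha> (F v)
      = tensor_map K (C \<one>) (V \<one>) (C \<one>) (H \<alpha>) id F (\<rho> \<one> \<one> v)"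
  shows "restrict F (carrier (V \<one>)) \<in> carrier (E \<alpha>)"
proof -
  have "tensor_map K (C \<one>) (V \<one>) (C \<one>) (H \<alpha>) id (restrict F (carrier (V \<one>))) (\<rho> \<one> \<one> v)
      = tensor_map K (C \<one>) (V \<one>) (C \<one>) (H \<alpha>) id F (\<rho> \<one> \<one> v)" if "v \<in> carrier (V \<one>)" for v
    by (rule tensor_map_cong[OF C_one V_one C_one H_module[OF \<alpha>] module_hom_id F])
      (simp_all add: \<rho>_one that)
  then show ?thesis
    using restrict_in_hom_space[OF V_one F] eq by (simp add: coind_simps(1) hom_space_simps)
qed

text \<open>Both sides of the defining condition are linear in \<open>F\<close>: the left one since
  \<open>L\<close> is linear, the right one by linearity of the tensor product of maps in its second
  slot.\<close>

lemma coind_submodule: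
  assumes \<alpha>: "\<alpha> \<in> carrier G"
  shows "submodule K (carrier (E \<alpha>)) (hom_space K (V \<one>) (H \<alpha>))"
proof (rule submodule.intro)
  note H = H_module[OF \<alpha>]
  note T = tensor_module[OF C_one H]
  show "module K (hom_space K (V \<one>) (H \<alpha>))"
    by (rule hom_space_module[OF V_one H])
  show "carrier (E \<alpha>) \<subseteq> carrier (hom_space K (V \<one>) (H \<alpha>))"
    by (auto simp: coind_simps(1) hom_space_simps)
  note lin = tensor_map_right_linear[OF C_one V_one C_one H module_hom_id]
  show "F \<oplus>\<^bsub>hom_space K (V \<one>) (H \<alpha>)\<^esub> F' \<in> carrier (E \<alpha>)"
    if F: "F \<in> carrier (E \<alpha>)" and F': "F' \<in> carrier (E \<alpha>)" for F F'
    unfolding hom_space_simps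
  proof (rule restrict_in_coind[OF \<alpha> module_hom_plus[OF H coindD(1)[OF F] coindD(1)[OF F']]])
    fix v assume v: "v \<in> carrier (V \<one>)"
    show "L \<alpha> (F v \<oplus>\<^bsub>H \<alpha>\<^esub> F' v) = tensor_map K (C \<one>) (V \<one>) (C \<one>) (H \<alpha>) id
        (\<lambda>v. F v \<oplus>\<^bsub>H \<alpha>\<^esub> F' v) (\<rho> \<one> \<one> v)"
      by (simp add: lin(3)[OF coindD(1)[OF F] \<rho>_one[OF v] coindD(1)[OF F']] v
          coindD(2)[OF F] coindD(2)[OF F'] module_hom_add[OF L_hom[OF \<alpha>]]
          module_hom_in[OF coindD(1)[OF F]] module_hom_in[OF coindD(1)[OF F']])
  qed
  show "c \<odot>\<^bsub>hom_space K (V \<one>) (H \<alpha>)\<^esub> F \<in> carrier (E \<alpha>)"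
    if c: "c \<in> carrier K" and F: "F \<in> carrier (E \<alpha>)" for c F
    unfolding hom_space_simps
  proof (rule restrict_in_coind[OF \<alpha> module_hom_scale[OF H coindD(1)[OF F] c]])
    fix v assume v: "v \<in> carrier (V \<one>)"
    show "L \<alpha> (c \<odot>\<^bsub>H \<alpha>\<^esub> F v) = tensor_map K (C \<one>) (V \<one>) (C \<one>) (H \<alpha>) id
        (\<lambda>v. c \<odot>\<^bsub>H \<alpha>\<^esub> F v) (\<rho> \<one> \<one> v)"
      by (simp add: lin(2)[OF coindD(1)[OF F] \<rho>_one[OF v] c] v c
          coindD(2)[OF F] module_hom_smult[OF L_hom[OF \<alpha>]] module_hom_in[OF coindD(1)[OF F]])
  qed
  note z = module_hom_const_zero[OF H]
  show "\<zero>\<^bsub>hom_space K (V \<one>) (H \<alpha>)\<^esub> \<in> carrier (E \<alpha>)"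
    unfolding hom_space_simps
    by (rule restrict_in_coind[OF \<alpha> z])
      (simp add: lin(1)[OF z] \<rho>_one module_hom_zero[OF H T L_hom[OF \<alpha>]])
qed

lemma coind_module:
  assumes "\<alpha> \<in> carrier G"
  shows "module K (E \<alpha>)"
proof -
  note S = coind_submodule[OF assms]
  have "module K ((hom_space K (V \<one>) (H \<alpha>))\<lparr>carrier := carrier (E \<alpha>)\<rparr>)"
    by (rule module.submodule_is_module[OF submodule.module[OF S] S])
  then show ?thesis
    by (simp add: coind_def)
qed

lemma eval_hom: "v \<in> carrier (V \<one>) \<Longrightarrow> (\<lambda>F. F v) \<in> module_hom K (E \<alpha>) (H \<alpha>)"
  by (rule module_homI) (simp_all add: coind_simps(2-) module_hom_in[OF coindD(1)])

section \<open>The coefficients of the coaction\<close>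

definition component :: "'g \<Rightarrow> 'g \<Rightarrow> 'h \<Rightarrow> ('v \<Rightarrow> 'h) \<Rightarrow> 'v \<Rightarrow> 'h" where
  "component \<alpha> \<beta> b F = (\<lambda>v\<in>carrier (V \<one>). slice K (H \<alpha>) (H \<beta>) (g \<beta> b) (\<Delta>H \<alpha> \<beta> (F v)))"

lemma coact_eq:
  "\<theta> \<alpha> \<beta> F = (\<Oplus>\<^bsub>tensor_space K (E \<alpha>) (H \<beta>)\<^esub>b\<in>B \<beta>. tens K (E \<alpha>) (H \<beta>) (component \<alpha> \<beta> b F) b)"
  by (simp add: coind_coact_def component_def slice_def)

lemma dualD:
  assumes "\<beta> \<in> carrier G"
  shows "finite (B \<beta>)" and "b \<in> B \<beta> \<Longrightarrow> g \<beta> b \<in> module_hom K (H \<beta>) (ground_space K)"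
    and "b \<in> B \<beta> \<Longrightarrow> b \<in> carrier (H \<beta>)"
  using dual_basesD(1,3)[OF dual[OF assms]] dual_bases_carrier[OF space[OF assms] dual[OF assms]]
  by auto

text \<open>Coassociativity of \<open>H\<close> with the third leg contracted by \<phi>. Both sides
  then lie in a twofold tensor product and the associator is gone.\<close>

lemma slice_comult:
  assumes \<alpha>: "\<alpha> \<in> carrier G" and \<beta>: "\<beta> \<in> carrier G" and \<gamma>: "\<gamma> \<in> carrier G"
    and \<phi>: "\<phi> \<in> module_hom K (H \<gamma>) (ground_space K)"
    and x: "x \<in> carrier (H (\<alpha> \<otimes> \<beta> \<otimes> \<gamma>))"
  shows "\<Delta>H \<alpha> \<beta> (slice K (H (\<alpha> \<otimes> \<beta>)) (H \<gamma>) \<phi> (\<Delta>H (\<alpha> \<otimes> \<beta>) \<gamma> x))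
    = tensor_map K (H \<alpha>) (H (\<beta> \<otimes> \<gamma>)) (H \<alpha>) (H \<beta>) id
        (\<lambda>y. slice K (H \<beta>) (H \<gamma>) \<phi> (\<Delta>H \<beta> \<gamma> y)) (\<Delta>H \<alpha> (\<beta> \<otimes> \<gamma>) x)"
proof -
  have \<alpha>\<beta>: "\<alpha> \<otimes> \<beta> \<in> carrier G" and \<beta>\<gamma>: "\<beta> \<otimes> \<gamma> \<in> carrier G"
    using \<alpha> \<beta> \<gamma> by simp_all
  note H\<alpha> = H_module[OF \<alpha>] and H\<beta> = H_module[OF \<beta>] and H\<gamma> = H_module[OF \<gamma>]
    and H\<alpha>\<beta> = H_module[OF \<alpha>\<beta>] and H\<beta>\<gamma> = H_module[OF \<beta>\<gamma>]
  note T\<alpha>\<beta> = tensor_module[OF H\<alpha> H\<beta>] and T\<beta>\<gamma> = tensor_module[OF H\<beta> H\<gamma>]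
  note \<Delta>1 = comult_hom[OF \<alpha> \<beta>] and \<Delta>2 = comult_hom[OF \<beta> \<gamma>]
  note sl = slice_hom[OF H\<beta> H\<gamma> \<phi>]
  have t1: "\<Delta>H (\<alpha> \<otimes> \<beta>) \<gamma> x \<in> carrier (tensor_space K (H (\<alpha> \<otimes> \<beta>)) (H \<gamma>))"
    by (rule module_hom_in[OF comult_hom[OF \<alpha>\<beta> \<gamma>] x])
  \<comment> \<open>The spaces are indexed by group elements, so associativity in \<open>G\<close>
    identifies the domain of the two iterated comultiplications.\<close>
  have t2: "\<Delta>H \<alpha> (\<beta> \<otimes> \<gamma>) x \<in> carrier (tensor_space K (H \<alpha>) (H (\<beta> \<otimes> \<gamma>)))"
    by (rule module_hom_in[OF comult_hom[OF \<alpha> \<beta>\<gamma>]]) (use x \<alpha> \<beta> \<gamma> in \<open>simp add: G.m_assoc\<close>)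
  note u = module_hom_in[OF tensor_map_hom[OF H\<alpha>\<beta> H\<gamma> T\<alpha>\<beta> H\<gamma> \<Delta>1 module_hom_id] t1]
  \<comment> \<open>From right to left: \<open>slice_assoc\<close> removes the associator, and
    \<open>slice_natural\<close> exchanges the contraction with the comultiplication acting on the
    first leg.\<close>
  have "\<Delta>H \<alpha> \<beta> (slice K (H (\<alpha> \<otimes> \<beta>)) (H \<gamma>) \<phi> (\<Delta>H (\<alpha> \<otimes> \<beta>) \<gamma> x))
      = tensor_map K (H \<alpha>) (tensor_space K (H \<beta>) (H \<gamma>)) (H \<alpha>) (H \<beta>) id (slice K (H \<beta>) (H \<gamma>) \<phi>)
          (tensor_assoc K (H \<alpha>) (H \<beta>) (H \<gamma>)
            (tensor_map K (H (\<alpha> \<otimes> \<beta>)) (H \<gamma>) (tensor_space K (H \<alpha>) (H \<beta>)) (H \<gamma>)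
              (\<Delta>H \<alpha> \<beta>) id (\<Delta>H (\<alpha> \<otimes> \<beta>) \<gamma> x)))"
    by (simp only: slice_assoc[OF H\<alpha> H\<beta> H\<gamma> \<phi> u] slice_natural[OF H\<alpha>\<beta> T\<alpha>\<beta> H\<gamma> \<Delta>1 \<phi> t1])
  also have "\<dots> = tensor_map K (H \<alpha>) (H (\<beta> \<otimes> \<gamma>)) (H \<alpha>) (H \<beta>) id
        (\<lambda>y. slice K (H \<beta>) (H \<gamma>) \<phi> (\<Delta>H \<beta> \<gamma> y)) (\<Delta>H \<alpha> (\<beta> \<otimes> \<gamma>) x)"
    by (simp add: coassoc[OF \<alpha> \<beta> \<gamma> x] id_def[symmetric]
        tensor_map_comp[OF H\<alpha> H\<beta>\<gamma> H\<alpha> T\<beta>\<gamma> H\<alpha> H\<beta> module_hom_id \<Delta>2 module_hom_id sl t2])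
  finally show ?thesis .
qed

lemma component_hom:
  assumes \<alpha>: "\<alpha> \<in> carrier G" and \<beta>: "\<beta> \<in> carrier G"
    and \<phi>: "\<phi> \<in> module_hom K (H \<beta>) (ground_space K)"
  shows "(\<lambda>x. slice K (H \<alpha>) (H \<beta>) \<phi> (\<Delta>H \<alpha> \<beta> x)) \<in> module_hom K (H (\<alpha> \<otimes> \<beta>)) (H \<alpha>)"
  by (rule module_hom_comp[OF comult_hom[OF \<alpha> \<beta>] slice_hom[OF H_module[OF \<alpha>] H_module[OF \<beta>] \<phi>]])

text \<open>\<open>slice_comult\<close> at first index \<open>\<one>\<close>, followed by
  \<open>\<sigma> \<one>\<close> on the first leg. The map \<open>L\<close> splits off a leg on the
  left and the contraction removes one on the right, so the two commute.\<close>

lemma L_slice_comult: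
  assumes \<alpha>: "\<alpha> \<in> carrier G" and \<beta>: "\<beta> \<in> carrier G"
    and \<phi>: "\<phi> \<in> module_hom K (H \<beta>) (ground_space K)"
    and x: "x \<in> carrier (H (\<alpha> \<otimes> \<beta>))"
  shows "L \<alpha> (slice K (H \<alpha>) (H \<beta>) \<phi> (\<Delta>H \<alpha> \<beta> x))
    = tensor_map K (C \<one>) (H (\<alpha> \<otimes> \<beta>)) (C \<one>) (H \<alpha>) id
        (\<lambda>y. slice K (H \<alpha>) (H \<beta>) \<phi> (\<Delta>H \<alpha> \<beta> y)) (L (\<alpha> \<otimes> \<beta>) x)"
proof -
  have \<alpha>\<beta>: "\<alpha> \<otimes> \<beta> \<in> carrier G"
    using \<alpha> \<beta> by simp
  note H1 = H_module[OF G.one_closed] and H\<alpha> = H_module[OF \<alpha>] and H\<alpha>\<beta> = H_module[OF \<alpha>\<beta>]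
  note s = component_hom[OF \<alpha> \<beta> \<phi>]
  have t: "\<Delta>H \<one> (\<alpha> \<otimes> \<beta>) x \<in> carrier (tensor_space K (H \<one>) (H (\<alpha> \<otimes> \<beta>)))"
    by (rule module_hom_in[OF comult_hom[OF G.one_closed \<alpha>\<beta>]]) (use x \<alpha>\<beta> in simp)
  have "\<Delta>H \<one> \<alpha> (slice K (H \<alpha>) (H \<beta>) \<phi> (\<Delta>H \<alpha> \<beta> x))
    = tensor_map K (H \<one>) (H (\<alpha> \<otimes> \<beta>)) (H \<one>) (H \<alpha>) id
        (\<lambda>y. slice K (H \<alpha>) (H \<beta>) \<phi> (\<Delta>H \<alpha> \<beta> y)) (\<Delta>H \<one> (\<alpha> \<otimes> \<beta>) x)"
    using slice_comult[OF G.one_closed \<alpha> \<beta> \<phi>] x \<alpha> \<beta> by simp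
  then show ?thesis
    unfolding coind_L_def
    by (simp add: tensor_map_comp[OF H1 H\<alpha>\<beta> H1 H\<alpha> C_one H\<alpha> module_hom_id s \<sigma>_one module_hom_id t]
        tensor_map_comp[OF H1 H\<alpha>\<beta> C_one H\<alpha>\<beta> C_one H\<alpha> \<sigma>_one module_hom_id module_hom_id s t])
qed

text \<open>\<open>L_slice_comult\<close> moves the contraction outside \<open>L\<close>, the
  condition on \<open>F\<close> rewrites \<open>L (F v)\<close> as \<open>(I \<otimes> F)\<close>
  applied to the coaction of \<open>v\<close>, and the maps on the second leg compose. A pure tensor
  formed from a function outside the carrier would degenerate to zero, so the coaction has its
  intended meaning only because of this membership.\<close>

lemma component_closed:
  assumes \<alpha>: "\<alpha> \<in> carrier G" and \<beta>: "\<beta> \<in> carrier G" and b: "b \<in> B \<beta>"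
    and F: "F \<in> carrier (E (\<alpha> \<otimes> \<beta>))"
  shows "component \<alpha> \<beta> b F \<in> carrier (E \<alpha>)"
  unfolding component_def
proof (rule restrict_in_coind[OF \<alpha>])
  have \<alpha>\<beta>: "\<alpha> \<otimes> \<beta> \<in> carrier G"
    using \<alpha> \<beta> by simp
  note \<phi> = dualD(2)[OF \<beta> b]
  note s = component_hom[OF \<alpha> \<beta> \<phi>] and F_hom = coindD(1)[OF F]
  note H\<alpha> = H_module[OF \<alpha>] and H\<alpha>\<beta> = H_module[OF \<alpha>\<beta>]
  show "(\<lambda>v. slice K (H \<alpha>) (H \<beta>) (g \<beta> b) (\<Delta>H \<alpha> \<beta> (F v))) \<in> module_hom K (V \<one>) (H \<alpha>)"
    by (rule module_hom_comp[OF F_hom s])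
  fix v assume v: "v \<in> carrier (V \<one>)"
  show "L \<alpha> (slice K (H \<alpha>) (H \<beta>) (g \<beta> b) (\<Delta>H \<alpha> \<beta> (F v)))
    = tensor_map K (C \<one>) (V \<one>) (C \<one>) (H \<alpha>) id
        (\<lambda>v. slice K (H \<alpha>) (H \<beta>) (g \<beta> b) (\<Delta>H \<alpha> \<beta> (F v))) (\<rho> \<one> \<one> v)"
    by (simp add: L_slice_comult[OF \<alpha> \<beta> \<phi> module_hom_in[OF F_hom v]] coindD(2)[OF F v] id_def[symmetric]
        tensor_map_comp[OF C_one V_one C_one H\<alpha>\<beta> C_one H\<alpha> module_hom_id F_hom module_hom_id s
          \<rho>_one[OF v]])
qed

lemma component_linear:
  assumes \<alpha>: "\<alpha> \<in> carrier G" and \<beta>: "\<beta> \<in> carrier G" and b: "b \<in> B \<beta>"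
  shows "component \<alpha> \<beta> b \<in> module_hom K (E (\<alpha> \<otimes> \<beta>)) (E \<alpha>)"
proof (rule module_homI)
  note s = component_hom[OF \<alpha> \<beta> dualD(2)[OF \<beta> b]]
  show "component \<alpha> \<beta> b F \<in> carrier (E \<alpha>)" if "F \<in> carrier (E (\<alpha> \<otimes> \<beta>))" for F
    using component_closed[OF \<alpha> \<beta> b that] .
  show "component \<alpha> \<beta> b (F \<oplus>\<^bsub>E (\<alpha> \<otimes> \<beta>)\<^esub> F') = component \<alpha> \<beta> b F \<oplus>\<^bsub>E \<alpha>\<^esub> component \<alpha> \<beta> b F'"
    if "F \<in> carrier (E (\<alpha> \<otimes> \<beta>))" "F' \<in> carrier (E (\<alpha> \<otimes> \<beta>))" for F F'
    unfolding component_def coind_simps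
    by (rule restrict_ext)
      (simp add: module_hom_add[OF s] module_hom_in[OF coindD(1)] that)
  show "component \<alpha> \<beta> b (c \<odot>\<^bsub>E (\<alpha> \<otimes> \<beta>)\<^esub> F) = c \<odot>\<^bsub>E \<alpha>\<^esub> component \<alpha> \<beta> b F"
    if "c \<in> carrier K" "F \<in> carrier (E (\<alpha> \<otimes> \<beta>))" for c F
    unfolding component_def coind_simps
    by (rule restrict_ext)
      (simp add: module_hom_smult[OF s] module_hom_in[OF coindD(1)] that)
qed

lemma coact_linear:
  assumes \<alpha>: "\<alpha> \<in> carrier G" and \<beta>: "\<beta> \<in> carrier G"
  shows "\<theta> \<alpha> \<beta> \<in> module_hom K (E (\<alpha> \<otimes> \<beta>)) (tensor_space K (E \<alpha>) (H \<beta>))"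
proof -
  note T = tensor_module[OF coind_module[OF \<alpha>] H_module[OF \<beta>]]
  have "(\<lambda>F. \<theta> \<alpha> \<beta> F) \<in> module_hom K (E (\<alpha> \<otimes> \<beta>)) (tensor_space K (E \<alpha>) (H \<beta>))"
    unfolding coact_eq
    by (intro module_hom_sum[OF T] module_hom_comp[OF component_linear[OF \<alpha> \<beta>]]
        bilinear_mapD(2)[OF tens_bilinear[OF coind_module[OF \<alpha>] H_module[OF \<beta>]]] dualD(3)[OF \<beta>])
  then show ?thesis .
qed

end

text \<open>The values of \<open>f\<close> are expanded in the basis of \<open>P\<close>, which
  leaves basis vectors in the third leg; the associator moves the bracket off them. This is the
  shape in which the other side of coassociativity arises when the outer coaction is written
  out.\<close>

lemma tensor_map_right_expand:
  assumes M: "module K M" and N': "module K N'" and N: "module K N" and P: "vectorspace K P"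
    and dual: "dual_bases K P B g"
    and f: "f \<in> module_hom K N' (tensor_space K N P)"
    and t: "t \<in> carrier (tensor_space K M N')"
  shows "tensor_map K M N' M (tensor_space K N P) id f t
    = (\<Oplus>\<^bsub>tensor_space K M (tensor_space K N P)\<^esub>b\<in>B. tensor_assoc K M N P
        (tens K (tensor_space K M N) P (tensor_map K M N' M N id (\<lambda>n. slice K N P (g b) (f n)) t) b))"
proof -
  note P' = vectorspace.axioms(1)[OF P]
  let ?NP = "tensor_space K N P" and ?MN = "tensor_space K M N"
  let ?T = "tensor_space K M ?NP"
  note NP = tensor_module[OF N P'] and MN = tensor_module[OF M N]
  note T = tensor_module[OF M NP]
  interpret T: module K ?T by (rule T)
  note g = dual_basesD(3)[OF dual] and b_in = dual_bases_carrier[OF P dual]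
  note fg = module_hom_comp[OF f slice_hom[OF N P' g]]
  note tm = tensor_map_hom[OF M N' M N module_hom_id fg]
  note tP = bilinear_mapD(2)[OF tens_bilinear[OF MN P']] and tM = bilinear_mapD(1)[OF tens_bilinear[OF M NP]]
  have r: "(\<lambda>t. \<Oplus>\<^bsub>?T\<^esub>b\<in>B. tensor_assoc K M N P
        (tens K ?MN P (tensor_map K M N' M N id (\<lambda>n. slice K N P (g b) (f n)) t) b))
      \<in> module_hom K (tensor_space K M N') ?T"
    by (rule module_hom_sum[OF T])
      (rule module_hom_comp[OF module_hom_comp[OF tm tP[OF b_in]] tensor_assoc(1)[OF M N P']])
  show ?thesis
  proof (rule tensor_hom_eqI[OF M N' T tensor_map_hom[OF M N' M NP module_hom_id f] r _ t])
    fix m n assume m: "m \<in> carrier M" and n: "n \<in> carrier N'"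
    note s_in = module_hom_in[OF fg n]
    have "tens K M ?NP m (f n)
        = tens K M ?NP m (\<Oplus>\<^bsub>?NP\<^esub>b\<in>B. tens K N P (slice K N P (g b) (f n)) b)"
      by (rule arg_cong[OF tensor_expand[OF P dual N module_hom_in[OF f n]]])
    also have "\<dots> = (\<Oplus>\<^bsub>?T\<^esub>b\<in>B. tens K M ?NP m (tens K N P (slice K N P (g b) (f n)) b))"
      by (rule module_hom_finsum[OF NP T tM[OF m]]) (rule tens_closed[OF N P' s_in b_in])
    also have "\<dots> = (\<Oplus>\<^bsub>?T\<^esub>b\<in>B. tensor_assoc K M N P
        (tens K ?MN P (tensor_map K M N' M N id (\<lambda>n. slice K N P (g b) (f n)) (tens K M N' m n)) b))"
      by (rule T.M.finsum_cong')
        (simp_all add: tensor_map_tens[OF M N' M N module_hom_id fg m n] tensor_assoc(2)[OF M N P' m s_in b_in]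
          tens_closed[OF M NP m] tens_closed[OF N P' s_in b_in])
    finally show "tensor_map K M N' M ?NP id f (tens K M N' m n)
        = (\<Oplus>\<^bsub>?T\<^esub>b\<in>B. tensor_assoc K M N P
        (tens K ?MN P (tensor_map K M N' M N id (\<lambda>n. slice K N P (g b) (f n)) (tens K M N' m n)) b))"
      by (simp add: tensor_map_tens[OF M N' M NP module_hom_id f m n])
  qed
qed

section \<open>Separation by evaluations and the comodule axioms\<close>

context coinduction
begin

text \<open>Evaluation turns the summand at \<open>b\<close> into the slice of
  \<open>\<Delta>H \<alpha> \<beta> (F v)\<close> at \<open>g \<beta> b\<close>, tensored with
  \<open>b\<close>. By \<open>tensor_expand\<close> these add up to the whole element, so the basis
  drops out.\<close>

lemma eval_coact:
  assumes \<alpha>: "\<alpha> \<in> carrier G" and \<beta>: "\<beta> \<in> carrier G"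
    and F: "F \<in> carrier (E (\<alpha> \<otimes> \<beta>))" and v: "v \<in> carrier (V \<one>)"
  shows "tensor_map K (E \<alpha>) (H \<beta>) (H \<alpha>) (H \<beta>) (\<lambda>F. F v) id (\<theta> \<alpha> \<beta> F) = \<Delta>H \<alpha> \<beta> (F v)"
proof -
  let ?T = "tensor_space K (H \<alpha>) (H \<beta>)"
  note E\<alpha> = coind_module[OF \<alpha>] and H\<alpha> = H_module[OF \<alpha>] and H\<beta> = H_module[OF \<beta>]
  note T = tensor_module[OF H\<alpha> H\<beta>]
  interpret T: module K ?T by (rule T)
  note b_in = dualD(3)[OF \<beta>] and c_in = component_closed[OF \<alpha> \<beta> _ F] and ev = eval_hom[OF v]
  note \<Delta>F = module_hom_in[OF comult_hom[OF \<alpha> \<beta>] module_hom_in[OF coindD(1)[OF F] v]]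
  have "tensor_map K (E \<alpha>) (H \<beta>) (H \<alpha>) (H \<beta>) (\<lambda>F. F v) id (\<theta> \<alpha> \<beta> F)
      = (\<Oplus>\<^bsub>?T\<^esub>b\<in>B \<beta>. tensor_map K (E \<alpha>) (H \<beta>) (H \<alpha>) (H \<beta>) (\<lambda>F. F v) id
          (tens K (E \<alpha>) (H \<beta>) (component \<alpha> \<beta> b F) b))"
    unfolding coact_eq
    by (rule module_hom_finsum[OF tensor_module[OF E\<alpha> H\<beta>] T tensor_map_hom[OF E\<alpha> H\<beta> H\<alpha> H\<beta> ev module_hom_id]])
      (simp add: tens_closed[OF E\<alpha> H\<beta>] c_in b_in)
  also have "\<dots> = (\<Oplus>\<^bsub>?T\<^esub>b\<in>B \<beta>. tens K (H \<alpha>) (H \<beta>)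
      (slice K (H \<alpha>) (H \<beta>) (g \<beta> b) (\<Delta>H \<alpha> \<beta> (F v))) b)"
  proof (rule T.M.finsum_cong')
    show "tensor_map K (E \<alpha>) (H \<beta>) (H \<alpha>) (H \<beta>) (\<lambda>F. F v) id
          (tens K (E \<alpha>) (H \<beta>) (component \<alpha> \<beta> b F) b)
        = tens K (H \<alpha>) (H \<beta>) (slice K (H \<alpha>) (H \<beta>) (g \<beta> b) (\<Delta>H \<alpha> \<beta> (F v))) b"
      if b: "b \<in> B \<beta>" for b
      by (simp add: tensor_map_tens[OF E\<alpha> H\<beta> H\<alpha> H\<beta> ev module_hom_id c_in[OF b] b_in[OF b]])
        (simp add: component_def v)
    show "(\<lambda>b. tens K (H \<alpha>) (H \<beta>) (slice K (H \<alpha>) (H \<beta>) (g \<beta> b) (\<Delta>H \<alpha> \<beta> (F v))) b)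
        \<in> B \<beta> \<rightarrow> carrier ?T"
      by (intro Pi_I tens_closed[OF H\<alpha> H\<beta>] module_hom_in[OF slice_hom[OF H\<alpha> H\<beta> dualD(2)[OF \<beta>]] \<Delta>F] b_in)
  qed simp
  also have "\<dots> = \<Delta>H \<alpha> \<beta> (F v)"
    by (rule tensor_expand[OF space[OF \<beta>] dual[OF \<beta>] H\<alpha> \<Delta>F, symmetric])
  finally show ?thesis .
qed

lemma eval_slice:
  assumes \<alpha>: "\<alpha> \<in> carrier G" and \<beta>: "\<beta> \<in> carrier G" and v: "v \<in> carrier (V \<one>)"
    and \<phi>: "\<phi> \<in> module_hom K (H \<beta>) (ground_space K)"
    and t: "t \<in> carrier (tensor_space K (E \<alpha>) (H \<beta>))"
  shows "slice K (E \<alpha>) (H \<beta>) \<phi> t v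
    = slice K (H \<alpha>) (H \<beta>) \<phi> (tensor_map K (E \<alpha>) (H \<beta>) (H \<alpha>) (H \<beta>) (\<lambda>F. F v) id t)"
  using slice_natural[OF coind_module[OF \<alpha>] H_module[OF \<alpha>] H_module[OF \<beta>] eval_hom[OF v] \<phi> t]
  by simp

text \<open>A slice of \<open>s\<close> is a map on the carrier of \<open>V \<one>\<close>, hence
  known from its values, and by \<open>eval_slice\<close> the value at \<open>v\<close> is the slice
  of the evaluated tensor. The evaluations therefore fix all slices, and the slices fix the
  tensor.\<close>

lemma coind_tensor_eqI:
  assumes \<alpha>: "\<alpha> \<in> carrier G" and \<beta>: "\<beta> \<in> carrier G"
    and s: "s \<in> carrier (tensor_space K (E \<alpha>) (H \<beta>))"
    and t: "t \<in> carrier (tensor_space K (E \<alpha>) (H \<beta>))"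
    and eq: "\<And>v. v \<in> carrier (V \<one>) \<Longrightarrow>
      tensor_map K (E \<alpha>) (H \<beta>) (H \<alpha>) (H \<beta>) (\<lambda>F. F v) id s
      = tensor_map K (E \<alpha>) (H \<beta>) (H \<alpha>) (H \<beta>) (\<lambda>F. F v) id t"
  shows "s = t"
proof -
  let ?T = "tensor_space K (E \<alpha>) (H \<beta>)"
  note E\<alpha> = coind_module[OF \<alpha>] and H\<beta> = H_module[OF \<beta>]
  interpret T: module K ?T by (rule tensor_module[OF E\<alpha> H\<beta>])
  note g = dualD(2)[OF \<beta>]
  note sl = slice_hom[OF E\<alpha> H\<beta> g]
  have slices: "slice K (E \<alpha>) (H \<beta>) (g \<beta> b) s = slice K (E \<alpha>) (H \<beta>) (g \<beta> b) t" if b: "b \<in> B \<beta>" for b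
    by (rule coind_eqI[OF module_hom_in[OF sl[OF b] s] module_hom_in[OF sl[OF b] t]])
      (simp add: eval_slice[OF \<alpha> \<beta> _ g[OF b]] s t eq)
  have "s = (\<Oplus>\<^bsub>?T\<^esub>b\<in>B \<beta>. tens K (E \<alpha>) (H \<beta>) (slice K (E \<alpha>) (H \<beta>) (g \<beta> b) s) b)"
    by (rule tensor_expand[OF space[OF \<beta>] dual[OF \<beta>] E\<alpha> s])
  also have "\<dots> = (\<Oplus>\<^bsub>?T\<^esub>b\<in>B \<beta>. tens K (E \<alpha>) (H \<beta>) (slice K (E \<alpha>) (H \<beta>) (g \<beta> b) t) b)"
    by (rule T.M.finsum_cong')
      (auto simp: slices intro!: tens_closed[OF E\<alpha> H\<beta>] module_hom_in[OF sl t] dualD(3)[OF \<beta>])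
  also have "\<dots> = t"
    by (rule tensor_expand[OF space[OF \<beta>] dual[OF \<beta>] E\<alpha> t, symmetric])
  finally show ?thesis .
qed

text \<open>The coassociativity of the coaction, with the third leg contracted by
  \<open>g \<gamma> c\<close>. Both sides lie in \<open>Coind \<otimes> H\<close>, so evaluations
  may be compared, and at \<open>v\<close> the claim is \<open>slice_comult\<close> for
  \<open>F v\<close>.\<close>

lemma coact_component:
  assumes \<alpha>: "\<alpha> \<in> carrier G" and \<beta>: "\<beta> \<in> carrier G" and \<gamma>: "\<gamma> \<in> carrier G"
    and c: "c \<in> B \<gamma>" and F: "F \<in> carrier (E (\<alpha> \<otimes> \<beta> \<otimes> \<gamma>))"
  shows "\<theta> \<alpha> \<beta> (component (\<alpha> \<otimes> \<beta>) \<gamma> c F)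
    = tensor_map K (E \<alpha>) (H (\<beta> \<otimes> \<gamma>)) (E \<alpha>) (H \<beta>) id
        (\<lambda>y. slice K (H \<beta>) (H \<gamma>) (g \<gamma> c) (\<Delta>H \<beta> \<gamma> y)) (\<theta> \<alpha> (\<beta> \<otimes> \<gamma>) F)"
proof (rule coind_tensor_eqI[OF \<alpha> \<beta>])
  have \<alpha>\<beta>: "\<alpha> \<otimes> \<beta> \<in> carrier G" and \<beta>\<gamma>: "\<beta> \<otimes> \<gamma> \<in> carrier G"
    using \<alpha> \<beta> \<gamma> by simp_all
  note E\<alpha> = coind_module[OF \<alpha>] and H\<alpha> = H_module[OF \<alpha>] and H\<beta> = H_module[OF \<beta>] and H\<beta>\<gamma> = H_module[OF \<beta>\<gamma>]
  note \<phi> = dualD(2)[OF \<gamma> c]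
  note y = component_hom[OF \<beta> \<gamma> \<phi>] and Fc = component_closed[OF \<alpha>\<beta> \<gamma> c F]
  have F': "F \<in> carrier (E (\<alpha> \<otimes> (\<beta> \<otimes> \<gamma>)))"
    using F \<alpha> \<beta> \<gamma> by (simp add: G.m_assoc)
  note \<theta>F = module_hom_in[OF coact_linear[OF \<alpha> \<beta>\<gamma>] F']
  show "\<theta> \<alpha> \<beta> (component (\<alpha> \<otimes> \<beta>) \<gamma> c F) \<in> carrier (tensor_space K (E \<alpha>) (H \<beta>))"
    by (rule module_hom_in[OF coact_linear[OF \<alpha> \<beta>] Fc])
  show "tensor_map K (E \<alpha>) (H (\<beta> \<otimes> \<gamma>)) (E \<alpha>) (H \<beta>) id
        (\<lambda>y. slice K (H \<beta>) (H \<gamma>) (g \<gamma> c) (\<Delta>H \<beta> \<gamma> y)) (\<theta> \<alpha> (\<beta> \<otimes> \<gamma>) F)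
      \<in> carrier (tensor_space K (E \<alpha>) (H \<beta>))"
    by (rule module_hom_in[OF tensor_map_hom[OF E\<alpha> H\<beta>\<gamma> E\<alpha> H\<beta> module_hom_id y] \<theta>F])
  fix v assume v: "v \<in> carrier (V \<one>)"
  note ev = eval_hom[OF v]
  have "tensor_map K (E \<alpha>) (H \<beta>) (H \<alpha>) (H \<beta>) (\<lambda>F. F v) id (\<theta> \<alpha> \<beta> (component (\<alpha> \<otimes> \<beta>) \<gamma> c F))
      = \<Delta>H \<alpha> \<beta> (slice K (H (\<alpha> \<otimes> \<beta>)) (H \<gamma>) (g \<gamma> c) (\<Delta>H (\<alpha> \<otimes> \<beta>) \<gamma> (F v)))"
    by (simp add: eval_coact[OF \<alpha> \<beta> Fc v]) (simp add: component_def v)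
  also have "\<dots> = tensor_map K (H \<alpha>) (H (\<beta> \<otimes> \<gamma>)) (H \<alpha>) (H \<beta>) id
        (\<lambda>y. slice K (H \<beta>) (H \<gamma>) (g \<gamma> c) (\<Delta>H \<beta> \<gamma> y))
        (tensor_map K (E \<alpha>) (H (\<beta> \<otimes> \<gamma>)) (H \<alpha>) (H (\<beta> \<otimes> \<gamma>)) (\<lambda>F. F v) id (\<theta> \<alpha> (\<beta> \<otimes> \<gamma>) F))"
    by (simp only: slice_comult[OF \<alpha> \<beta> \<gamma> \<phi> module_hom_in[OF coindD(1)[OF F] v]]
        eval_coact[OF \<alpha> \<beta>\<gamma> F' v])
  also have "\<dots> = tensor_map K (E \<alpha>) (H \<beta>) (H \<alpha>) (H \<beta>) (\<lambda>F. F v) id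
      (tensor_map K (E \<alpha>) (H (\<beta> \<otimes> \<gamma>)) (E \<alpha>) (H \<beta>) id
        (\<lambda>y. slice K (H \<beta>) (H \<gamma>) (g \<gamma> c) (\<Delta>H \<beta> \<gamma> y)) (\<theta> \<alpha> (\<beta> \<otimes> \<gamma>) F))"
    by (simp add: tensor_map_comp[OF E\<alpha> H\<beta>\<gamma> H\<alpha> H\<beta>\<gamma> H\<alpha> H\<beta> ev module_hom_id module_hom_id y \<theta>F]
        tensor_map_comp[OF E\<alpha> H\<beta>\<gamma> E\<alpha> H\<beta> H\<alpha> H\<beta> module_hom_id y ev module_hom_id \<theta>F])
  finally show "tensor_map K (E \<alpha>) (H \<beta>) (H \<alpha>) (H \<beta>) (\<lambda>F. F v) id (\<theta> \<alpha> \<beta> (component (\<alpha> \<otimes> \<beta>) \<gamma> c F))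
    = tensor_map K (E \<alpha>) (H \<beta>) (H \<alpha>) (H \<beta>) (\<lambda>F. F v) id
      (tensor_map K (E \<alpha>) (H (\<beta> \<otimes> \<gamma>)) (E \<alpha>) (H \<beta>) id
        (\<lambda>y. slice K (H \<beta>) (H \<gamma>) (g \<gamma> c) (\<Delta>H \<beta> \<gamma> y)) (\<theta> \<alpha> (\<beta> \<otimes> \<gamma>) F))" .
qed

text \<open>Writing out the outer coaction gives one summand for each basis vector \<open>c\<close>
  in the third leg. Its coefficient is rewritten by \<open>coact_component\<close>, and the
  resulting sum is the expansion of the right side in
  \<open>tensor_map_right_expand\<close>.\<close>

lemma coact_coassoc:
  assumes \<alpha>: "\<alpha> \<in> carrier G" and \<beta>: "\<beta> \<in> carrier G" and \<gamma>: "\<gamma> \<in> carrier G"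
    and F: "F \<in> carrier (E (\<alpha> \<otimes> \<beta> \<otimes> \<gamma>))"
  shows "tensor_assoc K (E \<alpha>) (H \<beta>) (H \<gamma>)
      (tensor_map K (E (\<alpha> \<otimes> \<beta>)) (H \<gamma>) (tensor_space K (E \<alpha>) (H \<beta>)) (H \<gamma>) (\<theta> \<alpha> \<beta>) id
        (\<theta> (\<alpha> \<otimes> \<beta>) \<gamma> F))
    = tensor_map K (E \<alpha>) (H (\<beta> \<otimes> \<gamma>)) (E \<alpha>) (tensor_space K (H \<beta>) (H \<gamma>)) id (\<Delta>H \<beta> \<gamma>)
        (\<theta> \<alpha> (\<beta> \<otimes> \<gamma>) F)"
proof -
  have \<alpha>\<beta>: "\<alpha> \<otimes> \<beta> \<in> carrier G" and \<beta>\<gamma>: "\<beta> \<otimes> \<gamma> \<in> carrier G"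
    using \<alpha> \<beta> \<gamma> by simp_all
  note E\<alpha> = coind_module[OF \<alpha>] and E\<alpha>\<beta> = coind_module[OF \<alpha>\<beta>]
    and H\<beta> = H_module[OF \<beta>] and H\<gamma> = H_module[OF \<gamma>] and H\<beta>\<gamma> = H_module[OF \<beta>\<gamma>]
  let ?EH = "tensor_space K (E \<alpha>) (H \<beta>)"
  let ?T = "tensor_space K (E \<alpha>) (tensor_space K (H \<beta>) (H \<gamma>))"
  note EH = tensor_module[OF E\<alpha> H\<beta>] and T = tensor_module[OF E\<alpha> tensor_module[OF H\<beta> H\<gamma>]]
  interpret T: module K ?T by (rule T)
  have F': "F \<in> carrier (E (\<alpha> \<otimes> (\<beta> \<otimes> \<gamma>)))"
    using F \<alpha> \<beta> \<gamma> by (simp add: G.m_assoc)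
  note \<theta>F = module_hom_in[OF coact_linear[OF \<alpha> \<beta>\<gamma>] F']
  note \<theta>_hom = coact_linear[OF \<alpha> \<beta>] and c_in = dualD(3)[OF \<gamma>] and Fc = component_closed[OF \<alpha>\<beta> \<gamma> _ F]
  note \<theta>id = tensor_map_hom[OF E\<alpha>\<beta> H\<gamma> EH H\<gamma> \<theta>_hom module_hom_id]
  note assoc = module_hom_comp[OF \<theta>id tensor_assoc(1)[OF E\<alpha> H\<beta> H\<gamma>]]
  have "tensor_assoc K (E \<alpha>) (H \<beta>) (H \<gamma>)
        (tensor_map K (E (\<alpha> \<otimes> \<beta>)) (H \<gamma>) ?EH (H \<gamma>) (\<theta> \<alpha> \<beta>) id (\<theta> (\<alpha> \<otimes> \<beta>) \<gamma> F))
      = (\<Oplus>\<^bsub>?T\<^esub>c\<in>B \<gamma>. tensor_assoc K (E \<alpha>) (H \<beta>) (H \<gamma>)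
          (tensor_map K (E (\<alpha> \<otimes> \<beta>)) (H \<gamma>) ?EH (H \<gamma>) (\<theta> \<alpha> \<beta>) id
            (tens K (E (\<alpha> \<otimes> \<beta>)) (H \<gamma>) (component (\<alpha> \<otimes> \<beta>) \<gamma> c F) c)))"
    \<comment> \<open>Only the outer coaction is written out; the inner one stays a linear map that
      is applied to the coefficients.\<close>
    unfolding coact_eq[of "\<alpha> \<otimes> \<beta>"]
    by (rule module_hom_finsum[OF tensor_module[OF E\<alpha>\<beta> H\<gamma>] T assoc])
      (simp add: tens_closed[OF E\<alpha>\<beta> H\<gamma>] Fc c_in)
  also have "\<dots> = (\<Oplus>\<^bsub>?T\<^esub>c\<in>B \<gamma>. tensor_assoc K (E \<alpha>) (H \<beta>) (H \<gamma>) (tens K ?EH (H \<gamma>)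
      (tensor_map K (E \<alpha>) (H (\<beta> \<otimes> \<gamma>)) (E \<alpha>) (H \<beta>) id
        (\<lambda>y. slice K (H \<beta>) (H \<gamma>) (g \<gamma> c) (\<Delta>H \<beta> \<gamma> y)) (\<theta> \<alpha> (\<beta> \<otimes> \<gamma>) F)) c))"
  proof (rule T.M.finsum_cong')
    show "tensor_assoc K (E \<alpha>) (H \<beta>) (H \<gamma>)
          (tensor_map K (E (\<alpha> \<otimes> \<beta>)) (H \<gamma>) ?EH (H \<gamma>) (\<theta> \<alpha> \<beta>) id
            (tens K (E (\<alpha> \<otimes> \<beta>)) (H \<gamma>) (component (\<alpha> \<otimes> \<beta>) \<gamma> c F) c))
        = tensor_assoc K (E \<alpha>) (H \<beta>) (H \<gamma>) (tens K ?EH (H \<gamma>)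
          (tensor_map K (E \<alpha>) (H (\<beta> \<otimes> \<gamma>)) (E \<alpha>) (H \<beta>) id
            (\<lambda>y. slice K (H \<beta>) (H \<gamma>) (g \<gamma> c) (\<Delta>H \<beta> \<gamma> y)) (\<theta> \<alpha> (\<beta> \<otimes> \<gamma>) F)) c)"
      if c: "c \<in> B \<gamma>" for c
      by (simp add: tensor_map_tens[OF E\<alpha>\<beta> H\<gamma> EH H\<gamma> \<theta>_hom module_hom_id Fc[OF c] c_in[OF c]]
          coact_component[OF \<alpha> \<beta> \<gamma> c F])
    show "(\<lambda>c. tensor_assoc K (E \<alpha>) (H \<beta>) (H \<gamma>) (tens K ?EH (H \<gamma>)
          (tensor_map K (E \<alpha>) (H (\<beta> \<otimes> \<gamma>)) (E \<alpha>) (H \<beta>) id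
            (\<lambda>y. slice K (H \<beta>) (H \<gamma>) (g \<gamma> c) (\<Delta>H \<beta> \<gamma> y)) (\<theta> \<alpha> (\<beta> \<otimes> \<gamma>) F)) c))
        \<in> B \<gamma> \<rightarrow> carrier ?T"
      by (intro Pi_I module_hom_in[OF tensor_assoc(1)[OF E\<alpha> H\<beta> H\<gamma>]] tens_closed[OF EH H\<gamma>]
          module_hom_in[OF tensor_map_hom[OF E\<alpha> H\<beta>\<gamma> E\<alpha> H\<beta> module_hom_id
              component_hom[OF \<beta> \<gamma> dualD(2)[OF \<gamma>]]] \<theta>F] c_in)
  qed simp
  also have "\<dots> = tensor_map K (E \<alpha>) (H (\<beta> \<otimes> \<gamma>)) (E \<alpha>) (tensor_space K (H \<beta>) (H \<gamma>)) id (\<Delta>H \<beta> \<gamma>)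
        (\<theta> \<alpha> (\<beta> \<otimes> \<gamma>) F)"
    by (rule tensor_map_right_expand[OF E\<alpha> H\<beta>\<gamma> H\<beta> space[OF \<gamma>] dual[OF \<gamma>] comult_hom[OF \<beta> \<gamma>] \<theta>F, symmetric])
  finally show ?thesis .
qed

text \<open>The left side is a slice at the counit. Its value at \<open>v\<close> is the contraction
  of \<open>\<Delta>H \<alpha> \<one> (F v)\<close> by the counit, which the right counit axiom of
  \<open>H\<close> identifies with \<open>F v\<close>.\<close>

lemma coact_counit:
  assumes \<alpha>: "\<alpha> \<in> carrier G" and F: "F \<in> carrier (E \<alpha>)"
  shows "tensor_runit K (E \<alpha>)
      (tensor_map K (E \<alpha>) (H \<one>) (E \<alpha>) (ground_space K) id \<epsilon>H (\<theta> \<alpha> \<one> F)) = F"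
proof -
  have F': "F \<in> carrier (E (\<alpha> \<otimes> \<one>))"
    using F \<alpha> by simp
  note \<theta>F = module_hom_in[OF coact_linear[OF \<alpha> G.one_closed] F']
  note sl = slice_hom[OF coind_module[OF \<alpha>] H_module[OF G.one_closed] counit_hom]
  have "slice K (E \<alpha>) (H \<one>) \<epsilon>H (\<theta> \<alpha> \<one> F) = F"
  proof (rule coind_eqI[OF module_hom_in[OF sl \<theta>F] F])
    fix v assume v: "v \<in> carrier (V \<one>)"
    show "slice K (E \<alpha>) (H \<one>) \<epsilon>H (\<theta> \<alpha> \<one> F) v = F v"
      using counit_right[OF \<alpha> module_hom_in[OF coindD(1)[OF F] v]]
      by (simp add: eval_slice[OF \<alpha> G.one_closed v counit_hom \<theta>F]
          eval_coact[OF \<alpha> G.one_closed F' v]) (simp add: slice_def)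
  qed
  then show ?thesis
    by (simp add: slice_def)
qed

lemma coind_comodule: "right_pi_comodule G K H \<Delta>H \<epsilon>H E \<theta>"
proof (intro right_pi_comodule.intro right_pi_comodule_axioms.intro pi_coalgebra_axioms)
  show "vectorspace K (E \<alpha>)" if "\<alpha> \<in> carrier G" for \<alpha>
    using coind_module[OF that] field by (rule vectorspace.intro)
qed (simp_all only: coact_linear coact_coassoc coact_counit)

end

section \<open>Direct sums\<close>

lemma tensor_map_id:
  assumes M: "module K M" and N: "module K N" and t: "t \<in> carrier (tensor_space K M N)"
  shows "tensor_map K M N M N id id t = t"
proof -
  have "tensor_map K M N M N id id t = id t"
    by (rule tensor_hom_eqI[OF M N tensor_module[OF M N]
          tensor_map_hom[OF M N M N module_hom_id module_hom_id] module_hom_id _ t])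
      (simp add: tensor_map_tens[OF M N M N module_hom_id module_hom_id])
  then show ?thesis by simp
qed

lemma tensor_map_left_plus:
  assumes M: "module K M" "module K N" "module K M'" "module K N'"
    and f: "f \<in> module_hom K M M'" and f': "f' \<in> module_hom K M M'" and g: "g \<in> module_hom K N N'"
    and t: "t \<in> carrier (tensor_space K M N)"
  shows "tensor_map K M N M' N' (\<lambda>m. f m \<oplus>\<^bsub>M'\<^esub> f' m) g t
    = tensor_map K M N M' N' f g t \<oplus>\<^bsub>tensor_space K M' N'\<^esub> tensor_map K M N M' N' f' g t"
proof -
  note T = tensor_module[OF M(3,4)]
  note ff' = module_hom_plus[OF M(3) f f']
  show ?thesis
    by (rule tensor_hom_eqI[OF M(1,2) T tensor_map_hom[OF M ff' g]
          module_hom_plus[OF T tensor_map_hom[OF M f g] tensor_map_hom[OF M f' g]] _ t])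
      (simp add: tensor_map_tens[OF M ff' g] tensor_map_tens[OF M f g] tensor_map_tens[OF M f' g]
        tens_simps[OF M(3,4)] module_hom_in[OF f] module_hom_in[OF f'] module_hom_in[OF g])
qed

text \<open>Every element of \<open>N \<alpha>\<close> has the form \<open>F \<alpha> x\<close>, and
  on such elements \<open>eq\<close> expresses the new coaction by the old one. Each axiom for
  \<open>N\<close> is thus the image under \<open>F\<close> of the axiom for
  \<open>M\<close>.\<close>

lemma right_pi_comodule_transport:
  fixes G (structure)
  assumes M: "right_pi_comodule G K C \<Delta> \<epsilon> M \<theta>"
    and N: "\<And>\<alpha>. \<alpha> \<in> carrier G \<Longrightarrow> vectorspace K (N \<alpha>)"
    and F: "\<And>\<alpha>. \<alpha> \<in> carrier G \<Longrightarrow> F \<alpha> \<in> module_hom K (M \<alpha>) (N \<alpha>)"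
    and surj: "\<And>\<alpha>. \<alpha> \<in> carrier G \<Longrightarrow> F \<alpha> ` carrier (M \<alpha>) = carrier (N \<alpha>)"
    and eq: "\<And>\<alpha> \<beta> x. \<lbrakk>\<alpha> \<in> carrier G; \<beta> \<in> carrier G; x \<in> carrier (M (\<alpha> \<otimes> \<beta>))\<rbrakk> \<Longrightarrow>
      \<theta>' \<alpha> \<beta> (F (\<alpha> \<otimes> \<beta>) x) = tensor_map K (M \<alpha>) (C \<beta>) (N \<alpha>) (C \<beta>) (F \<alpha>) id (\<theta> \<alpha> \<beta> x)"
  shows "right_pi_comodule G K C \<Delta> \<epsilon> N \<theta>'"
proof -
  interpret M: right_pi_comodule G K C \<Delta> \<epsilon> M \<theta> by (rule M)
  interpret group G by (rule M.group)
  have mM: "module K (M \<alpha>)" and mN: "module K (N \<alpha>)" and mC: "module K (C \<alpha>)"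
    if "\<alpha> \<in> carrier G" for \<alpha>
    using that M.comodule_space N M.space by (auto intro: vectorspace.axioms(1))
  have lift: "\<exists>x\<in>carrier (M \<alpha>). y = F \<alpha> x" if "\<alpha> \<in> carrier G" "y \<in> carrier (N \<alpha>)" for \<alpha> y
    using surj that by blast
  have hom: "\<theta>' \<alpha> \<beta> \<in> module_hom K (N (\<alpha> \<otimes> \<beta>)) (tensor_space K (N \<alpha>) (C \<beta>))"
    if \<alpha>: "\<alpha> \<in> carrier G" and \<beta>: "\<beta> \<in> carrier G" for \<alpha> \<beta>
  proof -
    have \<alpha>\<beta>: "\<alpha> \<otimes> \<beta> \<in> carrier G"
      using \<alpha> \<beta> by simp
    interpret M\<alpha>\<beta>: module K "M (\<alpha> \<otimes> \<beta>)" by (rule mM[OF \<alpha>\<beta>])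
    \<comment> \<open>The composite is linear because \<open>eq\<close> presents it as a composite
      of linear maps. Linearity of \<open>\<theta>' \<alpha> \<beta>\<close> itself then follows by
      lifting its arguments along \<open>F\<close>.\<close>
    have h: "(\<lambda>x. \<theta>' \<alpha> \<beta> (F (\<alpha> \<otimes> \<beta>) x)) \<in> module_hom K (M (\<alpha> \<otimes> \<beta>)) (tensor_space K (N \<alpha>) (C \<beta>))"
      by (rule module_hom_cong[OF eq[OF \<alpha> \<beta>] mM[OF \<alpha>\<beta>] module_hom_comp[OF M.coact_hom[OF \<alpha> \<beta>]
            tensor_map_hom[OF mM[OF \<alpha>] mC[OF \<beta>] mN[OF \<alpha>] mC[OF \<beta>] F[OF \<alpha>] module_hom_id]]])
    note F' = F[OF \<alpha>\<beta>]
    show ?thesis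
    proof (rule module_homI)
      fix y assume "y \<in> carrier (N (\<alpha> \<otimes> \<beta>))"
      then obtain x where x: "x \<in> carrier (M (\<alpha> \<otimes> \<beta>))" "y = F (\<alpha> \<otimes> \<beta>) x"
        using lift[OF \<alpha>\<beta>] by blast
      show "\<theta>' \<alpha> \<beta> y \<in> carrier (tensor_space K (N \<alpha>) (C \<beta>))"
        unfolding x(2) by (rule module_hom_in[OF h x(1)])
      show "\<theta>' \<alpha> \<beta> (c \<odot>\<^bsub>N (\<alpha> \<otimes> \<beta>)\<^esub> y) = c \<odot>\<^bsub>tensor_space K (N \<alpha>) (C \<beta>)\<^esub> \<theta>' \<alpha> \<beta> y"
        if "c \<in> carrier K" for c
        unfolding x(2) module_hom_smult[OF F' that x(1), symmetric]
        by (rule module_hom_smult[OF h that x(1)])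
      fix y' assume "y' \<in> carrier (N (\<alpha> \<otimes> \<beta>))"
      then obtain x' where x': "x' \<in> carrier (M (\<alpha> \<otimes> \<beta>))" "y' = F (\<alpha> \<otimes> \<beta>) x'"
        using lift[OF \<alpha>\<beta>] by blast
      show "\<theta>' \<alpha> \<beta> (y \<oplus>\<^bsub>N (\<alpha> \<otimes> \<beta>)\<^esub> y') = \<theta>' \<alpha> \<beta> y \<oplus>\<^bsub>tensor_space K (N \<alpha>) (C \<beta>)\<^esub> \<theta>' \<alpha> \<beta> y'"
        unfolding x(2) x'(2) module_hom_add[OF F' x(1) x'(1), symmetric]
        by (rule module_hom_add[OF h x(1) x'(1)])
    qed
  qed
  show ?thesis
  proof (intro right_pi_comodule.intro right_pi_comodule_axioms.intro M.pi_coalgebra_axioms N hom)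
    fix \<alpha> \<beta> \<gamma> y
    assume \<alpha>: "\<alpha> \<in> carrier G" and \<beta>: "\<beta> \<in> carrier G" and \<gamma>: "\<gamma> \<in> carrier G"
      and "y \<in> carrier (N (\<alpha> \<otimes> \<beta> \<otimes> \<gamma>))"
    then obtain x where x: "x \<in> carrier (M (\<alpha> \<otimes> \<beta> \<otimes> \<gamma>))" and y: "y = F (\<alpha> \<otimes> \<beta> \<otimes> \<gamma>) x"
      using lift by (meson m_closed)
    have \<alpha>\<beta>: "\<alpha> \<otimes> \<beta> \<in> carrier G" and \<beta>\<gamma>: "\<beta> \<otimes> \<gamma> \<in> carrier G"
      using \<alpha> \<beta> \<gamma> by simp_all
    have x': "x \<in> carrier (M (\<alpha> \<otimes> (\<beta> \<otimes> \<gamma>)))" and y': "y = F (\<alpha> \<otimes> (\<beta> \<otimes> \<gamma>)) x"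
      using x y \<alpha> \<beta> \<gamma> by (simp_all add: m_assoc)
    note M\<alpha> = mM[OF \<alpha>] and M\<alpha>\<beta> = mM[OF \<alpha>\<beta>] and N\<alpha> = mN[OF \<alpha>] and N\<alpha>\<beta> = mN[OF \<alpha>\<beta>]
      and C\<beta> = mC[OF \<beta>] and C\<gamma> = mC[OF \<gamma>] and C\<beta>\<gamma> = mC[OF \<beta>\<gamma>]
    note MC = tensor_module[OF M\<alpha> C\<beta>] and NC = tensor_module[OF N\<alpha> C\<beta>] and CC = tensor_module[OF C\<beta> C\<gamma>]
    note \<theta>x = module_hom_in[OF M.coact_hom[OF \<alpha>\<beta> \<gamma>] x] and \<theta>x' = module_hom_in[OF M.coact_hom[OF \<alpha> \<beta>\<gamma>] x']
    note \<theta> = M.coact_hom[OF \<alpha> \<beta>] and \<Delta> = M.comult_hom[OF \<beta> \<gamma>] and F\<alpha> = F[OF \<alpha>]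
    note id = module_hom_id
    note F_id = tensor_map_hom[OF M\<alpha> C\<beta> N\<alpha> C\<beta> F\<alpha> id]
    have "tensor_map K (N (\<alpha> \<otimes> \<beta>)) (C \<gamma>) (tensor_space K (N \<alpha>) (C \<beta>)) (C \<gamma>) (\<theta>' \<alpha> \<beta>) id
          (\<theta>' (\<alpha> \<otimes> \<beta>) \<gamma> y)
        = tensor_map K (M (\<alpha> \<otimes> \<beta>)) (C \<gamma>) (tensor_space K (N \<alpha>) (C \<beta>)) (C \<gamma>)
            (\<lambda>x. \<theta>' \<alpha> \<beta> (F (\<alpha> \<otimes> \<beta>) x)) (\<lambda>x. id (id x)) (\<theta> (\<alpha> \<otimes> \<beta>) \<gamma> x)"
      unfolding y eq[OF \<alpha>\<beta> \<gamma> x]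
      by (rule tensor_map_comp[OF M\<alpha>\<beta> C\<gamma> N\<alpha>\<beta> C\<gamma> NC C\<gamma> F[OF \<alpha>\<beta>] id hom[OF \<alpha> \<beta>] id \<theta>x])
    \<comment> \<open>Here \<open>eq\<close> enters a second time, for the inner coaction. It holds
      on the carrier only, hence the use of congruence; both coactions are now those of
      \<open>M\<close>.\<close>
    also have "\<dots> = tensor_map K (M (\<alpha> \<otimes> \<beta>)) (C \<gamma>) (tensor_space K (N \<alpha>) (C \<beta>)) (C \<gamma>)
          (\<lambda>x. tensor_map K (M \<alpha>) (C \<beta>) (N \<alpha>) (C \<beta>) (F \<alpha>) id (\<theta> \<alpha> \<beta> x)) (\<lambda>x. id (id x))
          (\<theta> (\<alpha> \<otimes> \<beta>) \<gamma> x)"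
      by (rule tensor_map_cong[OF M\<alpha>\<beta> C\<gamma> NC C\<gamma> module_hom_comp[OF \<theta> F_id] module_hom_comp[OF id id] _ _ \<theta>x])
        (simp_all add: eq[OF \<alpha> \<beta>])
    also have "\<dots> = tensor_map K (tensor_space K (M \<alpha>) (C \<beta>)) (C \<gamma>) (tensor_space K (N \<alpha>) (C \<beta>)) (C \<gamma>)
          (tensor_map K (M \<alpha>) (C \<beta>) (N \<alpha>) (C \<beta>) (F \<alpha>) id) id
          (tensor_map K (M (\<alpha> \<otimes> \<beta>)) (C \<gamma>) (tensor_space K (M \<alpha>) (C \<beta>)) (C \<gamma>) (\<theta> \<alpha> \<beta>) id
            (\<theta> (\<alpha> \<otimes> \<beta>) \<gamma> x))"
      by (rule tensor_map_comp[OF M\<alpha>\<beta> C\<gamma> MC C\<gamma> NC C\<gamma> \<theta> id F_id id \<theta>x, symmetric])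
    finally have "tensor_assoc K (N \<alpha>) (C \<beta>) (C \<gamma>)
        (tensor_map K (N (\<alpha> \<otimes> \<beta>)) (C \<gamma>) (tensor_space K (N \<alpha>) (C \<beta>)) (C \<gamma>) (\<theta>' \<alpha> \<beta>) id
          (\<theta>' (\<alpha> \<otimes> \<beta>) \<gamma> y))
      = tensor_map K (M \<alpha>) (tensor_space K (C \<beta>) (C \<gamma>)) (N \<alpha>) (tensor_space K (C \<beta>) (C \<gamma>)) (F \<alpha>)
          (tensor_map K (C \<beta>) (C \<gamma>) (C \<beta>) (C \<gamma>) id id)
          (tensor_map K (M \<alpha>) (C (\<beta> \<otimes> \<gamma>)) (M \<alpha>) (tensor_space K (C \<beta>) (C \<gamma>)) id (\<Delta> \<beta> \<gamma>)
            (\<theta> \<alpha> (\<beta> \<otimes> \<gamma>) x))"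
      by (simp only: tensor_assoc_natural[OF M\<alpha> C\<beta> C\<gamma> N\<alpha> C\<beta> C\<gamma> F\<alpha> id id
            module_hom_in[OF tensor_map_hom[OF M\<alpha>\<beta> C\<gamma> MC C\<gamma> \<theta> id] \<theta>x]]
          M.coact_assoc[OF \<alpha> \<beta> \<gamma> x])
    also have "\<dots> = tensor_map K (M \<alpha>) (C (\<beta> \<otimes> \<gamma>)) (N \<alpha>) (tensor_space K (C \<beta>) (C \<gamma>))
        (\<lambda>x. F \<alpha> (id x)) (\<lambda>c. tensor_map K (C \<beta>) (C \<gamma>) (C \<beta>) (C \<gamma>) id id (\<Delta> \<beta> \<gamma> c)) (\<theta> \<alpha> (\<beta> \<otimes> \<gamma>) x)"
      by (rule tensor_map_comp[OF M\<alpha> C\<beta>\<gamma> M\<alpha> CC N\<alpha> CC id \<Delta> F\<alpha> tensor_map_hom[OF C\<beta> C\<gamma> C\<beta> C\<gamma> id id] \<theta>x'])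
    \<comment> \<open>\<open>F\<close> acts on the first leg and the comultiplication on the second,
      so their order is immaterial. The inserted identities give the composite the form from which
      \<open>F\<close> is split off first, to be absorbed by \<open>eq\<close>.\<close>
    also have "\<dots> = tensor_map K (M \<alpha>) (C (\<beta> \<otimes> \<gamma>)) (N \<alpha>) (tensor_space K (C \<beta>) (C \<gamma>))
        (\<lambda>x. id (F \<alpha> x)) (\<lambda>c. \<Delta> \<beta> \<gamma> (id c)) (\<theta> \<alpha> (\<beta> \<otimes> \<gamma>) x)"
      by (rule tensor_map_cong[OF M\<alpha> C\<beta>\<gamma> N\<alpha> CC module_hom_comp[OF F\<alpha> id] module_hom_comp[OF id \<Delta>] _ _ \<theta>x'])
        (simp_all add: tensor_map_id[OF C\<beta> C\<gamma>] module_hom_in[OF \<Delta>])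
    also have "\<dots> = tensor_map K (N \<alpha>) (C (\<beta> \<otimes> \<gamma>)) (N \<alpha>) (tensor_space K (C \<beta>) (C \<gamma>)) id (\<Delta> \<beta> \<gamma>)
        (\<theta>' \<alpha> (\<beta> \<otimes> \<gamma>) y)"
      unfolding y' eq[OF \<alpha> \<beta>\<gamma> x']
      by (rule tensor_map_comp[OF M\<alpha> C\<beta>\<gamma> N\<alpha> C\<beta>\<gamma> N\<alpha> CC F\<alpha> id id \<Delta> \<theta>x', symmetric])
    finally show "tensor_assoc K (N \<alpha>) (C \<beta>) (C \<gamma>)
        (tensor_map K (N (\<alpha> \<otimes> \<beta>)) (C \<gamma>) (tensor_space K (N \<alpha>) (C \<beta>)) (C \<gamma>) (\<theta>' \<alpha> \<beta>) id
          (\<theta>' (\<alpha> \<otimes> \<beta>) \<gamma> y))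
      = tensor_map K (N \<alpha>) (C (\<beta> \<otimes> \<gamma>)) (N \<alpha>) (tensor_space K (C \<beta>) (C \<gamma>)) id (\<Delta> \<beta> \<gamma>)
          (\<theta>' \<alpha> (\<beta> \<otimes> \<gamma>) y)" .
  next
    fix \<alpha> y assume \<alpha>: "\<alpha> \<in> carrier G" and "y \<in> carrier (N \<alpha>)"
    then obtain x where x: "x \<in> carrier (M \<alpha>)" and y: "y = F \<alpha> x"
      using lift by blast
    have x': "x \<in> carrier (M (\<alpha> \<otimes> \<one>))" and y': "y = F (\<alpha> \<otimes> \<one>) x"
      using x y \<alpha> by simp_all
    note \<theta>x = module_hom_in[OF M.coact_hom[OF \<alpha> one_closed] x']
    have "slice K (N \<alpha>) (C \<one>) \<epsilon> (\<theta>' \<alpha> \<one> y) = F \<alpha> (slice K (M \<alpha>) (C \<one>) \<epsilon> (\<theta> \<alpha> \<one> x))"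
      unfolding y' eq[OF \<alpha> one_closed x']
      by (rule slice_natural[OF mM[OF \<alpha>] mN[OF \<alpha>] mC[OF one_closed] F[OF \<alpha>] M.counit_hom \<theta>x])
    then show "tensor_runit K (N \<alpha>)
        (tensor_map K (N \<alpha>) (C \<one>) (N \<alpha>) (ground_space K) id \<epsilon> (\<theta>' \<alpha> \<one> y)) = y"
      using M.coact_counit[OF \<alpha> x] by (simp add: slice_def y)
  qed
qed

section \<open>Inclusions, projections and pullback\<close>

lemma direct_sum_homs:
  assumes V: "module K V" and W: "module K W"
  shows "inj1 V W \<in> module_hom K V (direct_sum V W)" and "inj2 V W \<in> module_hom K W (direct_sum V W)"
    and "fst \<in> module_hom K (direct_sum V W) V" and "snd \<in> module_hom K (direct_sum V W) W"
  using mod_hom.f_hom[OF inj1_hom[OF V W]] mod_hom.f_hom[OF inj2_hom[OF V W]]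
  by (auto intro!: module_homI simp: direct_sum_def)

text \<open>Precomposition keeps the defining condition since
  \<open>(I \<otimes> F) (I \<otimes> j) = I \<otimes> F j\<close>. For the coactions, evaluating
  \<open>pull F\<close> at \<open>x\<close> is evaluating \<open>F\<close> at \<open>j x\<close>;
  under this evaluation both sides become the comultiplication of \<open>F (j x)\<close>, and
  evaluations separate.\<close>

lemma coind_pullback:
  fixes G (structure)
  assumes D: "coinduction G K H \<Delta>H \<epsilon>H C \<sigma> D \<delta> B g"
    and X: "coinduction G K H \<Delta>H \<epsilon>H C \<sigma> X \<xi> B g"
    and j: "j \<in> module_hom K (X \<one>) (D \<one>)"
    and \<delta>j: "\<forall>x\<in>carrier (X \<one>).
      \<delta> \<one> \<one> (j x) = tensor_map K (C \<one>) (X \<one>) (C \<one>) (D \<one>) id j (\<xi> \<one> \<one> x)"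
  defines "pull F \<equiv> (\<lambda>x\<in>carrier (X \<one>). F (j x))"
  shows "\<alpha> \<in> carrier G \<Longrightarrow>
      pull \<in> module_hom K (coind G K H \<Delta>H C \<sigma> D \<delta> \<alpha>) (coind G K H \<Delta>H C \<sigma> X \<xi> \<alpha>)"
    and "\<lbrakk>\<alpha> \<in> carrier G; \<beta> \<in> carrier G; F \<in> carrier (coind G K H \<Delta>H C \<sigma> D \<delta> (\<alpha> \<otimes> \<beta>))\<rbrakk> \<Longrightarrow>
      coind_coact G K H \<Delta>H C \<sigma> B g X \<xi> \<alpha> \<beta> (pull F)
      = tensor_map K (coind G K H \<Delta>H C \<sigma> D \<delta> \<alpha>) (H \<beta>) (coind G K H \<Delta>H C \<sigma> X \<xi> \<alpha>) (H \<beta>) pull id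
          (coind_coact G K H \<Delta>H C \<sigma> B g D \<delta> \<alpha> \<beta> F)"
proof -
  interpret D: coinduction G K H \<Delta>H \<epsilon>H C \<sigma> D \<delta> B g by (rule D)
  interpret X: coinduction G K H \<Delta>H \<epsilon>H C \<sigma> X \<xi> B g by (rule X)
  have jx: "j x \<in> carrier (D \<one>)" if "x \<in> carrier (X \<one>)" for x
    using module_hom_in[OF j that] .
  show pull: "pull \<in> module_hom K (D.E \<alpha>) (X.E \<alpha>)" if \<alpha>: "\<alpha> \<in> carrier G" for \<alpha>
  proof (rule module_homI)
    note H\<alpha> = D.H_module[OF \<alpha>]
    show "pull F \<in> carrier (X.E \<alpha>)" if F: "F \<in> carrier (D.E \<alpha>)" for F
      unfolding pull_def
    proof (rule X.restrict_in_coind[OF \<alpha>])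
      note F_hom = D.coindD(1)[OF F]
      show "(\<lambda>x. F (j x)) \<in> module_hom K (X \<one>) (H \<alpha>)"
        by (rule module_hom_comp[OF j F_hom])
      fix x assume x: "x \<in> carrier (X \<one>)"
      show "X.L \<alpha> (F (j x)) = tensor_map K (C \<one>) (X \<one>) (C \<one>) (H \<alpha>) id (\<lambda>x. F (j x)) (\<xi> \<one> \<one> x)"
        by (simp add: D.coindD(2)[OF F jx[OF x]] bspec[OF \<delta>j x] id_def[symmetric]
            tensor_map_comp[OF D.C_one X.V_one D.C_one D.V_one D.C_one H\<alpha> module_hom_id j
              module_hom_id F_hom X.\<rho>_one[OF x]])
    qed
  qed (auto simp: pull_def D.coind_simps(3,4) X.coind_simps(3,4) jx)
  show "X.\<theta> \<alpha> \<beta> (pull F) = tensor_map K (D.E \<alpha>) (H \<beta>) (X.E \<alpha>) (H \<beta>) pull id (D.\<theta> \<alpha> \<beta> F)"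
    if \<alpha>: "\<alpha> \<in> carrier G" and \<beta>: "\<beta> \<in> carrier G" and F: "F \<in> carrier (D.E (\<alpha> \<otimes> \<beta>))" for \<alpha> \<beta> F
  proof (rule X.coind_tensor_eqI[OF \<alpha> \<beta>])
    have \<alpha>\<beta>: "\<alpha> \<otimes> \<beta> \<in> carrier G"
      using \<alpha> \<beta> by simp
    note D\<alpha> = D.coind_module[OF \<alpha>] and X\<alpha> = X.coind_module[OF \<alpha>]
      and H\<alpha> = D.H_module[OF \<alpha>] and H\<beta> = D.H_module[OF \<beta>]
    note pF = module_hom_in[OF pull[OF \<alpha>\<beta>] F] and \<theta>F = module_hom_in[OF D.coact_linear[OF \<alpha> \<beta>] F]
    note p = pull[OF \<alpha>] and id = module_hom_id
    show "X.\<theta> \<alpha> \<beta> (pull F) \<in> carrier (tensor_space K (X.E \<alpha>) (H \<beta>))"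
      by (rule module_hom_in[OF X.coact_linear[OF \<alpha> \<beta>] pF])
    show "tensor_map K (D.E \<alpha>) (H \<beta>) (X.E \<alpha>) (H \<beta>) pull id (D.\<theta> \<alpha> \<beta> F)
        \<in> carrier (tensor_space K (X.E \<alpha>) (H \<beta>))"
      by (rule module_hom_in[OF tensor_map_hom[OF D\<alpha> H\<beta> X\<alpha> H\<beta> p id] \<theta>F])
    fix x assume x: "x \<in> carrier (X \<one>)"
    note ev = X.eval_hom[OF x] and evj = D.eval_hom[OF jx[OF x]]
    have "tensor_map K (X.E \<alpha>) (H \<beta>) (H \<alpha>) (H \<beta>) (\<lambda>F. F x) id (X.\<theta> \<alpha> \<beta> (pull F))
        = tensor_map K (D.E \<alpha>) (H \<beta>) (H \<alpha>) (H \<beta>) (\<lambda>F. F (j x)) id (D.\<theta> \<alpha> \<beta> F)"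
      by (simp add: X.eval_coact[OF \<alpha> \<beta> pF x] D.eval_coact[OF \<alpha> \<beta> F jx[OF x]])
        (simp add: pull_def x)
    also have "\<dots> = tensor_map K (D.E \<alpha>) (H \<beta>) (H \<alpha>) (H \<beta>) (\<lambda>F. pull F x) (\<lambda>h. id (id h)) (D.\<theta> \<alpha> \<beta> F)"
      by (rule tensor_map_cong[OF D\<alpha> H\<beta> H\<alpha> H\<beta> module_hom_comp[OF p ev] module_hom_comp[OF id id] _ _ \<theta>F])
        (simp_all add: pull_def x)
    also have "\<dots> = tensor_map K (X.E \<alpha>) (H \<beta>) (H \<alpha>) (H \<beta>) (\<lambda>F. F x) id
        (tensor_map K (D.E \<alpha>) (H \<beta>) (X.E \<alpha>) (H \<beta>) pull id (D.\<theta> \<alpha> \<beta> F))"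
      by (rule tensor_map_comp[OF D\<alpha> H\<beta> X\<alpha> H\<beta> H\<alpha> H\<beta> p id ev id \<theta>F, symmetric])
    finally show "tensor_map K (X.E \<alpha>) (H \<beta>) (H \<alpha>) (H \<beta>) (\<lambda>F. F x) id (X.\<theta> \<alpha> \<beta> (pull F))
      = tensor_map K (X.E \<alpha>) (H \<beta>) (H \<alpha>) (H \<beta>) (\<lambda>F. F x) id
        (tensor_map K (D.E \<alpha>) (H \<beta>) (X.E \<alpha>) (H \<beta>) pull id (D.\<theta> \<alpha> \<beta> F))" .
  qed
qed

text \<open>Only the component of the coaction at \<open>(1, 1)\<close> enters the coinduced representation.\<close>

lemma left_sum_coact_one:
  fixes G (structure)
  assumes C: "module K (C \<one>)" and V: "module K (V \<one>)" and W: "module K (W \<one>)"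
    and \<rho>: "\<rho> \<one> \<one> \<in> module_hom K (V \<one>) (tensor_space K (C \<one>) (V \<one>))"
    and \<psi>: "\<psi> \<one> \<one> \<in> module_hom K (W \<one>) (tensor_space K (C \<one>) (W \<one>))"
  defines "D \<equiv> direct_sum_family V W \<one>"
    and "\<delta> \<equiv> left_sum_coact K C V \<rho> W \<psi> \<one> \<one>"
  shows "x \<in> carrier D \<Longrightarrow> \<delta> x \<in> carrier (tensor_space K (C \<one>) D)"
    and "\<forall>v\<in>carrier (V \<one>). \<delta> (inj1 (V \<one>) (W \<one>) v)
      = tensor_map K (C \<one>) (V \<one>) (C \<one>) D id (inj1 (V \<one>) (W \<one>)) (\<rho> \<one> \<one> v)"
    and "\<forall>w\<in>carrier (W \<one>). \<delta> (inj2 (V \<one>) (W \<one>) w)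
      = tensor_map K (C \<one>) (W \<one>) (C \<one>) D id (inj2 (V \<one>) (W \<one>)) (\<psi> \<one> \<one> w)"
    and "\<forall>x\<in>carrier D. \<rho> \<one> \<one> (fst x) = tensor_map K (C \<one>) D (C \<one>) (V \<one>) id fst (\<delta> x)"
    and "\<forall>x\<in>carrier D. \<psi> \<one> \<one> (snd x) = tensor_map K (C \<one>) D (C \<one>) (W \<one>) id snd (\<delta> x)"
proof -
  let ?V = "V \<one>" and ?W = "W \<one>" and ?C = "C \<one>"
  have D_def': "D = direct_sum ?V ?W"
    by (simp add: D_def direct_sum_family_def)
  note homs = direct_sum_homs[OF V W, folded D_def'] and id = module_hom_id
  have D: "module K D"
    unfolding D_def' by (rule direct_sum_is_module[OF V W])
  note TV = tensor_module[OF C V] and TW = tensor_module[OF C W] and TD = tensor_module[OF C D]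
  interpret TV: module K "tensor_space K ?C ?V" by (rule TV)
  interpret TW: module K "tensor_space K ?C ?W" by (rule TW)
  interpret TD: module K "tensor_space K ?C D" by (rule TD)
  let ?i1 = "tensor_map K ?C ?V ?C D id (inj1 ?V ?W)" and ?i2 = "tensor_map K ?C ?W ?C D id (inj2 ?V ?W)"
  note i1 = tensor_map_hom[OF C V C D id homs(1)] and i2 = tensor_map_hom[OF C W C D id homs(2)]
  note p1 = tensor_map_hom[OF C D C V id homs(3)] and p2 = tensor_map_hom[OF C D C W id homs(4)]
  have \<delta>: "\<delta> x = ?i1 (\<rho> \<one> \<one> (fst x)) \<oplus>\<^bsub>tensor_space K ?C D\<^esub> ?i2 (\<psi> \<one> \<one> (snd x))" for x
    by (simp add: \<delta>_def left_sum_coact_def D_def')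
  have D_in: "fst x \<in> carrier ?V" "snd x \<in> carrier ?W" if "x \<in> carrier D" for x
    using that by (auto simp: D_def' direct_sum_def)
  have inj_simps: "fst (inj1 ?V ?W v) = v" "snd (inj1 ?V ?W v) = \<zero>\<^bsub>?W\<^esub>"
    "fst (inj2 ?V ?W w) = \<zero>\<^bsub>?V\<^esub>" "snd (inj2 ?V ?W w) = w" for v w
    by (simp_all add: inj1_def inj2_def)
  note \<rho>_in = module_hom_in[OF \<rho>] and \<psi>_in = module_hom_in[OF \<psi>]
  show "\<delta> x \<in> carrier (tensor_space K ?C D)" if "x \<in> carrier D" for x
    using D_in[OF that] by (simp add: \<delta> module_hom_in[OF i1] module_hom_in[OF i2] \<rho>_in \<psi>_in)
  show "\<forall>v\<in>carrier ?V. \<delta> (inj1 ?V ?W v) = ?i1 (\<rho> \<one> \<one> v)"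
    by (simp add: \<delta> inj_simps module_hom_zero[OF W TW \<psi>]
        module_hom_zero[OF TW TD i2] module_hom_in[OF i1] \<rho>_in)
  show "\<forall>w\<in>carrier ?W. \<delta> (inj2 ?V ?W w) = ?i2 (\<psi> \<one> \<one> w)"
    by (simp add: \<delta> inj_simps module_hom_zero[OF V TV \<rho>]
        module_hom_zero[OF TV TD i1] module_hom_in[OF i2] \<psi>_in)
  note i1' = module_hom_in[OF i1 \<rho>_in[OF D_in(1)]] and i2' = module_hom_in[OF i2 \<psi>_in[OF D_in(2)]]
  show "\<forall>x\<in>carrier D. \<rho> \<one> \<one> (fst x) = tensor_map K ?C D ?C ?V id fst (\<delta> x)"
  proof
    fix x assume x: "x \<in> carrier D"
    note t = \<rho>_in[OF D_in(1)[OF x]] and u = \<psi>_in[OF D_in(2)[OF x]]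
    \<comment> \<open>The projection \<open>fst\<close> undoes \<open>inj1\<close>, so this summand
      returns the coaction of the first component.\<close>
    have "tensor_map K ?C D ?C ?V id fst (?i1 (\<rho> \<one> \<one> (fst x))) = \<rho> \<one> \<one> (fst x)"
      by (simp add: tensor_map_comp[OF C V C D C V id homs(1) id homs(3) t] inj_simps
          id_def[symmetric] tensor_map_id[OF C V t])
    \<comment> \<open>The composite of \<open>fst\<close> with \<open>inj2\<close> is the zero map,
      and tensoring with it annihilates the other summand.\<close>
    moreover have "tensor_map K ?C D ?C ?V id fst (?i2 (\<psi> \<one> \<one> (snd x))) = \<zero>\<^bsub>tensor_space K ?C ?V\<^esub>"
      by (simp add: tensor_map_comp[OF C W C D C V id homs(2) id homs(3) u] inj_simps
          id_def[symmetric] tensor_map_right_linear(1)[OF C W C V id module_hom_const_zero[OF V] u])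
    ultimately show "\<rho> \<one> \<one> (fst x) = tensor_map K ?C D ?C ?V id fst (\<delta> x)"
      by (simp add: \<delta> module_hom_add[OF p1 i1'[OF x] i2'[OF x]] t)
  qed
  show "\<forall>x\<in>carrier D. \<psi> \<one> \<one> (snd x) = tensor_map K ?C D ?C ?W id snd (\<delta> x)"
  proof
    fix x assume x: "x \<in> carrier D"
    note t = \<rho>_in[OF D_in(1)[OF x]] and u = \<psi>_in[OF D_in(2)[OF x]]
    have "tensor_map K ?C D ?C ?W id snd (?i2 (\<psi> \<one> \<one> (snd x))) = \<psi> \<one> \<one> (snd x)"
      by (simp add: tensor_map_comp[OF C W C D C W id homs(2) id homs(4) u] inj_simps
          id_def[symmetric] tensor_map_id[OF C W u])
    moreover have "tensor_map K ?C D ?C ?W id snd (?i1 (\<rho> \<one> \<one> (fst x))) = \<zero>\<^bsub>tensor_space K ?C ?W\<^esub>"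
      by (simp add: tensor_map_comp[OF C V C D C W id homs(1) id homs(4) t] inj_simps
          id_def[symmetric] tensor_map_right_linear(1)[OF C V C W id module_hom_const_zero[OF W] t])
    ultimately show "\<psi> \<one> \<one> (snd x) = tensor_map K ?C D ?C ?W id snd (\<delta> x)"
      by (simp add: \<delta> module_hom_add[OF p2 i1'[OF x] i2'[OF x]] u)
  qed
qed

lemma (in left_coisotropic_subgroup) coinductionI:
  assumes "module K (V \<one>)"
    and "\<And>v. v \<in> carrier (V \<one>) \<Longrightarrow> \<rho> \<one> \<one> v \<in> carrier (tensor_space K (C \<one>) (V \<one>))"
    and "\<And>\<beta>. \<beta> \<in> carrier G \<Longrightarrow> dual_bases K (H \<beta>) (B \<beta>) (g \<beta>)"
  shows "coinduction G K H \<Delta>H \<epsilon>H C \<sigma> V \<rho> B g"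
proof (rule coinduction.intro[OF H.pi_coalgebra_axioms coinduction_axioms.intro])
  have "\<one> \<in> carrier G"
    using C.group by (simp add: group.is_monoid monoid.one_closed)
  then show "module K (C \<one>)" and "\<sigma> \<one> \<in> module_hom K (H \<one>) (C \<one>)"
    by (rule vectorspace.axioms(1)[OF C.space], rule proj_hom)
qed (fact assms)+

theorem theorem5p8:
  fixes G :: "('g, 's) monoid_scheme"
    and K :: "('k, 'r) ring_scheme"
    and H :: "'g \<Rightarrow> ('k, 'h) module"
    and \<Delta>H :: "'g \<Rightarrow> 'g \<Rightarrow> 'h \<Rightarrow> ('k, 'h, 'h) tensor"
    and \<epsilon>H :: "'h \<Rightarrow> 'k"
    and S :: "'g \<Rightarrow> 'h \<Rightarrow> 'h"
    and C :: "'g \<Rightarrow> ('k, 'c) module"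
    and \<Delta>C :: "'g \<Rightarrow> 'g \<Rightarrow> 'c \<Rightarrow> ('k, 'c, 'c) tensor"
    and \<epsilon>C :: "'c \<Rightarrow> 'k"
    and act :: "'g \<Rightarrow> 'h \<Rightarrow> 'c \<Rightarrow> 'c"
    and \<sigma> :: "'g \<Rightarrow> 'h \<Rightarrow> 'c"
    and V :: "'g \<Rightarrow> ('k, 'v) module"
    and \<rho> :: "'g \<Rightarrow> 'g \<Rightarrow> 'v \<Rightarrow> ('k, 'c, 'v) tensor"
    and W :: "'g \<Rightarrow> ('k, 'w) module"
    and \<psi> :: "'g \<Rightarrow> 'g \<Rightarrow> 'w \<Rightarrow> ('k, 'c, 'w) tensor"
    and B :: "'g \<Rightarrow> 'h set"
    and g :: "'g \<Rightarrow> 'h \<Rightarrow> 'h \<Rightarrow> 'k"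
  assumes hopf: "hopf_pi_coalgebra G K H \<Delta>H \<epsilon>H S"
    and fin_dim: "\<And>\<alpha>. \<alpha> \<in> carrier G \<Longrightarrow> vectorspace.fin_dim K (H \<alpha>)"
    and coisotropic: "left_coisotropic_subgroup G K H \<Delta>H \<epsilon>H S C \<Delta>C \<epsilon>C act \<sigma>"
    and V: "left_pi_comodule G K C \<Delta>C \<epsilon>C V \<rho>"
    and W: "left_pi_comodule G K C \<Delta>C \<epsilon>C W \<psi>"
    and dual: "\<And>\<beta>. \<beta> \<in> carrier G \<Longrightarrow> dual_bases K (H \<beta>) (B \<beta>) (g \<beta>)"
  shows "right_pi_comodule_iso G K H \<Delta>H \<epsilon>H
    (coind G K H \<Delta>H C \<sigma> (direct_sum_family V W) (left_sum_coact K C V \<rho> W \<psi>))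
    (coind_coact G K H \<Delta>H C \<sigma> B g (direct_sum_family V W) (left_sum_coact K C V \<rho> W \<psi>))
    (direct_sum_family (coind G K H \<Delta>H C \<sigma> V \<rho>) (coind G K H \<Delta>H C \<sigma> W \<psi>))
    (right_sum_coact K H
      (coind G K H \<Delta>H C \<sigma> V \<rho>) (coind_coact G K H \<Delta>H C \<sigma> B g V \<rho>)
      (coind G K H \<Delta>H C \<sigma> W \<psi>) (coind_coact G K H \<Delta>H C \<sigma> B g W \<psi>))"
proof -
  interpret Q: left_coisotropic_subgroup G K H \<Delta>H \<epsilon>H S C \<Delta>C \<epsilon>C act \<sigma> by (rule coisotropic)
  interpret V: left_pi_comodule G K C \<Delta>C \<epsilon>C V \<rho> by (rule V)
  interpret W: left_pi_comodule G K C \<Delta>C \<epsilon>C W \<psi> by (rule W)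
  interpret group G by (rule Q.C.group)
  let ?D = "direct_sum_family V W" and ?\<delta> = "left_sum_coact K C V \<rho> W \<psi>"
  note C1 = vectorspace.axioms(1)[OF Q.C.space[OF one_closed]]
    and V1 = vectorspace.axioms(1)[OF V.comodule_space[OF one_closed]]
    and W1 = vectorspace.axioms(1)[OF W.comodule_space[OF one_closed]]
  have D1: "module K (?D \<one>\<^bsub>G\<^esub>)"
    unfolding direct_sum_family_def by (rule direct_sum_is_module[OF V1 W1])
  have \<rho>: "\<rho> \<one>\<^bsub>G\<^esub> \<one>\<^bsub>G\<^esub> \<in> module_hom K (V \<one>\<^bsub>G\<^esub>) (tensor_space K (C \<one>\<^bsub>G\<^esub>) (V \<one>\<^bsub>G\<^esub>))"
    and \<psi>: "\<psi> \<one>\<^bsub>G\<^esub> \<one>\<^bsub>G\<^esub> \<in> module_hom K (W \<one>\<^bsub>G\<^esub>) (tensor_space K (C \<one>\<^bsub>G\<^esub>) (W \<one>\<^bsub>G\<^esub>))"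
    using V.coact_hom[OF one_closed one_closed] W.coact_hom[OF one_closed one_closed] by simp_all
  note \<delta> = left_sum_coact_one[where G = G and C = C and V = V and W = W and \<rho> = \<rho> and \<psi> = \<psi>, OF C1 V1 W1 \<rho> \<psi>]
  interpret EV: coinduction G K H \<Delta>H \<epsilon>H C \<sigma> V \<rho> B g
    by (rule Q.coinductionI) (rule V1 module_hom_in[OF \<rho>] dual, assumption?)+
  interpret EW: coinduction G K H \<Delta>H \<epsilon>H C \<sigma> W \<psi> B g
    by (rule Q.coinductionI) (rule W1 module_hom_in[OF \<psi>] dual, assumption?)+
  interpret ED: coinduction G K H \<Delta>H \<epsilon>H C \<sigma> ?D ?\<delta> B g
    by (rule Q.coinductionI) (rule D1 \<delta>(1) dual, assumption?)+
  note axV = EV.coinduction_axioms and axW = EW.coinduction_axioms and axD = ED.coinduction_axioms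
  note homs = direct_sum_homs[OF V1 W1, folded fun_cong[OF direct_sum_family_def, of V W]]
  let ?N = "direct_sum_family EV.E EW.E" and ?\<theta> = "right_sum_coact K H EV.E EV.\<theta> EW.E EW.\<theta>"
  let ?j1 = "inj1 (V \<one>\<^bsub>G\<^esub>) (W \<one>\<^bsub>G\<^esub>)" and ?j2 = "inj2 (V \<one>\<^bsub>G\<^esub>) (W \<one>\<^bsub>G\<^esub>)"
  define p1 where "p1 F = (\<lambda>v\<in>carrier (V \<one>\<^bsub>G\<^esub>). F (?j1 v))" for F :: "'v \<times> 'w \<Rightarrow> 'h"
  define p2 where "p2 F = (\<lambda>w\<in>carrier (W \<one>\<^bsub>G\<^esub>). F (?j2 w))" for F :: "'v \<times> 'w \<Rightarrow> 'h"
  define q1 where "q1 F = (\<lambda>x\<in>carrier (?D \<one>\<^bsub>G\<^esub>). F (fst x))" for F :: "'v \<Rightarrow> 'h"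
  define q2 where "q2 F = (\<lambda>x\<in>carrier (?D \<one>\<^bsub>G\<^esub>). F (snd x))" for F :: "'w \<Rightarrow> 'h"
  \<comment> \<open>No index \<alpha> occurs: restriction to the two summands does not refer to the
    target \<open>H \<alpha>\<close>, so a single function serves in all degrees.\<close>
  define \<Phi> where "\<Phi> F = (p1 F, p2 F)" for F :: "'v \<times> 'w \<Rightarrow> 'h"
  note p1 = coind_pullback[OF axD axV homs(1) \<delta>(2), folded p1_def]
    and p2 = coind_pullback[OF axD axW homs(2) \<delta>(3), folded p2_def]
    and q1 = coind_pullback(1)[OF axV axD homs(3) \<delta>(4), folded q1_def]
    and q2 = coind_pullback(1)[OF axW axD homs(4) \<delta>(5), folded q2_def]
  have N_eq: "?N \<alpha> = direct_sum (EV.E \<alpha>) (EW.E \<alpha>)" for \<alpha>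
    by (simp only: direct_sum_family_def)
  have D_eq: "?D \<one>\<^bsub>G\<^esub> = direct_sum (V \<one>\<^bsub>G\<^esub>) (W \<one>\<^bsub>G\<^esub>)"
    by (simp only: direct_sum_family_def)
  have N: "module K (?N \<alpha>)" if "\<alpha> \<in> carrier G" for \<alpha>
    unfolding N_eq by (rule direct_sum_is_module[OF EV.coind_module[OF that] EW.coind_module[OF that]])
  have \<Phi>_hom: "\<Phi> \<in> module_hom K (ED.E \<alpha>) (?N \<alpha>)" if "\<alpha> \<in> carrier G" for \<alpha>
    using module_hom_in[OF p1(1)[OF that]] module_hom_in[OF p2(1)[OF that]]
    by (intro module_homI) (simp_all add: \<Phi>_def N_eq direct_sum_def
        module_hom_add[OF p1(1)[OF that]] module_hom_add[OF p2(1)[OF that]]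
        module_hom_smult[OF p1(1)[OF that]] module_hom_smult[OF p2(1)[OF that]])
  have \<Phi>_bij: "bij_betw \<Phi> (carrier (ED.E \<alpha>)) (carrier (?N \<alpha>))" if \<alpha>: "\<alpha> \<in> carrier G" for \<alpha>
  \<comment> \<open>A pair of maps is glued to \<open>F1\<close> after \<open>fst\<close> plus
    \<open>F2\<close> after \<open>snd\<close>. Each summand is a pullback along a projection, hence
    lies in the coinduced space of the direct sum, which is closed under addition.\<close>
  proof (rule bij_betw_byWitness[where f' = "\<lambda>(F1, F2). q1 F1 \<oplus>\<^bsub>ED.E \<alpha>\<^esub> q2 F2"])
    note H\<alpha> = ED.H_module[OF \<alpha>]
    interpret H\<alpha>: module K "H \<alpha>" by (rule H\<alpha>)
    interpret E\<alpha>: module K "ED.E \<alpha>" by (rule ED.coind_module[OF \<alpha>])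
    interpret V1: module K "V \<one>\<^bsub>G\<^esub>" by (rule V1)
    interpret W1: module K "W \<one>\<^bsub>G\<^esub>" by (rule W1)
    note q1_in = module_hom_in[OF q1[OF \<alpha>]] and q2_in = module_hom_in[OF q2[OF \<alpha>]]
    note p1_in = module_hom_in[OF p1(1)[OF \<alpha>]] and p2_in = module_hom_in[OF p2(1)[OF \<alpha>]]
    note D_simps = D_eq direct_sum_def inj1_def inj2_def
    show "\<Phi> ` carrier (ED.E \<alpha>) \<subseteq> carrier (?N \<alpha>)"
      using module_hom_in[OF \<Phi>_hom[OF \<alpha>]] by blast
    show "(\<lambda>(F1, F2). q1 F1 \<oplus>\<^bsub>ED.E \<alpha>\<^esub> q2 F2) ` carrier (?N \<alpha>) \<subseteq> carrier (ED.E \<alpha>)"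
      by (auto simp: N_eq direct_sum_def q1_in q2_in)
    show "\<forall>F\<in>carrier (ED.E \<alpha>). (\<lambda>(F1, F2). q1 F1 \<oplus>\<^bsub>ED.E \<alpha>\<^esub> q2 F2) (\<Phi> F) = F"
    proof
      fix F assume F: "F \<in> carrier (ED.E \<alpha>)"
      have "q1 (p1 F) \<oplus>\<^bsub>ED.E \<alpha>\<^esub> q2 (p2 F) = F"
      proof (rule ED.coind_eqI[OF E\<alpha>.M.a_closed[OF q1_in[OF p1_in[OF F]] q2_in[OF p2_in[OF F]]] F])
        fix x assume x: "x \<in> carrier (?D \<one>\<^bsub>G\<^esub>)"
        then obtain v w where vw: "x = (v, w)" "v \<in> carrier (V \<one>\<^bsub>G\<^esub>)" "w \<in> carrier (W \<one>\<^bsub>G\<^esub>)"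
          by (auto simp: D_simps)
        have "(q1 (p1 F) \<oplus>\<^bsub>ED.E \<alpha>\<^esub> q2 (p2 F)) x = F (?j1 v) \<oplus>\<^bsub>H \<alpha>\<^esub> F (?j2 w)"
          using x vw by (simp add: ED.coind_simps(3) q1_def q2_def p1_def p2_def)
        \<comment> \<open>Additivity of \<open>F\<close>, applied to the decomposition of
          \<open>x\<close> into its two components.\<close>
        also have "\<dots> = F (?j1 v \<oplus>\<^bsub>?D \<one>\<^bsub>G\<^esub>\<^esub> ?j2 w)"
          using module_hom_in[OF homs(1)] module_hom_in[OF homs(2)] vw
          by (simp add: module_hom_add[OF ED.coindD(1)[OF F]])
        also have "?j1 v \<oplus>\<^bsub>?D \<one>\<^bsub>G\<^esub>\<^esub> ?j2 w = x"
          using vw by (simp add: D_simps)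
        finally show "(q1 (p1 F) \<oplus>\<^bsub>ED.E \<alpha>\<^esub> q2 (p2 F)) x = F x" .
      qed
      then show "(\<lambda>(F1, F2). q1 F1 \<oplus>\<^bsub>ED.E \<alpha>\<^esub> q2 F2) (\<Phi> F) = F"
        by (simp add: \<Phi>_def)
    qed
    show "\<forall>P\<in>carrier (?N \<alpha>). \<Phi> ((\<lambda>(F1, F2). q1 F1 \<oplus>\<^bsub>ED.E \<alpha>\<^esub> q2 F2) P) = P"
    proof
      fix P assume "P \<in> carrier (?N \<alpha>)"
      then obtain F1 F2 where P: "P = (F1, F2)"
        and F1: "F1 \<in> carrier (EV.E \<alpha>)" and F2: "F2 \<in> carrier (EW.E \<alpha>)"
        by (auto simp: N_eq direct_sum_def)
      note F1_hom = EV.coindD(1)[OF F1] and F2_hom = EW.coindD(1)[OF F2]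
      note q = E\<alpha>.M.a_closed[OF q1_in[OF F1] q2_in[OF F2]]
      have "p1 (q1 F1 \<oplus>\<^bsub>ED.E \<alpha>\<^esub> q2 F2) = F1"
      proof (rule EV.coind_eqI[OF p1_in[OF q] F1])
        fix v assume v: "v \<in> carrier (V \<one>\<^bsub>G\<^esub>)"
        \<comment> \<open>At \<open>inj1 v\<close> the projections return \<open>v\<close> and zero,
          and the linear map \<open>F2\<close> vanishes at zero. The second component is
          symmetric.\<close>
        then show "p1 (q1 F1 \<oplus>\<^bsub>ED.E \<alpha>\<^esub> q2 F2) v = F1 v"
          by (simp add: p1_def q1_def q2_def ED.coind_simps(3) D_simps
              module_hom_in[OF F1_hom] module_hom_zero[OF W1 H\<alpha> F2_hom])
      qed
      moreover have "p2 (q1 F1 \<oplus>\<^bsub>ED.E \<alpha>\<^esub> q2 F2) = F2"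
      proof (rule EW.coind_eqI[OF p2_in[OF q] F2])
        fix w assume w: "w \<in> carrier (W \<one>\<^bsub>G\<^esub>)"
        then show "p2 (q1 F1 \<oplus>\<^bsub>ED.E \<alpha>\<^esub> q2 F2) w = F2 w"
          by (simp add: p2_def q1_def q2_def ED.coind_simps(3) D_simps
              module_hom_in[OF F2_hom] module_hom_zero[OF V1 H\<alpha> F1_hom])
      qed
      ultimately show "\<Phi> ((\<lambda>(F1, F2). q1 F1 \<oplus>\<^bsub>ED.E \<alpha>\<^esub> q2 F2) P) = P"
        by (simp add: P \<Phi>_def)
    qed
  qed
  \<comment> \<open>\<Phi> is the sum of \<open>p1\<close> and \<open>p2\<close> followed by the
    inclusions of the two coinduced spaces, and the coaction on their direct sum is assembled with
    the same inclusions. What remains is the compatibility of \<open>p1\<close> and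
    \<open>p2\<close> with the coactions.\<close>
  have \<Phi>_coact: "?\<theta> \<alpha> \<beta> (\<Phi> F) = tensor_map K (ED.E \<alpha>) (H \<beta>) (?N \<alpha>) (H \<beta>) \<Phi> id (ED.\<theta> \<alpha> \<beta> F)"
    if \<alpha>: "\<alpha> \<in> carrier G" and \<beta>: "\<beta> \<in> carrier G" and F: "F \<in> carrier (ED.E (\<alpha> \<otimes>\<^bsub>G\<^esub> \<beta>))" for \<alpha> \<beta> F
  proof -
    let ?i1 = "inj1 (EV.E \<alpha>) (EW.E \<alpha>)" and ?i2 = "inj2 (EV.E \<alpha>) (EW.E \<alpha>)"
    note E\<alpha> = ED.coind_module[OF \<alpha>] and V\<alpha> = EV.coind_module[OF \<alpha>] and W\<alpha> = EW.coind_module[OF \<alpha>]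
      and N\<alpha> = N[OF \<alpha>] and H\<beta> = ED.H_module[OF \<beta>] and id = module_hom_id
    interpret V\<alpha>: module K "EV.E \<alpha>" by (rule V\<alpha>)
    interpret W\<alpha>: module K "EW.E \<alpha>" by (rule W\<alpha>)
    note i = direct_sum_homs[OF V\<alpha> W\<alpha>, folded fun_cong[OF direct_sum_family_def, of EV.E EW.E]]
    note \<theta>F = module_hom_in[OF ED.coact_linear[OF \<alpha> \<beta>] F]
    note ip1 = module_hom_comp[OF p1(1)[OF \<alpha>] i(1)] and ip2 = module_hom_comp[OF p2(1)[OF \<alpha>] i(2)]
    let ?tm = "\<lambda>f. tensor_map K (ED.E \<alpha>) (H \<beta>) (?N \<alpha>) (H \<beta>) f id (ED.\<theta> \<alpha> \<beta> F)"
    have "?\<theta> \<alpha> \<beta> (\<Phi> F)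
        = tensor_map K (EV.E \<alpha>) (H \<beta>) (?N \<alpha>) (H \<beta>) ?i1 id (EV.\<theta> \<alpha> \<beta> (p1 F))
          \<oplus>\<^bsub>tensor_space K (?N \<alpha>) (H \<beta>)\<^esub>
          tensor_map K (EW.E \<alpha>) (H \<beta>) (?N \<alpha>) (H \<beta>) ?i2 id (EW.\<theta> \<alpha> \<beta> (p2 F))"
      by (simp add: right_sum_coact_def \<Phi>_def N_eq)
    also have "\<dots> = ?tm (\<lambda>F. ?i1 (p1 F)) \<oplus>\<^bsub>tensor_space K (?N \<alpha>) (H \<beta>)\<^esub> ?tm (\<lambda>F. ?i2 (p2 F))"
      by (simp add: p1(2)[OF \<alpha> \<beta> F] p2(2)[OF \<alpha> \<beta> F] id_def[symmetric]
          tensor_map_comp[OF E\<alpha> H\<beta> V\<alpha> H\<beta> N\<alpha> H\<beta> p1(1)[OF \<alpha>] id i(1) id \<theta>F]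
          tensor_map_comp[OF E\<alpha> H\<beta> W\<alpha> H\<beta> N\<alpha> H\<beta> p2(1)[OF \<alpha>] id i(2) id \<theta>F])
    also have "\<dots> = ?tm (\<lambda>F. ?i1 (p1 F) \<oplus>\<^bsub>?N \<alpha>\<^esub> ?i2 (p2 F))"
      by (rule tensor_map_left_plus[OF E\<alpha> H\<beta> N\<alpha> H\<beta> ip1 ip2 id \<theta>F, symmetric])
    \<comment> \<open>The sum of the included components equals the pair after adding zeros, which
      is valid only for components in the carriers; hence an equality of maps on the carrier and a
      congruence.\<close>
    also have "\<dots> = ?tm \<Phi>"
      by (rule tensor_map_cong[OF E\<alpha> H\<beta> N\<alpha> H\<beta> \<Phi>_hom[OF \<alpha>] id _ _ \<theta>F])
        (simp_all add: \<Phi>_def N_eq direct_sum_def inj1_def inj2_def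
          module_hom_in[OF p1(1)[OF \<alpha>]] module_hom_in[OF p2(1)[OF \<alpha>]])
    finally show ?thesis .
  qed
  have "right_pi_comodule G K H \<Delta>H \<epsilon>H ?N ?\<theta>"
  proof (rule right_pi_comodule_transport[OF ED.coind_comodule _ \<Phi>_hom])
    show "vectorspace K (?N \<alpha>)" if "\<alpha> \<in> carrier G" for \<alpha>
      using N[OF that] Q.C.field by (rule vectorspace.intro)
    show "\<Phi> ` carrier (ED.E \<alpha>) = carrier (?N \<alpha>)" if "\<alpha> \<in> carrier G" for \<alpha>
      by (rule bij_betw_imp_surj_on[OF \<Phi>_bij[OF that]])
  qed (assumption | rule \<Phi>_coact)+
  then show ?thesis
    unfolding right_pi_comodule_iso_def
    using ED.coind_comodule \<Phi>_hom \<Phi>_bij \<Phi>_coact by (intro conjI exI[of _ "\<lambda>_. \<Phi>"]) auto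
qed

end
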